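(* Let $H$ be a Hopf algebra over a commutative ring $k$ with a modular pair in involution $(\delta,\sigma)$, let $A$ be a right $H$-comodule algebra, and let $Tr:A\to k$ be a $\delta$-trace which is $\sigma$-invariant. Then the maps $$\gamma:C_n(A)\to\widetilde H^{(\delta,\sigma)}_n,\qquad \gamma(a_0\otimes a_1\otimes\dots\otimes a_n)=\sum Tr\big(a_0a_1^{(0)}a_2^{(0)}\cdots a_n^{(0)}\big)\,a_1^{(1)}\otimes\dots\otimes a_n^{(1)}$$ define a cyclic map, i.e. a map of cyclic modules (commuting with all faces, degeneracies and cyclic operators).
   Context: $H$ has coproduct $\Delta(h)=\sum h^{(1)}\otimes h^{(2)}$, counit $\varepsilon$, antipode $S$; $\sigma\in H$ is grouplike, $\delta:H\to k$ is a character (unital algebra homomorphism); $S_\sigma(h)=\sigma S(h)$ and $\widetilde S_\sigma(h)=\sigma\sum\delta(h^{(2)})S(h^{(1)})$. $(\delta,\sigma)$ is a modular pair in involution if $\delta(\sigma)=1$ and $\widetilde S_\sigma^2=\mathrm{id}$. The cyclic module $\widetilde{H}^{(\delta,\sigma)}$: $\widetilde{H}^{(\delta,\sigma)}_n=H^{\otimes n}$ ($=k$ for $n=0$), with $d_0(h_1\otimes\dots\otimes h_n)=\varepsilon(h_1)h_2\otimes\dots\otimes h_n$; $d_i$ multiplies $h_i$ and $h_{i+1}$ for $1\le i\le n-1$; $d_n(h_1\otimes\dots\otimes h_n)=\delta(h_n)h_1\otimes\dots\otimes h_{n-1}$; $s_i$ ($0\le i\le n$) inserts $1$ after the $i$-th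 factor (in front if $i=0$); and $\tau_n(h_1\otimes\dots\otimes h_n)=\sum\delta(h_n^{(2)})S_\sigma(h_1^{(1)}\cdots h_n^{(1)})\otimes h_1^{(2)}\otimes\dots\otimes h_{n-1}^{(2)}$ ($\tau_0=\mathrm{id}$). A right $H$-comodule algebra is a unital $k$-algebra $A$ with a coassociative counital right coaction $\beta:A\to A\otimes H$, written $\beta(a)=\sum a^{(0)}\otimes a^{(1)}$ with $a^{(0)}\in A$, $a^{(1)}\in H$, which is an algebra map. A linear map $Tr:A\to k$ is a $\delta$-trace if $Tr(ab)=\sum Tr(b\,a^{(0)})\delta(a^{(1)})$ for all $a,b\in A$. It is $\sigma$-invariant if for all $a,b\in A$, $\sum Tr(a^{(0)}b)\,a^{(1)}=\sum Tr(a\,b^{(0)})\,S_\sigma(b^{(1)})$, equivalently $\sum Tr(a^{(0)})a^{(1)}=Tr(a)\sigma$ for all $a$. $C_*(A)$ is the usual cyclic module of the algebra $A$: $C_n(A)=A^{\otimes(n+1)}$; $d_i$ multiplies $a_i$ and $a_{i+1}$ for $0\le i\le n-1$; $d_n(a_0\otimes\dots\otimes a_n)=a_na_0\otimes a_1\otimes\dots\otimes a_{n-1}$; $s_i$ inserts $1$ after $a_i$; $\tau_n(a_0\otimes\dots\otimes a_n)=a_n\otimes a_0\otimes\dots\otimes a_{n-1}$. *)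

theory Defs
  imports "HOL-Algebra.Module" "HOL-Algebra.AbelCoset"
begin

section \<open>Modules, associative algebras and linear maps over a commutative ring\<close>

text \<open>The locale \<^locale>\<open>algebra\<close> of the library is restricted to commutative algebras.\<close>

locale assoc_algebra = module R A + ring A for R (structure) and A (structure) +
  assumes smult_mult_left:
      "\<lbrakk>c \<in> carrier R; x \<in> carrier A; y \<in> carrier A\<rbrakk> \<Longrightarrow>
        (c \<odot>\<^bsub>A\<^esub> x) \<otimes>\<^bsub>A\<^esub> y = c \<odot>\<^bsub>A\<^esub> (x \<otimes>\<^bsub>A\<^esub> y)"
    and smult_mult_right:
      "\<lbrakk>c \<in> carrier R; x \<in> carrier A; y \<in> carrier A\<rbrakk> \<Longrightarrow>
        x \<otimes>\<^bsub>A\<^esub> (c \<odot>\<^bsub>A\<^esub> y) = c \<odot>\<^bsub>A\<^esub> (x \<otimes>\<^bsub>A\<^esub> y)"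

definition base_module :: "('k, 'r) ring_scheme \<Rightarrow> ('k, 'k) module" where
  "base_module R = \<lparr>carrier = carrier R, mult = mult R, one = one R,
     zero = zero R, add = add R, smult = mult R\<rparr>"

definition linear_map ::
  "('k, 'r) ring_scheme \<Rightarrow> ('k, 'a, 'm) module_scheme \<Rightarrow> ('k, 'b, 'n) module_scheme \<Rightarrow> ('a \<Rightarrow> 'b) \<Rightarrow> bool"
  where "linear_map R M N f \<longleftrightarrow>
     f \<in> carrier M \<rightarrow> carrier N \<and>
     (\<forall>x\<in>carrier M. \<forall>y\<in>carrier M. f (x \<oplus>\<^bsub>M\<^esub> y) = f x \<oplus>\<^bsub>N\<^esub> f y) \<and>
     (\<forall>c\<in>carrier R. \<forall>x\<in>carrier M. f (c \<odot>\<^bsub>M\<^esub> x) = c \<odot>\<^bsub>N\<^esub> f x)"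

definition algebra_map ::
  "('k, 'r) ring_scheme \<Rightarrow> ('k, 'a, 'm) module_scheme \<Rightarrow> ('k, 'b, 'n) module_scheme \<Rightarrow> ('a \<Rightarrow> 'b) \<Rightarrow> bool"
  where "algebra_map R A B f \<longleftrightarrow> f \<in> ring_hom A B \<and> linear_map R A B f"

section \<open>Tensor products\<close>

text \<open>
  Tensor products are constructed as the free module on the pure tensors modulo the submodule
  generated by the multilinearity relations; the elements are cosets.  The constructions that are
  only modules leave the multiplicative fields of the record unspecified.
\<close>

definition free_mod :: "('k, 'r) ring_scheme \<Rightarrow> 'x set \<Rightarrow> ('k, 'x \<Rightarrow> 'k) module" where
  "free_mod R X = \<lparr>carrier = {t. (\<forall>x. t x \<in> carrier R) \<and> finite {x. t x \<noteq> \<zero>\<^bsub>R\<^esub>} \<and> {x. t x \<noteq> \<zero>\<^bsub>R\<^esub>} \<subseteq> X},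
     mult = undefined, one = undefined,
     zero = (\<lambda>_. \<zero>\<^bsub>R\<^esub>), add = (\<lambda>s t x. s x \<oplus>\<^bsub>R\<^esub> t x), smult = (\<lambda>c t x. c \<otimes>\<^bsub>R\<^esub> t x)\<rparr>"

definition free_gen :: "('k, 'r) ring_scheme \<Rightarrow> 'x \<Rightarrow> 'x \<Rightarrow> 'k" where
  "free_gen R x = (\<lambda>y. if y = x then \<one>\<^bsub>R\<^esub> else \<zero>\<^bsub>R\<^esub>)"

definition submodule_generated ::
  "('k, 'r) ring_scheme \<Rightarrow> ('k, 'a, 'm) module_scheme \<Rightarrow> 'a set \<Rightarrow> 'a set"
  where "submodule_generated R M B = \<Inter>{N. submodule N R M \<and> B \<subseteq> N}"

definition quot_mod :: "('k, 'a, 'm) module_scheme \<Rightarrow> 'a set \<Rightarrow> ('k, 'a set) module" where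
  "quot_mod M N = \<lparr>carrier = a_rcosets\<^bsub>M\<^esub> N, mult = undefined, one = undefined,
     zero = N, add = set_add M, smult = (\<lambda>c X. \<Union>x\<in>X. N +>\<^bsub>M\<^esub> (c \<odot>\<^bsub>M\<^esub> x))\<rparr>"

text \<open>
  The map out of a tensor product induced by a multilinear map \<open>f\<close> into \<open>P\<close>: the tensor
  represented by the formal sum of the \<open>t x \<cdot> x\<close> is sent to the sum of the \<open>t x \<cdot> f x\<close>,
  which does not depend on the representative.  With \<open>f\<close> on pairs, this is Sweedler summation:
  \<open>\<Sum> f(h\<^sup>1, h\<^sup>2)\<close> is \<open>tensor_lift R P f (\<Delta> h)\<close>.
\<close>

definition tensor_lift ::
  "('k, 'r) ring_scheme \<Rightarrow> ('k, 'p, 'm) module_scheme \<Rightarrow> ('x \<Rightarrow> 'p) \<Rightarrow> ('x \<Rightarrow> 'k) set \<Rightarrow> 'p"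
  where "tensor_lift R P f T =
     (THE p. \<forall>t\<in>T. p = (\<Oplus>\<^bsub>P\<^esub>x\<in>{x. t x \<noteq> \<zero>\<^bsub>R\<^esub>}. t x \<odot>\<^bsub>P\<^esub> f x))"

subsection \<open>Tensor product of two modules and of two algebras\<close>

definition tensor_rels ::
  "('k, 'r) ring_scheme \<Rightarrow> ('k, 'a, 'm) module_scheme \<Rightarrow> ('k, 'b, 'n) module_scheme \<Rightarrow> ('a \<times> 'b \<Rightarrow> 'k) set"
  where "tensor_rels R M N =
    (let F = free_mod R (carrier M \<times> carrier N); g = free_gen R in
      {g (x \<oplus>\<^bsub>M\<^esub> x', y) \<ominus>\<^bsub>F\<^esub> (g (x, y) \<oplus>\<^bsub>F\<^esub> g (x', y)) | x x' y.
          x \<in> carrier M \<and> x' \<in> carrier M \<and> y \<in> carrier N} \<union>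
      {g (x, y \<oplus>\<^bsub>N\<^esub> y') \<ominus>\<^bsub>F\<^esub> (g (x, y) \<oplus>\<^bsub>F\<^esub> g (x, y')) | x y y'.
          x \<in> carrier M \<and> y \<in> carrier N \<and> y' \<in> carrier N} \<union>
      {g (c \<odot>\<^bsub>M\<^esub> x, y) \<ominus>\<^bsub>F\<^esub> c \<odot>\<^bsub>F\<^esub> g (x, y) | c x y.
          c \<in> carrier R \<and> x \<in> carrier M \<and> y \<in> carrier N} \<union>
      {g (x, c \<odot>\<^bsub>N\<^esub> y) \<ominus>\<^bsub>F\<^esub> c \<odot>\<^bsub>F\<^esub> g (x, y) | c x y.
          c \<in> carrier R \<and> x \<in> carrier M \<and> y \<in> carrier N})"

definition tensor_null ::
  "('k, 'r) ring_scheme \<Rightarrow> ('k, 'a, 'm) module_scheme \<Rightarrow> ('k, 'b, 'n) module_scheme \<Rightarrow> ('a \<times> 'b \<Rightarrow> 'k) set"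
  where "tensor_null R M N =
    submodule_generated R (free_mod R (carrier M \<times> carrier N)) (tensor_rels R M N)"

definition tensor_mod ::
  "('k, 'r) ring_scheme \<Rightarrow> ('k, 'a, 'm) module_scheme \<Rightarrow> ('k, 'b, 'n) module_scheme \<Rightarrow>
    ('k, ('a \<times> 'b \<Rightarrow> 'k) set) module"
  where "tensor_mod R M N = quot_mod (free_mod R (carrier M \<times> carrier N)) (tensor_null R M N)"

definition tensor ::
  "('k, 'r) ring_scheme \<Rightarrow> ('k, 'a, 'm) module_scheme \<Rightarrow> ('k, 'b, 'n) module_scheme \<Rightarrow>
    'a \<Rightarrow> 'b \<Rightarrow> ('a \<times> 'b \<Rightarrow> 'k) set"
  where "tensor R M N x y =
    tensor_null R M N +>\<^bsub>free_mod R (carrier M \<times> carrier N)\<^esub> free_gen R (x, y)"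

definition tensor_mult ::
  "('k, 'r) ring_scheme \<Rightarrow> ('k, 'a, 'm) module_scheme \<Rightarrow> ('k, 'b, 'n) module_scheme \<Rightarrow>
    ('a \<times> 'b \<Rightarrow> 'k) set \<Rightarrow> ('a \<times> 'b \<Rightarrow> 'k) set \<Rightarrow> ('a \<times> 'b \<Rightarrow> 'k) set"
  where "tensor_mult R A B s t =
    tensor_lift R (tensor_mod R A B) (\<lambda>(x, y).
      tensor_lift R (tensor_mod R A B) (\<lambda>(x', y').
        tensor R A B (x \<otimes>\<^bsub>A\<^esub> x') (y \<otimes>\<^bsub>B\<^esub> y')) t) s"

definition tensor_alg ::
  "('k, 'r) ring_scheme \<Rightarrow> ('k, 'a, 'm) module_scheme \<Rightarrow> ('k, 'b, 'n) module_scheme \<Rightarrow>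
    ('k, ('a \<times> 'b \<Rightarrow> 'k) set) module"
  where "tensor_alg R A B =
    (tensor_mod R A B)\<lparr>mult := tensor_mult R A B, one := tensor R A B \<one>\<^bsub>A\<^esub> \<one>\<^bsub>B\<^esub>\<rparr>"

subsection \<open>Tensor powers\<close>

text \<open>
  The pure tensors of the \<open>n\<close>-th tensor power are indexed by lists of length \<open>n\<close>.  For \<open>n = 0\<close>
  there are no relations, so that the power is the free module of rank one on the empty list,
  i.e. a copy of the base ring.
\<close>

definition power_gens :: "('k, 'a, 'm) module_scheme \<Rightarrow> nat \<Rightarrow> 'a list set" where
  "power_gens M n = {xs. length xs = n \<and> set xs \<subseteq> carrier M}"

definition power_rels ::
  "('k, 'r) ring_scheme \<Rightarrow> ('k, 'a, 'm) module_scheme \<Rightarrow> nat \<Rightarrow> ('a list \<Rightarrow> 'k) set"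
  where "power_rels R M n =
    (let F = free_mod R (power_gens M n); g = free_gen R in
      {g (xs[i := x \<oplus>\<^bsub>M\<^esub> y]) \<ominus>\<^bsub>F\<^esub> (g (xs[i := x]) \<oplus>\<^bsub>F\<^esub> g (xs[i := y])) | xs i x y.
          xs \<in> power_gens M n \<and> i < n \<and> x \<in> carrier M \<and> y \<in> carrier M} \<union>
      {g (xs[i := c \<odot>\<^bsub>M\<^esub> x]) \<ominus>\<^bsub>F\<^esub> c \<odot>\<^bsub>F\<^esub> g (xs[i := x]) | xs i c x.
          xs \<in> power_gens M n \<and> i < n \<and> c \<in> carrier R \<and> x \<in> carrier M})"

definition power_null ::
  "('k, 'r) ring_scheme \<Rightarrow> ('k, 'a, 'm) module_scheme \<Rightarrow> nat \<Rightarrow> ('a list \<Rightarrow> 'k) set"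
  where "power_null R M n =
    submodule_generated R (free_mod R (power_gens M n)) (power_rels R M n)"

definition tensor_power ::
  "('k, 'r) ring_scheme \<Rightarrow> ('k, 'a, 'm) module_scheme \<Rightarrow> nat \<Rightarrow> ('k, ('a list \<Rightarrow> 'k) set) module"
  where "tensor_power R M n = quot_mod (free_mod R (power_gens M n)) (power_null R M n)"

definition tensor_list ::
  "('k, 'r) ring_scheme \<Rightarrow> ('k, 'a, 'm) module_scheme \<Rightarrow> 'a list \<Rightarrow> ('a list \<Rightarrow> 'k) set"
  where "tensor_list R M xs =
    power_null R M (length xs) +>\<^bsub>free_mod R (power_gens M (length xs))\<^esub> free_gen R xs"

section \<open>Hopf algebras and comodule algebras\<close>

text \<open>
  Both sides of the coassociativity laws are read in \<open>H \<otimes> (H \<otimes> H)\<close>, respectively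
  \<open>A \<otimes> (H \<otimes> H)\<close>.
\<close>

locale hopf_algebra = assoc_algebra R H for R (structure) and H (structure) +
  fixes \<Delta> :: "'h \<Rightarrow> ('h \<times> 'h \<Rightarrow> 'k) set" and \<epsilon> :: "'h \<Rightarrow> 'k" and S :: "'h \<Rightarrow> 'h"
  assumes comult_algebra_map: "algebra_map R H (tensor_alg R H H) \<Delta>"
    and counit_algebra_map: "algebra_map R H (base_module R) \<epsilon>"
    and antipode_linear: "linear_map R H H S"
    and coassoc: "h \<in> carrier H \<Longrightarrow>
      tensor_lift R (tensor_mod R H (tensor_mod R H H)) (\<lambda>(x, y).
        tensor_lift R (tensor_mod R H (tensor_mod R H H)) (\<lambda>(x', x'').
          tensor R H (tensor_mod R H H) x' (tensor R H H x'' y)) (\<Delta> x)) (\<Delta> h) =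
      tensor_lift R (tensor_mod R H (tensor_mod R H H)) (\<lambda>(x, y).
        tensor R H (tensor_mod R H H) x (\<Delta> y)) (\<Delta> h)"
    and counit_left: "h \<in> carrier H \<Longrightarrow> tensor_lift R H (\<lambda>(x, y). \<epsilon> x \<odot>\<^bsub>H\<^esub> y) (\<Delta> h) = h"
    and counit_right: "h \<in> carrier H \<Longrightarrow> tensor_lift R H (\<lambda>(x, y). \<epsilon> y \<odot>\<^bsub>H\<^esub> x) (\<Delta> h) = h"
    and antipode_left: "h \<in> carrier H \<Longrightarrow>
      tensor_lift R H (\<lambda>(x, y). S x \<otimes>\<^bsub>H\<^esub> y) (\<Delta> h) = \<epsilon> h \<odot>\<^bsub>H\<^esub> \<one>\<^bsub>H\<^esub>"
    and antipode_right: "h \<in> carrier H \<Longrightarrow>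
      tensor_lift R H (\<lambda>(x, y). x \<otimes>\<^bsub>H\<^esub> S y) (\<Delta> h) = \<epsilon> h \<odot>\<^bsub>H\<^esub> \<one>\<^bsub>H\<^esub>"

definition grouplike ::
  "('k, 'r) ring_scheme \<Rightarrow> ('k, 'h, 'm) module_scheme \<Rightarrow> ('h \<Rightarrow> ('h \<times> 'h \<Rightarrow> 'k) set) \<Rightarrow> ('h \<Rightarrow> 'k) \<Rightarrow>
    'h \<Rightarrow> bool"
  where "grouplike R H \<Delta> \<epsilon> \<sigma> \<longleftrightarrow>
    \<sigma> \<in> carrier H \<and> \<Delta> \<sigma> = tensor R H H \<sigma> \<sigma> \<and> \<epsilon> \<sigma> = \<one>\<^bsub>R\<^esub>"

definition twisted_antipode ::
  "('k, 'h, 'm) module_scheme \<Rightarrow> ('h \<Rightarrow> 'h) \<Rightarrow> 'h \<Rightarrow> 'h \<Rightarrow> 'h"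
  where "twisted_antipode H S \<sigma> h = \<sigma> \<otimes>\<^bsub>H\<^esub> S h"

definition bitwisted_antipode ::
  "('k, 'r) ring_scheme \<Rightarrow> ('k, 'h, 'm) module_scheme \<Rightarrow> ('h \<Rightarrow> ('h \<times> 'h \<Rightarrow> 'k) set) \<Rightarrow> ('h \<Rightarrow> 'h) \<Rightarrow>
    ('h \<Rightarrow> 'k) \<Rightarrow> 'h \<Rightarrow> 'h \<Rightarrow> 'h"
  where "bitwisted_antipode R H \<Delta> S \<delta> \<sigma> h =
    \<sigma> \<otimes>\<^bsub>H\<^esub> tensor_lift R H (\<lambda>(x, y). \<delta> y \<odot>\<^bsub>H\<^esub> S x) (\<Delta> h)"

definition modular_pair_in_involution ::
  "('k, 'r) ring_scheme \<Rightarrow> ('k, 'h, 'm) module_scheme \<Rightarrow> ('h \<Rightarrow> ('h \<times> 'h \<Rightarrow> 'k) set) \<Rightarrow> ('h \<Rightarrow> 'k) \<Rightarrow>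
    ('h \<Rightarrow> 'h) \<Rightarrow> ('h \<Rightarrow> 'k) \<Rightarrow> 'h \<Rightarrow> bool"
  where "modular_pair_in_involution R H \<Delta> \<epsilon> S \<delta> \<sigma> \<longleftrightarrow>
    algebra_map R H (base_module R) \<delta> \<and> grouplike R H \<Delta> \<epsilon> \<sigma> \<and> \<delta> \<sigma> = \<one>\<^bsub>R\<^esub> \<and>
    (\<forall>h\<in>carrier H.
      bitwisted_antipode R H \<Delta> S \<delta> \<sigma> (bitwisted_antipode R H \<Delta> S \<delta> \<sigma> h) = h)"

locale comodule_algebra = hopf_algebra R H \<Delta> \<epsilon> S + assoc_algebra R A
  for R (structure) and H (structure) and \<Delta> \<epsilon> S and A (structure) +
  fixes \<beta> :: "'a \<Rightarrow> ('a \<times> 'h \<Rightarrow> 'k) set"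
  assumes coaction_algebra_map: "algebra_map R A (tensor_alg R A H) \<beta>"
    and coaction_coassoc: "a \<in> carrier A \<Longrightarrow>
      tensor_lift R (tensor_mod R A (tensor_mod R H H)) (\<lambda>(x, y).
        tensor_lift R (tensor_mod R A (tensor_mod R H H)) (\<lambda>(x', x'').
          tensor R A (tensor_mod R H H) x' (tensor R H H x'' y)) (\<beta> x)) (\<beta> a) =
      tensor_lift R (tensor_mod R A (tensor_mod R H H)) (\<lambda>(x, y).
        tensor R A (tensor_mod R H H) x (\<Delta> y)) (\<beta> a)"
    and coaction_counit: "a \<in> carrier A \<Longrightarrow>
      tensor_lift R A (\<lambda>(x, y). \<epsilon> y \<odot>\<^bsub>A\<^esub> x) (\<beta> a) = a"

definition delta_trace ::
  "('k, 'r) ring_scheme \<Rightarrow> ('k, 'a, 'm) module_scheme \<Rightarrow> ('a \<Rightarrow> ('a \<times> 'h \<Rightarrow> 'k) set) \<Rightarrow> ('h \<Rightarrow> 'k) \<Rightarrow>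
    ('a \<Rightarrow> 'k) \<Rightarrow> bool"
  where "delta_trace R A \<beta> \<delta> Tr \<longleftrightarrow>
    linear_map R A (base_module R) Tr \<and>
    (\<forall>a\<in>carrier A. \<forall>b\<in>carrier A.
      Tr (a \<otimes>\<^bsub>A\<^esub> b) =
      tensor_lift R (base_module R) (\<lambda>(x, y). Tr (b \<otimes>\<^bsub>A\<^esub> x) \<otimes>\<^bsub>R\<^esub> \<delta> y) (\<beta> a))"

definition sigma_invariant ::
  "('k, 'r) ring_scheme \<Rightarrow> ('k, 'h, 'm) module_scheme \<Rightarrow> ('h \<Rightarrow> 'h) \<Rightarrow> 'h \<Rightarrow>
    ('k, 'a, 'n) module_scheme \<Rightarrow> ('a \<Rightarrow> ('a \<times> 'h \<Rightarrow> 'k) set) \<Rightarrow> ('a \<Rightarrow> 'k) \<Rightarrow> bool"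
  where "sigma_invariant R H S \<sigma> A \<beta> Tr \<longleftrightarrow>
    (\<forall>a\<in>carrier A. \<forall>b\<in>carrier A.
      tensor_lift R H (\<lambda>(x, y). Tr (x \<otimes>\<^bsub>A\<^esub> b) \<odot>\<^bsub>H\<^esub> y) (\<beta> a) =
      tensor_lift R H (\<lambda>(x, y). Tr (a \<otimes>\<^bsub>A\<^esub> x) \<odot>\<^bsub>H\<^esub> twisted_antipode H S \<sigma> y) (\<beta> b))"

section \<open>Cyclic modules and cyclic maps\<close>

record ('k, 'e) cyclic_structure =
  obj :: "nat \<Rightarrow> ('k, 'e) module"
  face :: "nat \<Rightarrow> nat \<Rightarrow> 'e \<Rightarrow> 'e"
  degen :: "nat \<Rightarrow> nat \<Rightarrow> 'e \<Rightarrow> 'e"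
  cyc :: "nat \<Rightarrow> 'e \<Rightarrow> 'e"

text \<open>
  \<open>face C n i\<close> and \<open>degen C n i\<close> are the maps \<open>d\<^sub>i\<close> and \<open>s\<^sub>i\<close> with source in degree \<open>n\<close>.
\<close>

definition cyclic_map ::
  "('k, 'r) ring_scheme \<Rightarrow> ('k, 'c) cyclic_structure \<Rightarrow> ('k, 'd) cyclic_structure \<Rightarrow>
    (nat \<Rightarrow> 'c \<Rightarrow> 'd) \<Rightarrow> bool"
  where "cyclic_map R C D \<phi> \<longleftrightarrow>
    (\<forall>n. linear_map R (obj C n) (obj D n) (\<phi> n)) \<and>
    (\<forall>n. \<forall>i\<le>Suc n. \<forall>x\<in>carrier (obj C (Suc n)).
       \<phi> n (face C (Suc n) i x) = face D (Suc n) i (\<phi> (Suc n) x)) \<and>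
    (\<forall>n. \<forall>i\<le>n. \<forall>x\<in>carrier (obj C n).
       \<phi> (Suc n) (degen C n i x) = degen D n i (\<phi> n x)) \<and>
    (\<forall>n. \<forall>x\<in>carrier (obj C n). \<phi> n (cyc C n x) = cyc D n (\<phi> n x))"

definition list_mult :: "('a, 'm) monoid_scheme \<Rightarrow> 'a list \<Rightarrow> 'a" where
  "list_mult A xs = foldr (mult A) xs \<one>\<^bsub>A\<^esub>"

text \<open>
  Sweedler summation over several coproducts or coactions at once:
  \<open>\<Sum> f [(a\<^sub>1\<^sup>0, a\<^sub>1\<^sup>1), \<dots>, (a\<^sub>n\<^sup>0, a\<^sub>n\<^sup>1)]\<close> for a multilinear \<open>f\<close> with values in \<open>P\<close>.
\<close>

fun sweedler_sum ::
  "('k, 'r) ring_scheme \<Rightarrow> ('k, 'p, 'm) module_scheme \<Rightarrow> ('a \<Rightarrow> ('b \<times> 'c \<Rightarrow> 'k) set) \<Rightarrow>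
    (('b \<times> 'c) list \<Rightarrow> 'p) \<Rightarrow> 'a list \<Rightarrow> 'p"
  where
    "sweedler_sum R P \<beta> f [] = f []"
  | "sweedler_sum R P \<beta> f (a # as) =
       tensor_lift R P (\<lambda>p. sweedler_sum R P \<beta> (\<lambda>ps. f (p # ps)) as) (\<beta> a)"

subsection \<open>The cyclic module of an algebra\<close>

text \<open>Here \<open>as\<close> is the list \<open>[a\<^sub>0, \<dots>, a\<^sub>n]\<close> of length \<open>n + 1\<close>.\<close>

definition alg_face_list :: "('a, 'm) monoid_scheme \<Rightarrow> nat \<Rightarrow> nat \<Rightarrow> 'a list \<Rightarrow> 'a list" where
  "alg_face_list A n i as =
    (if i < n then take i as @ [as ! i \<otimes>\<^bsub>A\<^esub> as ! Suc i] @ drop (Suc (Suc i)) as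
     else (last as \<otimes>\<^bsub>A\<^esub> hd as) # butlast (tl as))"

definition alg_cyclic ::
  "('k, 'r) ring_scheme \<Rightarrow> ('k, 'a, 'm) module_scheme \<Rightarrow> ('k, ('a list \<Rightarrow> 'k) set) cyclic_structure"
  where "alg_cyclic R A = \<lparr>
    obj = (\<lambda>n. tensor_power R A (Suc n)),
    face = (\<lambda>n i. tensor_lift R (tensor_power R A n)
      (\<lambda>as. tensor_list R A (alg_face_list A n i as))),
    degen = (\<lambda>n i. tensor_lift R (tensor_power R A (Suc (Suc n)))
      (\<lambda>as. tensor_list R A (take (Suc i) as @ [\<one>\<^bsub>A\<^esub>] @ drop (Suc i) as))),
    cyc = (\<lambda>n. tensor_lift R (tensor_power R A (Suc n))
      (\<lambda>as. tensor_list R A (last as # butlast as)))\<rparr>"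

subsection \<open>The cyclic module of a Hopf algebra with a modular pair in involution\<close>

text \<open>
  Here \<open>hs\<close> is the list \<open>[h\<^sub>1, \<dots>, h\<^sub>n]\<close> of length \<open>n\<close>, so that \<open>h\<^sub>i\<close> is \<open>hs ! (i - 1)\<close>.
\<close>

definition hopf_face_pure ::
  "('k, 'r) ring_scheme \<Rightarrow> ('k, 'h, 'm) module_scheme \<Rightarrow> ('h \<Rightarrow> 'k) \<Rightarrow> ('h \<Rightarrow> 'k) \<Rightarrow>
    nat \<Rightarrow> nat \<Rightarrow> 'h list \<Rightarrow> ('h list \<Rightarrow> 'k) set"
  where "hopf_face_pure R H \<epsilon> \<delta> n i hs =
    (if i = 0 then \<epsilon> (hd hs) \<odot>\<^bsub>tensor_power R H (n - 1)\<^esub> tensor_list R H (tl hs)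
     else if i < n then
       tensor_list R H (take (i - 1) hs @ [hs ! (i - 1) \<otimes>\<^bsub>H\<^esub> hs ! i] @ drop (Suc i) hs)
     else \<delta> (last hs) \<odot>\<^bsub>tensor_power R H (n - 1)\<^esub> tensor_list R H (butlast hs))"

text \<open>In \<open>ps\<close> the \<open>i\<close>-th pair is \<open>(h\<^sub>i\<^sup>1, h\<^sub>i\<^sup>2)\<close>.\<close>

definition hopf_cyc_pure ::
  "('k, 'r) ring_scheme \<Rightarrow> ('k, 'h, 'm) module_scheme \<Rightarrow> ('h \<Rightarrow> ('h \<times> 'h \<Rightarrow> 'k) set) \<Rightarrow> ('h \<Rightarrow> 'h) \<Rightarrow>
    ('h \<Rightarrow> 'k) \<Rightarrow> 'h \<Rightarrow> nat \<Rightarrow> 'h list \<Rightarrow> ('h list \<Rightarrow> 'k) set"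
  where "hopf_cyc_pure R H \<Delta> S \<delta> \<sigma> n hs =
    sweedler_sum R (tensor_power R H n) \<Delta>
      (\<lambda>ps. \<delta> (snd (last ps)) \<odot>\<^bsub>tensor_power R H n\<^esub>
        tensor_list R H (twisted_antipode H S \<sigma> (list_mult H (map fst ps)) # map snd (butlast ps)))
      hs"

definition hopf_cyclic ::
  "('k, 'r) ring_scheme \<Rightarrow> ('k, 'h, 'm) module_scheme \<Rightarrow> ('h \<Rightarrow> ('h \<times> 'h \<Rightarrow> 'k) set) \<Rightarrow> ('h \<Rightarrow> 'k) \<Rightarrow>
    ('h \<Rightarrow> 'h) \<Rightarrow> ('h \<Rightarrow> 'k) \<Rightarrow> 'h \<Rightarrow> ('k, ('h list \<Rightarrow> 'k) set) cyclic_structure"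
  where "hopf_cyclic R H \<Delta> \<epsilon> S \<delta> \<sigma> = \<lparr>
    obj = (\<lambda>n. tensor_power R H n),
    face = (\<lambda>n i. tensor_lift R (tensor_power R H (n - 1)) (hopf_face_pure R H \<epsilon> \<delta> n i)),
    degen = (\<lambda>n i. tensor_lift R (tensor_power R H (Suc n))
      (\<lambda>hs. tensor_list R H (take i hs @ [\<one>\<^bsub>H\<^esub>] @ drop i hs))),
    cyc = (\<lambda>n x. if n = 0 then x
      else tensor_lift R (tensor_power R H n) (hopf_cyc_pure R H \<Delta> S \<delta> \<sigma> n) x)\<rparr>"

subsection \<open>The characteristic map\<close>

text \<open>In \<open>ps\<close> the \<open>i\<close>-th pair is \<open>(a\<^sub>i\<^sup>0, a\<^sub>i\<^sup>1)\<close>, for \<open>i = 1, \<dots>, n\<close>.\<close>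

definition gamma_pure ::
  "('k, 'r) ring_scheme \<Rightarrow> ('k, 'h, 'm) module_scheme \<Rightarrow> ('k, 'a, 'n) module_scheme \<Rightarrow>
    ('a \<Rightarrow> ('a \<times> 'h \<Rightarrow> 'k) set) \<Rightarrow> ('a \<Rightarrow> 'k) \<Rightarrow> nat \<Rightarrow> 'a list \<Rightarrow> ('h list \<Rightarrow> 'k) set"
  where "gamma_pure R H A \<beta> Tr n as =
    sweedler_sum R (tensor_power R H n) \<beta>
      (\<lambda>ps. Tr (hd as \<otimes>\<^bsub>A\<^esub> list_mult A (map fst ps)) \<odot>\<^bsub>tensor_power R H n\<^esub>
        tensor_list R H (map snd ps))
      (tl as)"

definition gamma_map ::
  "('k, 'r) ring_scheme \<Rightarrow> ('k, 'h, 'm) module_scheme \<Rightarrow> ('k, 'a, 'n) module_scheme \<Rightarrow>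
    ('a \<Rightarrow> ('a \<times> 'h \<Rightarrow> 'k) set) \<Rightarrow> ('a \<Rightarrow> 'k) \<Rightarrow> nat \<Rightarrow> ('a list \<Rightarrow> 'k) set \<Rightarrow> ('h list \<Rightarrow> 'k) set"
  where "gamma_map R H A \<beta> Tr n = tensor_lift R (tensor_power R H n) (gamma_pure R H A \<beta> Tr n)"

end

(*
  By coassociativity, applying the coproduct of H to the legs a_i^(1) is the same as coacting on the
  legs a_i^(0).  Since the coaction is multiplicative, the antipode in the cyclic operator then only
  meets the H-leg of the product b = a_1^(0) ... a_n^(0), and sigma-invariance trades it for the
  coaction on a_0.  The trace property finally moves a_n to the front.  The faces and degeneracies
  use the counit, the multiplicativity and the unit of the coaction, and for the last face the trace
  property.
*)

theory Submission
  imports Defs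
begin

section \<open>Linear maps\<close>

text \<open>The obstacle is that \<open>tensor_lift\<close> is a definite description: a Sweedler
  sum has a meaning only once its summand is known to be multilinear, so every rewriting inside a
  sum carries such an obligation. Two devices keep this under control. Tensor products and tensor
  powers are treated together as modules with generators and relations, for which the universal
  property is proved once. And an iterated Sweedler sum is a finite sum whose coefficients do not
  depend on the summand, which settles the exchange of sums and linearity in parameters. The H-legs
  are fed to an arbitrary multilinear function \<open>G\<close> instead of a pure tensor. An
  operator on the Hopf side then only changes \<open>G\<close>, and one computation can serve two
  operators: the factor \<delta> in the cyclic operator is the one that the trace property absorbs
  when the last entry passes to the front, so that step is the computation for the last face with
  one more H-leg in front.\<close>

lemma linear_mapI:
  assumes "\<And>x. x \<in> carrier M \<Longrightarrow> f x \<in> carrier N"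
    and "\<And>x y. x \<in> carrier M \<Longrightarrow> y \<in> carrier M \<Longrightarrow> f (x \<oplus>\<^bsub>M\<^esub> y) = f x \<oplus>\<^bsub>N\<^esub> f y"
    and "\<And>c x. c \<in> carrier R \<Longrightarrow> x \<in> carrier M \<Longrightarrow> f (c \<odot>\<^bsub>M\<^esub> x) = c \<odot>\<^bsub>N\<^esub> f x"
  shows "linear_map R M N f"
  using assms by (auto simp: linear_map_def)

lemma linear_mapD:
  assumes "linear_map R M N f"
  shows linear_map_closed: "x \<in> carrier M \<Longrightarrow> f x \<in> carrier N"
    and linear_map_add: "x \<in> carrier M \<Longrightarrow> y \<in> carrier M \<Longrightarrow> f (x \<oplus>\<^bsub>M\<^esub> y) = f x \<oplus>\<^bsub>N\<^esub> f y"
    and linear_map_smult: "c \<in> carrier R \<Longrightarrow> x \<in> carrier M \<Longrightarrow> f (c \<odot>\<^bsub>M\<^esub> x) = c \<odot>\<^bsub>N\<^esub> f x"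
  using assms by (auto simp: linear_map_def)

lemma linear_map_comp:
  assumes "linear_map R M N f" "linear_map R N P g"
  shows "linear_map R M P (\<lambda>x. g (f x))"
  using assms by (auto simp: linear_map_def Pi_iff)

lemma linear_map_cong:
  assumes "module R M" "linear_map R M N g" "\<And>x. x \<in> carrier M \<Longrightarrow> f x = g x"
  shows "linear_map R M N f"
proof -
  interpret M: module R M by fact
  show ?thesis
    by (rule linear_mapI) (simp_all add: assms(3) linear_mapD[OF assms(2)])
qed

lemma linear_map_id: "linear_map R M M (\<lambda>x. x)"
  by (rule linear_mapI) simp_all

lemma linear_map_zero:
  assumes "module R M" "module R N" "linear_map R M N f"
  shows "f \<zero>\<^bsub>M\<^esub> = \<zero>\<^bsub>N\<^esub>"
proof -
  interpret M: module R M by fact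
  interpret N: module R N by fact
  have "f (\<zero>\<^bsub>R\<^esub> \<odot>\<^bsub>M\<^esub> \<zero>\<^bsub>M\<^esub>) = \<zero>\<^bsub>R\<^esub> \<odot>\<^bsub>N\<^esub> f \<zero>\<^bsub>M\<^esub>"
    using linear_map_smult[OF assms(3), of "\<zero>\<^bsub>R\<^esub>" "\<zero>\<^bsub>M\<^esub>"] by simp
  then show ?thesis
    using linear_map_closed[OF assms(3)] by simp
qed

lemma linear_map_uminus:
  assumes "module R M" "module R N" "linear_map R M N f" "x \<in> carrier M"
  shows "f (\<ominus>\<^bsub>M\<^esub> x) = \<ominus>\<^bsub>N\<^esub> f x"
proof -
  interpret M: module R M by fact
  interpret N: module R N by fact
  have "f x \<in> carrier N" "f (\<ominus>\<^bsub>M\<^esub> x) \<in> carrier N"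
    using assms linear_map_closed[OF assms(3)] by auto
  moreover have "f (\<ominus>\<^bsub>M\<^esub> x) \<oplus>\<^bsub>N\<^esub> f x = \<zero>\<^bsub>N\<^esub>"
    using assms linear_map_add[OF assms(3), of "\<ominus>\<^bsub>M\<^esub> x" x] linear_map_zero[OF assms(1-3)]
    by (simp add: M.l_neg)
  ultimately show ?thesis
    using N.add.inv_equality by fastforce
qed

lemma linear_map_minus:
  assumes "module R M" "module R N" "linear_map R M N f" "x \<in> carrier M" "y \<in> carrier M"
  shows "f (x \<ominus>\<^bsub>M\<^esub> y) = f x \<ominus>\<^bsub>N\<^esub> f y"
proof -
  interpret M: module R M by fact
  show ?thesis
    using assms by (simp add: a_minus_def linear_map_add[OF assms(3)] linear_map_uminus[OF assms(1-3)])
qed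

lemma (in module) minus_eq_zero_iff:
  assumes "x \<in> carrier M" "y \<in> carrier M"
  shows "x \<ominus>\<^bsub>M\<^esub> y = \<zero>\<^bsub>M\<^esub> \<longleftrightarrow> x = y"
proof
  assume *: "x \<ominus>\<^bsub>M\<^esub> y = \<zero>\<^bsub>M\<^esub>"
  then have "x \<oplus>\<^bsub>M\<^esub> \<ominus>\<^bsub>M\<^esub> y = \<zero>\<^bsub>M\<^esub>" by (simp add: a_minus_def)
  then have "\<ominus>\<^bsub>M\<^esub> (\<ominus>\<^bsub>M\<^esub> y) = x"
    using assms by (intro M.minus_equality) auto
  then show "x = y" using assms by simp
next
  assume "x = y"
  then show "x \<ominus>\<^bsub>M\<^esub> y = \<zero>\<^bsub>M\<^esub>" using assms by (simp add: a_minus_def M.r_neg)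
qed

lemma module_base_module:
  assumes "cring R"
  shows "module R (base_module R)"
proof -
  interpret cring R by fact
  show ?thesis
  proof (rule moduleI)
    show "abelian_group (base_module R)"
      by (rule abelian_groupI)
        (auto simp: base_module_def a_ac intro: l_neg bexI[of _ "\<ominus>\<^bsub>R\<^esub> _"])
  qed (auto simp: base_module_def assms l_distr r_distr m_assoc)
qed

lemma linear_map_smult_const:
  assumes "module R P" "linear_map R M (base_module R) \<phi>" "w \<in> carrier P"
  shows "linear_map R M P (\<lambda>x. \<phi> x \<odot>\<^bsub>P\<^esub> w)"
proof -
  interpret P: module R P by fact
  show ?thesis
    using assms(3) linear_mapD[OF assms(2)]
    by (intro linear_mapI) (auto simp: base_module_def P.smult_l_distr P.smult_assoc1)
qed

lemma linear_map_const_smult: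
  assumes "module R P" "linear_map R M P f" "c \<in> carrier R"
  shows "linear_map R M P (\<lambda>x. c \<odot>\<^bsub>P\<^esub> f x)"
proof -
  interpret P: module R P by fact
  show ?thesis
    using assms(3) linear_mapD[OF assms(2)]
    by (intro linear_mapI) (auto simp: P.smult_r_distr P.smult_assoc1[symmetric] P.m_comm)
qed

section \<open>Free modules\<close>

lemma carrier_free_mod:
  "t \<in> carrier (free_mod R X) \<longleftrightarrow>
    (\<forall>x. t x \<in> carrier R) \<and> finite {x. t x \<noteq> \<zero>\<^bsub>R\<^esub>} \<and> {x. t x \<noteq> \<zero>\<^bsub>R\<^esub>} \<subseteq> X"
  by (simp add: free_mod_def)

lemma free_mod_simps:
  "zero (free_mod R X) = (\<lambda>_. \<zero>\<^bsub>R\<^esub>)"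
  "add (free_mod R X) = (\<lambda>s t x. s x \<oplus>\<^bsub>R\<^esub> t x)"
  "smult (free_mod R X) = (\<lambda>c t x. c \<otimes>\<^bsub>R\<^esub> t x)"
  by (simp_all add: free_mod_def)

lemma (in cring) module_free_mod: "module R (free_mod R X)"
proof (rule moduleI)
  have add: "(\<lambda>x. s x \<oplus> t x) \<in> carrier (free_mod R X)"
    if "s \<in> carrier (free_mod R X)" "t \<in> carrier (free_mod R X)" for s t
  proof -
    have "{x. s x \<oplus> t x \<noteq> \<zero>} \<subseteq> {x. s x \<noteq> \<zero>} \<union> {x. t x \<noteq> \<zero>}"
      by auto
    then show ?thesis
      using that by (auto simp: carrier_free_mod intro: finite_subset)
  qed
  have smult: "(\<lambda>x. c \<otimes> t x) \<in> carrier (free_mod R X)"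
    if "c \<in> carrier R" "t \<in> carrier (free_mod R X)" for c t
  proof -
    have "{x. c \<otimes> t x \<noteq> \<zero>} \<subseteq> {x. t x \<noteq> \<zero>}"
      using that by auto
    then show ?thesis
      using that by (auto simp: carrier_free_mod intro: finite_subset)
  qed
  show "abelian_group (free_mod R X)"
  proof (rule abelian_groupI)
    fix t assume t: "t \<in> carrier (free_mod R X)"
    have "(\<lambda>x. \<ominus> \<one> \<otimes> t x) \<in> carrier (free_mod R X)"
      using t by (intro smult) auto
    moreover have "(\<lambda>x. \<ominus> \<one> \<otimes> t x) \<oplus>\<^bsub>free_mod R X\<^esub> t = \<zero>\<^bsub>free_mod R X\<^esub>"
      using t by (auto simp: free_mod_simps carrier_free_mod l_minus l_neg)
    ultimately show "\<exists>s\<in>carrier (free_mod R X). s \<oplus>\<^bsub>free_mod R X\<^esub> t = \<zero>\<^bsub>free_mod R X\<^esub>"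
      by blast
  qed (use add in \<open>auto simp: free_mod_simps carrier_free_mod a_ac\<close>)
  show "c \<odot>\<^bsub>free_mod R X\<^esub> t \<in> carrier (free_mod R X)"
    if "c \<in> carrier R" "t \<in> carrier (free_mod R X)" for c t
    using smult[OF that] by (simp add: free_mod_simps)
qed (auto simp: free_mod_simps carrier_free_mod l_distr r_distr m_assoc is_cring)

lemma (in cring) free_gen_closed:
  "x \<in> X \<Longrightarrow> free_gen R x \<in> carrier (free_mod R X)"
  by (auto simp: carrier_free_mod free_gen_def)

text \<open>The sum under \<open>THE\<close> in \<open>tensor_lift\<close>, at one representative
  \<open>t\<close>. As a function of \<open>t\<close> it is the linear extension of \<open>f\<close>
  to the free module; a lift is well defined when this extension is constant on cosets.\<close>

definition lin_sum ::
  "('k, 'r) ring_scheme \<Rightarrow> ('k, 'p, 'm) module_scheme \<Rightarrow> ('x \<Rightarrow> 'p) \<Rightarrow> ('x \<Rightarrow> 'k) \<Rightarrow> 'p"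
  where "lin_sum R P f t = (\<Oplus>\<^bsub>P\<^esub>x\<in>{x. t x \<noteq> \<zero>\<^bsub>R\<^esub>}. t x \<odot>\<^bsub>P\<^esub> f x)"

context module
begin

lemma lin_sum_superset:
  assumes "t \<in> carrier (free_mod R X)" "f \<in> X \<rightarrow> carrier M"
    and "finite K" "{x. t x \<noteq> \<zero>} \<subseteq> K" "K \<subseteq> X"
  shows "lin_sum R M f t = (\<Oplus>\<^bsub>M\<^esub>x\<in>K. t x \<odot>\<^bsub>M\<^esub> f x)"
  unfolding lin_sum_def using assms
  by (intro M.add.finprod_mono_neutral_cong_left) (auto simp: carrier_free_mod subset_iff Pi_iff)

lemma lin_sum_closed:
  assumes "t \<in> carrier (free_mod R X)" "f \<in> X \<rightarrow> carrier M"
  shows "lin_sum R M f t \<in> carrier M"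
  unfolding lin_sum_def using assms
  by (intro M.finsum_closed) (auto simp: carrier_free_mod)

lemma linear_map_lin_sum:
  assumes f: "f \<in> X \<rightarrow> carrier M"
  shows "linear_map R (free_mod R X) M (lin_sum R M f)"
proof (rule linear_mapI)
  interpret F: module R "free_mod R X" by (rule R.module_free_mod)
  fix s t assume st: "s \<in> carrier (free_mod R X)" "t \<in> carrier (free_mod R X)"
  \<comment> \<open>Cancellation can make the support of the sum smaller than the union of the
    supports, so all three sums are taken over the union, where the extra terms vanish.\<close>
  let ?K = "{x. s x \<noteq> \<zero>} \<union> {x. t x \<noteq> \<zero>}"
  have K: "finite ?K" "?K \<subseteq> X" using st by (auto simp: carrier_free_mod)
  have *: "s x \<odot>\<^bsub>M\<^esub> f x \<in> carrier M" "t x \<odot>\<^bsub>M\<^esub> f x \<in> carrier M" if "x \<in> ?K" for x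
    using f st that K by (auto simp: carrier_free_mod Pi_iff subset_iff)
  have "lin_sum R M f (s \<oplus>\<^bsub>free_mod R X\<^esub> t) = (\<Oplus>\<^bsub>M\<^esub>x\<in>?K. (s x \<oplus> t x) \<odot>\<^bsub>M\<^esub> f x)"
    by (subst lin_sum_superset[OF F.a_closed[OF st] f K(1) _ K(2)]) (auto simp: free_mod_simps)
  also have "\<dots> = (\<Oplus>\<^bsub>M\<^esub>x\<in>?K. s x \<odot>\<^bsub>M\<^esub> f x \<oplus>\<^bsub>M\<^esub> t x \<odot>\<^bsub>M\<^esub> f x)"
    using f st K * by (intro M.finsum_cong') (auto simp: carrier_free_mod smult_l_distr Pi_iff subset_iff)
  also have "\<dots> = lin_sum R M f s \<oplus>\<^bsub>M\<^esub> lin_sum R M f t"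
    using lin_sum_superset[OF st(1) f K(1) _ K(2)] lin_sum_superset[OF st(2) f K(1) _ K(2)] K *
    by (simp add: M.finsum_addf Pi_def)
  finally show "lin_sum R M f (s \<oplus>\<^bsub>free_mod R X\<^esub> t) = lin_sum R M f s \<oplus>\<^bsub>M\<^esub> lin_sum R M f t" .
next
  interpret F: module R "free_mod R X" by (rule R.module_free_mod)
  fix c t assume c: "c \<in> carrier R" and t: "t \<in> carrier (free_mod R X)"
  let ?K = "{x. t x \<noteq> \<zero>}"
  have K: "finite ?K" "?K \<subseteq> X" using t by (auto simp: carrier_free_mod)
  have "lin_sum R M f (c \<odot>\<^bsub>free_mod R X\<^esub> t) = (\<Oplus>\<^bsub>M\<^esub>x\<in>?K. (c \<otimes> t x) \<odot>\<^bsub>M\<^esub> f x)"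
    using c by (subst lin_sum_superset[OF F.smult_closed[OF c t] f K(1) _ K(2)])
      (auto simp: free_mod_simps)
  also have "\<dots> = (\<Oplus>\<^bsub>M\<^esub>x\<in>?K. c \<odot>\<^bsub>M\<^esub> (t x \<odot>\<^bsub>M\<^esub> f x))"
    using f t c K by (intro M.finsum_cong') (auto simp: carrier_free_mod smult_assoc1 Pi_iff subset_iff)
  also have "\<dots> = c \<odot>\<^bsub>M\<^esub> lin_sum R M f t"
    unfolding lin_sum_def using f t c K
    by (intro finsum_smult_ldistr[symmetric]) (auto simp: carrier_free_mod)
  finally show "lin_sum R M f (c \<odot>\<^bsub>free_mod R X\<^esub> t) = c \<odot>\<^bsub>M\<^esub> lin_sum R M f t" .
qed (use f in \<open>auto intro: lin_sum_closed\<close>)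

lemma lin_sum_free_gen:
  assumes "x \<in> X" "f \<in> X \<rightarrow> carrier M"
  shows "lin_sum R M f (free_gen R x) = f x"
proof -
  have "lin_sum R M f (free_gen R x) = (\<Oplus>\<^bsub>M\<^esub>y\<in>{x}. free_gen R x y \<odot>\<^bsub>M\<^esub> f y)"
    using assms by (intro lin_sum_superset[OF R.free_gen_closed[OF assms(1)]])
      (auto simp: free_gen_def)
  also have "\<dots> = (\<Oplus>\<^bsub>M\<^esub>y\<in>{x}. f y)"
    using assms by (intro M.finsum_cong') (auto simp: free_gen_def Pi_iff)
  finally show ?thesis using assms by (simp add: Pi_iff)
qed

lemma lin_sum_cong:
  assumes "t \<in> carrier (free_mod R X)" "g \<in> X \<rightarrow> carrier M" "\<And>x. x \<in> X \<Longrightarrow> f x = g x"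
  shows "lin_sum R M f t = lin_sum R M g t"
  unfolding lin_sum_def using assms
  by (intro M.finsum_cong') (auto simp: carrier_free_mod subset_iff Pi_iff)

lemma linear_map_finsum:
  assumes "module R N" "linear_map R M N \<phi>" "finite K" "f \<in> K \<rightarrow> carrier M"
  shows "\<phi> (\<Oplus>\<^bsub>M\<^esub>x\<in>K. f x) = (\<Oplus>\<^bsub>N\<^esub>x\<in>K. \<phi> (f x))"
proof -
  interpret N: module R N by fact
  show ?thesis
    using assms(3,4)
  proof induction
    case empty
    then show ?case using linear_map_zero[OF module_axioms assms(1,2)] by simp
  next
    case (insert x K)
    then have "f \<in> K \<rightarrow> carrier M" "f x \<in> carrier M" by auto
    then show ?case
      using insert linear_mapD[OF assms(2)] by (simp add: M.finsum_closed Pi_def)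
  qed
qed

lemma linear_map_lin_sum_comm:
  assumes "module R N" "linear_map R M N \<phi>" "t \<in> carrier (free_mod R X)" "f \<in> X \<rightarrow> carrier M"
  shows "\<phi> (lin_sum R M f t) = lin_sum R N (\<lambda>x. \<phi> (f x)) t"
proof -
  interpret N: module R N by fact
  have "\<phi> (lin_sum R M f t) = (\<Oplus>\<^bsub>N\<^esub>x\<in>{x. t x \<noteq> \<zero>}. \<phi> (t x \<odot>\<^bsub>M\<^esub> f x))"
    unfolding lin_sum_def using assms
    by (intro linear_map_finsum[OF assms(1,2)]) (auto simp: carrier_free_mod)
  also have "\<dots> = lin_sum R N (\<lambda>x. \<phi> (f x)) t"
    unfolding lin_sum_def using assms linear_mapD[OF assms(2)]
    by (intro N.finsum_cong') (auto simp: carrier_free_mod subset_iff Pi_iff)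
  finally show ?thesis .
qed

lemma lin_sum_add:
  assumes "t \<in> carrier (free_mod R X)" "f \<in> X \<rightarrow> carrier M" "g \<in> X \<rightarrow> carrier M"
  shows "lin_sum R M (\<lambda>x. f x \<oplus>\<^bsub>M\<^esub> g x) t = lin_sum R M f t \<oplus>\<^bsub>M\<^esub> lin_sum R M g t"
proof -
  have "lin_sum R M (\<lambda>x. f x \<oplus>\<^bsub>M\<^esub> g x) t =
      (\<Oplus>\<^bsub>M\<^esub>x\<in>{x. t x \<noteq> \<zero>}. t x \<odot>\<^bsub>M\<^esub> f x \<oplus>\<^bsub>M\<^esub> t x \<odot>\<^bsub>M\<^esub> g x)"
    unfolding lin_sum_def using assms
    by (intro M.finsum_cong') (auto simp: carrier_free_mod subset_iff Pi_iff smult_r_distr)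
  then show ?thesis
    unfolding lin_sum_def using assms
    by (simp add: M.finsum_addf carrier_free_mod subset_iff Pi_iff)
qed

lemma lin_sum_smult:
  assumes "t \<in> carrier (free_mod R X)" "f \<in> X \<rightarrow> carrier M" "c \<in> carrier R"
  shows "lin_sum R M (\<lambda>x. c \<odot>\<^bsub>M\<^esub> f x) t = c \<odot>\<^bsub>M\<^esub> lin_sum R M f t"
  using linear_map_lin_sum_comm[OF module_axioms
      linear_map_const_smult[OF module_axioms linear_map_id assms(3)] assms(1,2)]
  by simp

lemma linear_map_lin_sum_param:
  assumes "t \<in> carrier (free_mod R X)" "\<And>x. x \<in> X \<Longrightarrow> linear_map R N M (\<lambda>v. f v x)"
  shows "linear_map R N M (\<lambda>v. lin_sum R M (f v) t)"
proof (rule linear_mapI)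
  have cl: "f v \<in> X \<rightarrow> carrier M" if "v \<in> carrier N" for v
    using linear_map_closed[OF assms(2)] that by auto
  fix v w assume vw: "v \<in> carrier N" "w \<in> carrier N"
  have "lin_sum R M (f (v \<oplus>\<^bsub>N\<^esub> w)) t = lin_sum R M (\<lambda>x. f v x \<oplus>\<^bsub>M\<^esub> f w x) t"
    using cl vw by (intro lin_sum_cong[OF assms(1)])
      (auto simp: linear_map_add[OF assms(2)] Pi_iff)
  then show "lin_sum R M (f (v \<oplus>\<^bsub>N\<^esub> w)) t = lin_sum R M (f v) t \<oplus>\<^bsub>M\<^esub> lin_sum R M (f w) t"
    using lin_sum_add[OF assms(1)] cl vw by simp
next
  have cl: "f v \<in> X \<rightarrow> carrier M" if "v \<in> carrier N" for v
    using linear_map_closed[OF assms(2)] that by auto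
  fix c v assume cv: "c \<in> carrier R" "v \<in> carrier N"
  have "lin_sum R M (f (c \<odot>\<^bsub>N\<^esub> v)) t = lin_sum R M (\<lambda>x. c \<odot>\<^bsub>M\<^esub> f v x) t"
    using cl cv by (intro lin_sum_cong[OF assms(1)])
      (auto simp: linear_map_smult[OF assms(2)] Pi_iff)
  then show "lin_sum R M (f (c \<odot>\<^bsub>N\<^esub> v)) t = c \<odot>\<^bsub>M\<^esub> lin_sum R M (f v) t"
    using lin_sum_smult[OF assms(1)] cl cv by simp
qed (use linear_map_closed[OF assms(2)] in \<open>auto intro: lin_sum_closed[OF assms(1)]\<close>)

text \<open>Fubini for two formal sums. Every later exchange of Sweedler summations comes down to it
  once representatives are chosen.\<close>

lemma lin_sum_swap:
  assumes s: "s \<in> carrier (free_mod R X)" and t: "t \<in> carrier (free_mod R Y)"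
    and f: "\<And>x y. x \<in> X \<Longrightarrow> y \<in> Y \<Longrightarrow> f x y \<in> carrier M"
  shows "lin_sum R M (\<lambda>x. lin_sum R M (f x) t) s = lin_sum R M (\<lambda>y. lin_sum R M (\<lambda>x. f x y) s) t"
proof -
  let ?L = "\<lambda>t. lin_sum R M (\<lambda>y. lin_sum R M (\<lambda>x. f x y) s) t"
  have cl: "(\<lambda>x. f x y) \<in> X \<rightarrow> carrier M" "f x \<in> Y \<rightarrow> carrier M" if "x \<in> X" "y \<in> Y" for x y
    using f that by auto
  \<comment> \<open>Only the sum over \<open>s\<close> is unfolded, along a growing part
    \<open>J\<close> of its support; the sum over \<open>t\<close> stays a \<open>lin_sum\<close>
    and is handled by its linearity in the function.\<close>
  have "(\<Oplus>\<^bsub>M\<^esub>x\<in>J. s x \<odot>\<^bsub>M\<^esub> lin_sum R M (f x) t) =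
      (lin_sum R M (\<lambda>y. (\<Oplus>\<^bsub>M\<^esub>x\<in>J. s x \<odot>\<^bsub>M\<^esub> f x y)) t)"
    if "finite J" "J \<subseteq> X" for J
    using that
  proof induction
    case empty
    have "lin_sum R M (\<lambda>y. \<zero>\<^bsub>M\<^esub>) t = \<zero>\<^bsub>M\<^esub>"
      using lin_sum_smult[OF t, of "\<lambda>_. \<zero>\<^bsub>M\<^esub>" \<zero>] lin_sum_closed[OF t, of "\<lambda>_. \<zero>\<^bsub>M\<^esub>"] by simp
    then show ?case by simp
  next
    case (insert x J)
    have sc: "s x \<in> carrier R" for x using s by (simp add: carrier_free_mod)
    have x: "x \<in> X" "J \<subseteq> X" using insert by auto
    have a: "(\<lambda>y. s x \<odot>\<^bsub>M\<^esub> f x y) \<in> Y \<rightarrow> carrier M" using f sc x by auto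
    have b: "(\<lambda>y. \<Oplus>\<^bsub>M\<^esub>x\<in>J. s x \<odot>\<^bsub>M\<^esub> f x y) \<in> Y \<rightarrow> carrier M"
      using f sc x by (auto intro!: M.finsum_closed)
    have "lin_sum R M (\<lambda>y. (\<Oplus>\<^bsub>M\<^esub>x\<in>insert x J. s x \<odot>\<^bsub>M\<^esub> f x y)) t =
        lin_sum R M (\<lambda>y. s x \<odot>\<^bsub>M\<^esub> f x y \<oplus>\<^bsub>M\<^esub> (\<Oplus>\<^bsub>M\<^esub>x\<in>J. s x \<odot>\<^bsub>M\<^esub> f x y)) t"
    proof (rule lin_sum_cong[OF t])
      show "(\<lambda>y. s x \<odot>\<^bsub>M\<^esub> f x y \<oplus>\<^bsub>M\<^esub> (\<Oplus>\<^bsub>M\<^esub>x\<in>J. s x \<odot>\<^bsub>M\<^esub> f x y)) \<in> Y \<rightarrow> carrier M"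
        using a b by auto
      fix y assume "y \<in> Y"
      then show "(\<Oplus>\<^bsub>M\<^esub>x\<in>insert x J. s x \<odot>\<^bsub>M\<^esub> f x y) =
          s x \<odot>\<^bsub>M\<^esub> f x y \<oplus>\<^bsub>M\<^esub> (\<Oplus>\<^bsub>M\<^esub>x\<in>J. s x \<odot>\<^bsub>M\<^esub> f x y)"
        using insert f sc x by (intro M.finsum_insert) auto
    qed
    also have "\<dots> = s x \<odot>\<^bsub>M\<^esub> lin_sum R M (f x) t \<oplus>\<^bsub>M\<^esub>
        lin_sum R M (\<lambda>y. \<Oplus>\<^bsub>M\<^esub>x\<in>J. s x \<odot>\<^bsub>M\<^esub> f x y) t"
      using lin_sum_add[OF t a b] lin_sum_smult[OF t _ sc, of "f x"] f x by auto
    finally show ?case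
      using insert f sc x lin_sum_closed[OF t] by (subst M.finsum_insert) (auto simp: Pi_iff subset_iff)
  qed
  from this[of "{x. s x \<noteq> \<zero>}"] show ?thesis
    using s by (simp add: carrier_free_mod lin_sum_def)
qed

text \<open>In the free module, \<open>t\<close> is the combination of the generators with
  coefficients \<open>t x\<close>, so a linear map is fixed by its values on generators.\<close>

lemma free_mod_expand:
  assumes "t \<in> carrier (free_mod R X)" "linear_map R (free_mod R X) M \<phi>"
  shows "\<phi> t = lin_sum R M (\<lambda>x. \<phi> (free_gen R x)) t"
proof -
  interpret F: module R "free_mod R X" by (rule R.module_free_mod)
  let ?F = "free_mod R X"
  have fin: "finite {x. t x \<noteq> \<zero>}" "{x. t x \<noteq> \<zero>} \<subseteq> X" "\<And>x. t x \<in> carrier R"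
    using assms by (auto simp: carrier_free_mod)
  have gen: "free_gen R \<in> X \<rightarrow> carrier ?F" by (auto intro: R.free_gen_closed)
  \<comment> \<open>Computed pointwise: the partial sum over \<open>J\<close> is \<open>t\<close>
    cut off outside \<open>J\<close>.\<close>
  have ev: "(\<Oplus>\<^bsub>?F\<^esub>x\<in>J. t x \<odot>\<^bsub>?F\<^esub> free_gen R x) = (\<lambda>y. if y \<in> J then t y else \<zero>)"
    if "finite J" "J \<subseteq> X" for J
    using that
  proof induction
    case empty
    then show ?case by (simp add: free_mod_simps)
  next
    case (insert x J)
    have "(\<Oplus>\<^bsub>?F\<^esub>x\<in>insert x J. t x \<odot>\<^bsub>?F\<^esub> free_gen R x) =
        t x \<odot>\<^bsub>?F\<^esub> free_gen R x \<oplus>\<^bsub>?F\<^esub> (\<Oplus>\<^bsub>?F\<^esub>x\<in>J. t x \<odot>\<^bsub>?F\<^esub> free_gen R x)"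
      using insert fin gen by (intro F.finsum_insert) (auto simp: subset_iff Pi_iff)
    then show ?case
      using insert fin by (auto simp: free_mod_simps free_gen_def)
  qed
  have "lin_sum R ?F (free_gen R) t = t"
    unfolding lin_sum_def using ev[OF fin(1,2)] by auto
  then show ?thesis
    using F.linear_map_lin_sum_comm[OF module_axioms assms(2,1) gen] by simp
qed

end

section \<open>Modules given by generators and relations\<close>

lemma (in module) submodule_abelian_subgroup:
  assumes "submodule N R M"
  shows "abelian_subgroup N M"
  using assms by (intro abelian_subgroupI3 additive_subgroup.intro M.abelian_group_axioms)
    (simp add: submodule_def)

context module
begin

context
  fixes N
  assumes N: "submodule N R M"
begin

interpretation N: abelian_subgroup N M by (rule submodule_abelian_subgroup[OF N])

lemma carrier_quot_mod: "X \<in> carrier (quot_mod M N) \<longleftrightarrow> (\<exists>x\<in>carrier M. X = N +>\<^bsub>M\<^esub> x)"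
  by (auto simp: quot_mod_def A_RCOSETS_def')

lemma coset_closed: "x \<in> carrier M \<Longrightarrow> N +>\<^bsub>M\<^esub> x \<in> carrier (quot_mod M N)"
  by (auto simp: carrier_quot_mod)

lemma quot_mod_cases:
  assumes "X \<in> carrier (quot_mod M N)"
  obtains x where "x \<in> carrier M" "X = N +>\<^bsub>M\<^esub> x"
  using assms by (auto simp: carrier_quot_mod)

lemma zero_quot_mod: "\<zero>\<^bsub>quot_mod M N\<^esub> = N +>\<^bsub>M\<^esub> \<zero>\<^bsub>M\<^esub>"
  by (simp add: quot_mod_def N.a_subset)

lemma add_quot_mod:
  assumes "x \<in> carrier M" "y \<in> carrier M"
  shows "(N +>\<^bsub>M\<^esub> x) \<oplus>\<^bsub>quot_mod M N\<^esub> (N +>\<^bsub>M\<^esub> y) = N +>\<^bsub>M\<^esub> (x \<oplus>\<^bsub>M\<^esub> y)"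
  using assms by (simp add: quot_mod_def N.a_rcos_sum)

text \<open>The scalar product of \<open>quot_mod\<close> is a union of cosets indexed by all
  members of the given coset. Since \<open>N\<close> is closed under scalars, these cosets
  coincide.\<close>

lemma smult_quot_mod:
  assumes "c \<in> carrier R" "x \<in> carrier M"
  shows "c \<odot>\<^bsub>quot_mod M N\<^esub> (N +>\<^bsub>M\<^esub> x) = N +>\<^bsub>M\<^esub> (c \<odot>\<^bsub>M\<^esub> x)"
proof -
  have "N +>\<^bsub>M\<^esub> (c \<odot>\<^bsub>M\<^esub> y) = N +>\<^bsub>M\<^esub> (c \<odot>\<^bsub>M\<^esub> x)" if y: "y \<in> N +>\<^bsub>M\<^esub> x" for y
  proof -
    have yc: "y \<in> carrier M" using N.a_elemrcos_carrier[OF assms(2) y] .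
    have "c \<odot>\<^bsub>M\<^esub> (y \<oplus>\<^bsub>M\<^esub> \<ominus>\<^bsub>M\<^esub> x) \<in> N"
      using N.a_rcos_module_imp[OF assms(2) y] submodule.smult_closed[OF N assms(1)] by simp
    then have "c \<odot>\<^bsub>M\<^esub> y \<oplus>\<^bsub>M\<^esub> \<ominus>\<^bsub>M\<^esub> (c \<odot>\<^bsub>M\<^esub> x) \<in> N"
      using assms yc by (simp add: smult_r_distr smult_r_minus)
    then have "c \<odot>\<^bsub>M\<^esub> y \<in> N +>\<^bsub>M\<^esub> (c \<odot>\<^bsub>M\<^esub> x)"
      using assms yc by (intro N.a_rcos_module_rev) auto
    then show ?thesis
      using assms N.a_repr_independence' by (metis smult_closed)
  qed
  then have "(\<Union>y\<in>N +>\<^bsub>M\<^esub> x. N +>\<^bsub>M\<^esub> (c \<odot>\<^bsub>M\<^esub> y)) = N +>\<^bsub>M\<^esub> (c \<odot>\<^bsub>M\<^esub> x)"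
    using N.a_rcos_self[OF assms(2)] by (intro SUP_eq_const) blast+
  then show ?thesis
    by (simp add: quot_mod_def)
qed

lemma module_quot_mod: "module R (quot_mod M N)"
proof (rule moduleI)
  show "abelian_group (quot_mod M N)"
  proof (rule abelian_groupI)
    fix X assume "X \<in> carrier (quot_mod M N)"
    then obtain x where x: "x \<in> carrier M" "X = N +>\<^bsub>M\<^esub> x" by (rule quot_mod_cases)
    then show "\<exists>Y\<in>carrier (quot_mod M N). Y \<oplus>\<^bsub>quot_mod M N\<^esub> X = \<zero>\<^bsub>quot_mod M N\<^esub>"
      by (intro bexI[of _ "N +>\<^bsub>M\<^esub> \<ominus>\<^bsub>M\<^esub> x"])
        (simp_all add: coset_closed add_quot_mod zero_quot_mod M.l_neg del: M.a_coset_add_zero)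
  qed ((elim quot_mod_cases)?, simp add: coset_closed add_quot_mod zero_quot_mod M.a_ac
      del: M.a_coset_add_zero)+
qed ((elim quot_mod_cases)?, simp add: coset_closed add_quot_mod smult_quot_mod smult_l_distr
    smult_r_distr smult_assoc1 R.is_cring)+

lemma linear_map_coset: "linear_map R M (quot_mod M N) (\<lambda>x. N +>\<^bsub>M\<^esub> x)"
  by (rule linear_mapI) (simp_all add: coset_closed add_quot_mod smult_quot_mod)

text \<open>Two members of a coset differ by an element of \<open>N\<close>, which \<phi> kills.
  This is the uniqueness behind the definite description in \<open>tensor_lift\<close>.\<close>

lemma linear_map_coset_const:
  assumes "module R P" "linear_map R M P \<phi>" "\<And>n. n \<in> N \<Longrightarrow> \<phi> n = \<zero>\<^bsub>P\<^esub>"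
    and "x \<in> carrier M" "y \<in> N +>\<^bsub>M\<^esub> x"
  shows "\<phi> y = \<phi> x"
proof -
  interpret P: module R P by fact
  have y: "y \<in> carrier M" using N.a_elemrcos_carrier[OF assms(4,5)] .
  have "\<phi> (y \<ominus>\<^bsub>M\<^esub> x) = \<zero>\<^bsub>P\<^esub>"
    using N.a_rcos_module_imp[OF assms(4,5)] assms(3) by (simp add: a_minus_def)
  then show ?thesis
    using linear_map_minus[OF module_axioms assms(1,2) y assms(4)] assms(4) y
      linear_map_closed[OF assms(2)] by (simp add: P.minus_eq_zero_iff)
qed

end

lemma submodule_kernel:
  assumes "module R P" "linear_map R M P \<phi>"
  shows "submodule {x \<in> carrier M. \<phi> x = \<zero>\<^bsub>P\<^esub>} R M"
proof -
  interpret P: module R P by fact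
  show ?thesis
    using linear_mapD[OF assms(2)] linear_map_zero[OF module_axioms assms]
      linear_map_uminus[OF module_axioms assms]
    by (intro submoduleI) auto
qed

lemma submodule_submodule_generated:
  assumes "B \<subseteq> carrier M"
  shows "submodule (submodule_generated R M B) R M"
proof (rule submoduleI)
  show "submodule_generated R M B \<subseteq> carrier M"
    using carrier_is_submodule assms by (auto simp: submodule_generated_def)
  show "\<zero>\<^bsub>M\<^esub> \<in> submodule_generated R M B"
    using subgroup.one_closed by (fastforce simp: submodule_generated_def submodule_def)
qed (use submoduleE in \<open>auto simp: submodule_generated_def\<close>)

lemma submodule_generated_subset: "B \<subseteq> submodule_generated R M B"
  by (auto simp: submodule_generated_def)

text \<open>The kernel of \<phi> is one of the submodules whose intersection is the generated
  one.\<close>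

lemma linear_map_submodule_generated_zero:
  assumes "module R P" "linear_map R M P \<phi>" "B \<subseteq> carrier M" "\<And>b. b \<in> B \<Longrightarrow> \<phi> b = \<zero>\<^bsub>P\<^esub>"
    and "x \<in> submodule_generated R M B"
  shows "\<phi> x = \<zero>\<^bsub>P\<^esub>"
  using submodule_kernel[OF assms(1,2)] assms(3-5) by (auto simp: submodule_generated_def)

end

text \<open>The common form of \<open>tensor_mod\<close> and \<open>tensor_power\<close>, so that
  the universal property has to be proved only once.\<close>

definition pres_mod ::
  "('k, 'r) ring_scheme \<Rightarrow> 'x set \<Rightarrow> ('x \<Rightarrow> 'k) set \<Rightarrow> ('k, ('x \<Rightarrow> 'k) set) module"
  where "pres_mod R X B = quot_mod (free_mod R X) (submodule_generated R (free_mod R X) B)"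

definition pres_gen ::
  "('k, 'r) ring_scheme \<Rightarrow> 'x set \<Rightarrow> ('x \<Rightarrow> 'k) set \<Rightarrow> 'x \<Rightarrow> ('x \<Rightarrow> 'k) set"
  where "pres_gen R X B x = submodule_generated R (free_mod R X) B +>\<^bsub>free_mod R X\<^esub> free_gen R x"

text \<open>The condition under which \<open>f\<close> on generators extends to the quotient. For
  the relations of a tensor product it amounts to bilinearity, for those of a tensor power to
  multilinearity.\<close>

definition compatible ::
  "('k, 'r) ring_scheme \<Rightarrow> ('k, 'p, 'm) module_scheme \<Rightarrow> 'x set \<Rightarrow> ('x \<Rightarrow> 'k) set \<Rightarrow> ('x \<Rightarrow> 'p) \<Rightarrow> bool"
  where "compatible R P X B f \<longleftrightarrow> f \<in> X \<rightarrow> carrier P \<and> (\<forall>b\<in>B. lin_sum R P f b = \<zero>\<^bsub>P\<^esub>)"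

lemma compatible_funcset: "compatible R P X B f \<Longrightarrow> f \<in> X \<rightarrow> carrier P"
  by (simp add: compatible_def)

lemma compatible_closed: "compatible R P X B f \<Longrightarrow> x \<in> X \<Longrightarrow> f x \<in> carrier P"
  by (auto simp: compatible_def)

locale presentation = cring R for R (structure) +
  fixes X :: "'x set" and B :: "('x \<Rightarrow> 'a) set"
  assumes rels_subset: "B \<subseteq> carrier (free_mod R X)"
begin

sublocale F: module R "free_mod R X"
  by (rule module_free_mod)

lemma rels_submodule: "submodule (submodule_generated R (free_mod R X) B) R (free_mod R X)"
  by (rule F.submodule_submodule_generated[OF rels_subset])

lemma module_pres_mod: "module R (pres_mod R X B)"
  unfolding pres_mod_def by (rule F.module_quot_mod[OF rels_submodule])

sublocale Q: module R "pres_mod R X B"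
  by (rule module_pres_mod)

lemma pres_gen_closed: "x \<in> X \<Longrightarrow> pres_gen R X B x \<in> carrier (pres_mod R X B)"
  unfolding pres_mod_def pres_gen_def
  by (auto simp: F.carrier_quot_mod[OF rels_submodule] intro: free_gen_closed)

lemma pres_mod_rep:
  assumes "T \<in> carrier (pres_mod R X B)"
  obtains t where "t \<in> T" "t \<in> carrier (free_mod R X)"
    "T = submodule_generated R (free_mod R X) B +>\<^bsub>free_mod R X\<^esub> t"
proof -
  interpret N: abelian_subgroup "submodule_generated R (free_mod R X) B" "free_mod R X"
    by (rule F.submodule_abelian_subgroup[OF rels_submodule])
  show thesis
    using assms that N.a_rcos_self by (auto simp: pres_mod_def F.carrier_quot_mod[OF rels_submodule])
qed

text \<open>The linear map \<open>lin_sum R P f\<close> kills the relations, hence the submodule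
  they generate, hence is constant on the coset \<open>T\<close>. Afterwards the lift may be
  evaluated at any \<open>t\<close> in \<open>T\<close>.\<close>

lemma tensor_lift_eq:
  assumes "module R P" "compatible R P X B f" "T \<in> carrier (pres_mod R X B)" "t \<in> T"
  shows "tensor_lift R P f T = lin_sum R P f t" "t \<in> carrier (free_mod R X)"
proof -
  interpret P: module R P by fact
  interpret N: abelian_subgroup "submodule_generated R (free_mod R X) B" "free_mod R X"
    by (rule F.submodule_abelian_subgroup[OF rels_submodule])
  obtain s where s: "s \<in> T" "s \<in> carrier (free_mod R X)"
    "T = submodule_generated R (free_mod R X) B +>\<^bsub>free_mod R X\<^esub> s"
    using pres_mod_rep[OF assms(3)] .
  note lin = P.linear_map_lin_sum[OF compatible_funcset[OF assms(2)]]
  have zero: "lin_sum R P f u = \<zero>\<^bsub>P\<^esub>" if "u \<in> submodule_generated R (free_mod R X) B" for u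
    using assms(2) by (intro F.linear_map_submodule_generated_zero[OF assms(1) lin rels_subset _ that])
      (auto simp: compatible_def)
  have const: "lin_sum R P f u = lin_sum R P f s" if "u \<in> T" for u
    using F.linear_map_coset_const[OF rels_submodule assms(1) lin zero s(2)] s(3) that by blast
  show "tensor_lift R P f T = lin_sum R P f t"
    unfolding tensor_lift_def lin_sum_def[symmetric]
    using assms(4) const by (intro the_equality) auto
  show "t \<in> carrier (free_mod R X)"
    using assms(4) N.a_elemrcos_carrier s by blast
qed

lemma linear_map_tensor_lift:
  assumes "module R P" "compatible R P X B f"
  shows "linear_map R (pres_mod R X B) P (tensor_lift R P f)"
proof (rule linear_mapI)
  interpret P: module R P by fact
  interpret N: abelian_subgroup "submodule_generated R (free_mod R X) B" "free_mod R X"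
    by (rule F.submodule_abelian_subgroup[OF rels_submodule])
  note lin = P.linear_map_lin_sum[OF compatible_funcset[OF assms(2)]]
  note simps = F.add_quot_mod[OF rels_submodule] F.smult_quot_mod[OF rels_submodule]
  show "tensor_lift R P f T \<in> carrier P" if T: "T \<in> carrier (pres_mod R X B)" for T
  proof -
    obtain t where "t \<in> T" using pres_mod_rep[OF T] .
    then show ?thesis
      using tensor_lift_eq[OF assms T] linear_map_closed[OF lin] by simp
  qed
  fix T assume T: "T \<in> carrier (pres_mod R X B)"
  obtain t where t: "t \<in> T" "t \<in> carrier (free_mod R X)"
      "T = submodule_generated R (free_mod R X) B +>\<^bsub>free_mod R X\<^esub> t"
    using pres_mod_rep[OF T] .
  show "tensor_lift R P f (T \<oplus>\<^bsub>pres_mod R X B\<^esub> U) = tensor_lift R P f T \<oplus>\<^bsub>P\<^esub> tensor_lift R P f U"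
    if U: "U \<in> carrier (pres_mod R X B)" for U
  proof -
    obtain u where u: "u \<in> U" "u \<in> carrier (free_mod R X)"
      "U = submodule_generated R (free_mod R X) B +>\<^bsub>free_mod R X\<^esub> u"
      using pres_mod_rep[OF U] .
    have "t \<oplus>\<^bsub>free_mod R X\<^esub> u \<in> T \<oplus>\<^bsub>pres_mod R X B\<^esub> U"
      using t u by (simp add: pres_mod_def simps N.a_rcos_self)
    then show ?thesis
      using tensor_lift_eq(1)[OF assms T t(1)] tensor_lift_eq(1)[OF assms U u(1)]
        tensor_lift_eq(1)[OF assms Q.a_closed[OF T U]] linear_map_add[OF lin t(2) u(2)] by simp
  qed
  show "tensor_lift R P f (c \<odot>\<^bsub>pres_mod R X B\<^esub> T) = c \<odot>\<^bsub>P\<^esub> tensor_lift R P f T"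
    if c: "c \<in> carrier R" for c
  proof -
    have "c \<odot>\<^bsub>free_mod R X\<^esub> t \<in> c \<odot>\<^bsub>pres_mod R X B\<^esub> T"
      using t c by (simp add: pres_mod_def simps N.a_rcos_self)
    then show ?thesis
      using tensor_lift_eq(1)[OF assms T t(1)]
        tensor_lift_eq(1)[OF assms Q.smult_closed[OF c T]] linear_map_smult[OF lin c t(2)] by simp
  qed
qed

lemma tensor_lift_closed:
  assumes "module R P" "compatible R P X B f" "T \<in> carrier (pres_mod R X B)"
  shows "tensor_lift R P f T \<in> carrier P"
  using linear_map_closed[OF linear_map_tensor_lift[OF assms(1,2)] assms(3)] .

lemma tensor_lift_gen:
  assumes "module R P" "compatible R P X B f" "x \<in> X"
  shows "tensor_lift R P f (pres_gen R X B x) = f x"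
proof -
  interpret P: module R P by fact
  interpret N: abelian_subgroup "submodule_generated R (free_mod R X) B" "free_mod R X"
    by (rule F.submodule_abelian_subgroup[OF rels_submodule])
  have "free_gen R x \<in> pres_gen R X B x"
    unfolding pres_gen_def using N.a_rcos_self free_gen_closed[OF assms(3)] by simp
  then show ?thesis
    using tensor_lift_eq(1)[OF assms(1,2) pres_gen_closed[OF assms(3)]]
      P.lin_sum_free_gen[OF assms(3) compatible_funcset[OF assms(2)]] by simp
qed

text \<open>In the quotient, a relation becomes its own coset, which is zero. The bilinearity of
  \<open>tensor\<close> and the multilinearity of \<open>tensor_list\<close> are read off from
  this.\<close>

lemma compatible_gen: "compatible R (pres_mod R X B) X B (pres_gen R X B)"
  unfolding compatible_def
proof (intro conjI ballI)
  show "pres_gen R X B \<in> X \<rightarrow> carrier (pres_mod R X B)"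
    using pres_gen_closed by auto
  interpret N: abelian_subgroup "submodule_generated R (free_mod R X) B" "free_mod R X"
    by (rule F.submodule_abelian_subgroup[OF rels_submodule])
  fix b assume b: "b \<in> B"
  have "lin_sum R (pres_mod R X B) (pres_gen R X B) b =
      submodule_generated R (free_mod R X) B +>\<^bsub>free_mod R X\<^esub> b"
    using Q.free_mod_expand[OF _ F.linear_map_coset[OF rels_submodule, folded pres_mod_def]] b
      rels_subset
    by (simp add: pres_gen_def[abs_def] subset_iff)
  also have "\<dots> = submodule_generated R (free_mod R X) B"
    using N.a_rcos_const b F.submodule_generated_subset by blast
  finally show "lin_sum R (pres_mod R X B) (pres_gen R X B) b = \<zero>\<^bsub>pres_mod R X B\<^esub>"
    by (simp add: pres_mod_def quot_mod_def)
qed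

text \<open>The uniqueness half of the universal property; existence is
  \<open>linear_map_tensor_lift\<close> with \<open>tensor_lift_gen\<close>. Composed with the
  projection, each map is linear on the free module, where values on generators decide.\<close>

lemma pres_mod_ext:
  assumes "module R P" "linear_map R (pres_mod R X B) P \<phi>" "linear_map R (pres_mod R X B) P \<psi>"
    and "\<And>x. x \<in> X \<Longrightarrow> \<phi> (pres_gen R X B x) = \<psi> (pres_gen R X B x)"
    and "T \<in> carrier (pres_mod R X B)"
  shows "\<phi> T = \<psi> T"
proof -
  interpret P: module R P by fact
  obtain t where t: "t \<in> carrier (free_mod R X)"
      "T = submodule_generated R (free_mod R X) B +>\<^bsub>free_mod R X\<^esub> t"
    using pres_mod_rep[OF assms(5)] .
  have expand: "\<chi> T = lin_sum R P (\<lambda>x. \<chi> (pres_gen R X B x)) t"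
    if "linear_map R (pres_mod R X B) P \<chi>" for \<chi>
    using P.free_mod_expand[OF t(1) linear_map_comp[OF F.linear_map_coset[OF rels_submodule]
          that[unfolded pres_mod_def]]] t(2)
    by (simp add: pres_gen_def)
  show ?thesis
    unfolding expand[OF assms(2)] expand[OF assms(3)]
    using linear_map_closed[OF assms(3)] pres_gen_closed assms(4)
    by (intro P.lin_sum_cong[OF t(1)]) auto
qed

lemma compatible_comp:
  assumes "module R P" "module R P'" "compatible R P X B f" "linear_map R P P' \<phi>"
  shows "compatible R P' X B (\<lambda>x. \<phi> (f x))"
proof -
  interpret P: module R P by fact
  show ?thesis
    unfolding compatible_def
  proof (intro conjI ballI)
    show "(\<lambda>x. \<phi> (f x)) \<in> X \<rightarrow> carrier P'"
      using compatible_funcset[OF assms(3)] linear_map_closed[OF assms(4)] by auto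
    fix b assume b: "b \<in> B"
    then have "lin_sum R P' (\<lambda>x. \<phi> (f x)) b = \<phi> (lin_sum R P f b)"
      using rels_subset P.linear_map_lin_sum_comm[OF assms(2,4) _ compatible_funcset[OF assms(3)]]
      by auto
    then show "lin_sum R P' (\<lambda>x. \<phi> (f x)) b = \<zero>\<^bsub>P'\<^esub>"
      using b assms(3) linear_map_zero[OF assms(1,2,4)] by (simp add: compatible_def)
  qed
qed

lemma compatible_cong:
  assumes "module R P" "compatible R P X B g" "\<And>x. x \<in> X \<Longrightarrow> f x = g x"
  shows "compatible R P X B f"
proof -
  interpret P: module R P by fact
  have "lin_sum R P f b = lin_sum R P g b" if "b \<in> B" for b
    using P.lin_sum_cong[OF _ compatible_funcset[OF assms(2)] assms(3)] rels_subset that by blast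
  then show ?thesis
    using assms(2,3) by (auto simp: compatible_def)
qed

text \<open>Both sides are linear in \<open>T\<close> and agree on generators. In Sweedler notation:
  a linear map passes inside the summation.\<close>

lemma tensor_lift_linear:
  assumes "module R P" "module R P'" "compatible R P X B f" "linear_map R P P' \<phi>"
    and "T \<in> carrier (pres_mod R X B)"
  shows "\<phi> (tensor_lift R P f T) = tensor_lift R P' (\<lambda>x. \<phi> (f x)) T"
  by (rule pres_mod_ext[OF assms(2) linear_map_comp[OF linear_map_tensor_lift[OF assms(1,3)] assms(4)]
        linear_map_tensor_lift[OF assms(2) compatible_comp[OF assms(1-4)]]])
    (simp_all add: assms tensor_lift_gen[OF assms(1,3)]
      tensor_lift_gen[OF assms(2) compatible_comp[OF assms(1-4)]])

lemma tensor_lift_cong: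
  assumes "module R P" "compatible R P X B g" "\<And>x. x \<in> X \<Longrightarrow> f x = g x"
    and "T \<in> carrier (pres_mod R X B)"
  shows "tensor_lift R P f T = tensor_lift R P g T"
proof -
  have f: "compatible R P X B f"
    by (rule compatible_cong[OF assms(1,2)]) (rule assms(3))
  show ?thesis
    by (rule pres_mod_ext[OF assms(1) linear_map_tensor_lift[OF assms(1) f]
          linear_map_tensor_lift[OF assms(1,2)] _ assms(4)])
      (simp add: assms(3) tensor_lift_gen[OF assms(1) f] tensor_lift_gen[OF assms(1,2)])
qed

text \<open>After an exchange of sums, each inner sum is the value at a relation with
  \<open>y\<close> fixed, hence zero.\<close>

lemma compatible_lin_sum:
  assumes "module R P" "t \<in> carrier (free_mod R Y)" "\<And>y. y \<in> Y \<Longrightarrow> compatible R P X B (\<lambda>x. f x y)"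
  shows "compatible R P X B (\<lambda>x. lin_sum R P (f x) t)"
proof -
  interpret P: module R P by fact
  have cl: "f x y \<in> carrier P" if "x \<in> X" "y \<in> Y" for x y
    using compatible_closed[OF assms(3)] that by auto
  show ?thesis
    unfolding compatible_def
  proof (intro conjI ballI)
    show "(\<lambda>x. lin_sum R P (f x) t) \<in> X \<rightarrow> carrier P"
      using cl by (auto intro!: P.lin_sum_closed[OF assms(2)])
    fix b assume b: "b \<in> B"
    then have "lin_sum R P (\<lambda>x. lin_sum R P (f x) t) b = lin_sum R P (\<lambda>y. lin_sum R P (\<lambda>x. f x y) b) t"
      using rels_subset by (intro P.lin_sum_swap[OF _ assms(2)]) (auto intro: cl)
    also have "\<dots> = lin_sum R P (\<lambda>y. \<zero>\<^bsub>P\<^esub>) t"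
      using b assms(3) by (intro P.lin_sum_cong[OF assms(2)]) (auto simp: compatible_def)
    also have "\<dots> = \<zero>\<^bsub>P\<^esub>"
      using P.lin_sum_smult[OF assms(2), of "\<lambda>_. \<zero>\<^bsub>P\<^esub>" \<zero>] P.lin_sum_closed[OF assms(2), of "\<lambda>_. \<zero>\<^bsub>P\<^esub>"]
      by simp
    finally show "lin_sum R P (\<lambda>x. lin_sum R P (f x) t) b = \<zero>\<^bsub>P\<^esub>" .
  qed
qed

text \<open>One representative \<open>t\<close> serves for all \<open>v\<close>, so the lift is a
  sum, with coefficients independent of \<open>v\<close>, of functions linear in
  \<open>v\<close>.\<close>

lemma linear_map_tensor_lift_param:
  assumes "module R P" "module R V" "T \<in> carrier (pres_mod R X B)"
    and "\<And>v. v \<in> carrier V \<Longrightarrow> compatible R P X B (f v)"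
    and "\<And>x. x \<in> X \<Longrightarrow> linear_map R V P (\<lambda>v. f v x)"
  shows "linear_map R V P (\<lambda>v. tensor_lift R P (f v) T)"
proof -
  interpret P: module R P by fact
  obtain t where t: "t \<in> T" "t \<in> carrier (free_mod R X)" using pres_mod_rep[OF assms(3)] .
  show ?thesis
    by (rule linear_map_cong[OF assms(2) P.linear_map_lin_sum_param[OF t(2) assms(5)]])
      (simp_all add: tensor_lift_eq(1)[OF assms(1,4,3) t(1)])
qed

end

lemma compatible_tensor_lift_param:
  assumes "presentation R X B" "presentation R Y C" "module R P" "T \<in> carrier (pres_mod R X B)"
    and "\<And>y. y \<in> Y \<Longrightarrow> compatible R P X B (f y)"
    and "\<And>x. x \<in> X \<Longrightarrow> compatible R P Y C (\<lambda>y. f y x)"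
  shows "compatible R P Y C (\<lambda>y. tensor_lift R P (f y) T)"
proof -
  interpret X: presentation R X B by fact
  interpret Y: presentation R Y C by fact
  obtain t where t: "t \<in> T" "t \<in> carrier (free_mod R X)" using X.pres_mod_rep[OF assms(4)] .
  show ?thesis
    by (rule Y.compatible_cong[OF assms(3) Y.compatible_lin_sum[OF assms(3) t(2) assms(6)]])
      (simp_all add: X.tensor_lift_eq(1)[OF assms(3,5,4) t(1)])
qed

section \<open>Tensor products and tensor powers\<close>

lemma tensor_mod_eq:
  "tensor_mod R M N = pres_mod R (carrier M \<times> carrier N) (tensor_rels R M N)"
  by (simp add: tensor_mod_def pres_mod_def tensor_null_def)

lemma tensor_eq:
  "tensor R M N x y = pres_gen R (carrier M \<times> carrier N) (tensor_rels R M N) (x, y)"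
  by (simp add: tensor_def pres_gen_def tensor_null_def)

lemma tensor_power_eq: "tensor_power R M n = pres_mod R (power_gens M n) (power_rels R M n)"
  by (simp add: tensor_power_def pres_mod_def power_null_def)

lemma tensor_list_eq:
  "length xs = n \<Longrightarrow> tensor_list R M xs = pres_gen R (power_gens M n) (power_rels R M n) xs"
  by (simp add: tensor_list_def pres_gen_def power_null_def)

lemma presentation_tensor:
  assumes "module R M" "module R N"
  shows "presentation R (carrier M \<times> carrier N) (tensor_rels R M N)"
proof -
  interpret M: module R M by fact
  interpret N: module R N by fact
  interpret F: module R "free_mod R (carrier M \<times> carrier N)" by (rule M.module_free_mod)
  show ?thesis
    by unfold_locales (auto simp: tensor_rels_def Let_def intro!: F.minus_closed M.free_gen_closed)
qed

lemma power_gens_update: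
  "xs \<in> power_gens M n \<Longrightarrow> x \<in> carrier M \<Longrightarrow> xs[i := x] \<in> power_gens M n"
  unfolding power_gens_def using set_update_subset_insert[of xs i x] by auto

lemma presentation_power:
  assumes "module R M"
  shows "presentation R (power_gens M n) (power_rels R M n)"
proof -
  interpret M: module R M by fact
  interpret F: module R "free_mod R (power_gens M n)" by (rule M.module_free_mod)
  show ?thesis
    by unfold_locales (auto simp: power_rels_def Let_def power_gens_update
        intro!: F.minus_closed M.free_gen_closed)
qed

section \<open>Relations of tensor products and tensor powers read as linearity in each slot\<close>

context module
begin

text \<open>Turns vanishing on one relation into an identity for \<open>f\<close>, so that
  \<open>compatible\<close> and linearity in each slot can be traded in both directions.\<close>

lemma lin_sum_add_rel_iff:
  assumes "f \<in> X \<rightarrow> carrier M" "p \<in> X" "q \<in> X" "r \<in> X"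
  shows "lin_sum R M f (free_gen R p \<ominus>\<^bsub>free_mod R X\<^esub> (free_gen R q \<oplus>\<^bsub>free_mod R X\<^esub> free_gen R r)) = \<zero>\<^bsub>M\<^esub>
    \<longleftrightarrow> f p = f q \<oplus>\<^bsub>M\<^esub> f r"
proof -
  interpret F: module R "free_mod R X" by (rule R.module_free_mod)
  note lin = linear_map_lin_sum[OF assms(1)]
  have "f p \<in> carrier M" "f q \<in> carrier M" "f r \<in> carrier M" using assms by (auto simp: Pi_iff)
  then show ?thesis
    using assms R.free_gen_closed[of _ X]
    by (simp add: linear_map_minus[OF F.module_axioms module_axioms lin] linear_map_add[OF lin]
        lin_sum_free_gen[OF _ assms(1)] minus_eq_zero_iff)
qed

lemma lin_sum_smult_rel_iff:
  assumes "f \<in> X \<rightarrow> carrier M" "c \<in> carrier R" "p \<in> X" "q \<in> X"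
  shows "lin_sum R M f (free_gen R p \<ominus>\<^bsub>free_mod R X\<^esub> c \<odot>\<^bsub>free_mod R X\<^esub> free_gen R q) = \<zero>\<^bsub>M\<^esub>
    \<longleftrightarrow> f p = c \<odot>\<^bsub>M\<^esub> f q"
proof -
  interpret F: module R "free_mod R X" by (rule R.module_free_mod)
  note lin = linear_map_lin_sum[OF assms(1)]
  have "f p \<in> carrier M" "f q \<in> carrier M" using assms by (auto simp: Pi_iff)
  then show ?thesis
    using assms R.free_gen_closed[of _ X]
    by (simp add: linear_map_minus[OF F.module_axioms module_axioms lin] linear_map_smult[OF lin]
        lin_sum_free_gen[OF _ assms(1)] minus_eq_zero_iff)
qed

end

lemma
  fixes R M N P f
  assumes "module R M" "module R N" "module R P"
  shows compatible_tensorI: "\<lbrakk>\<And>y. y \<in> carrier N \<Longrightarrow> linear_map R M P (\<lambda>x. f (x, y));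
      \<And>x. x \<in> carrier M \<Longrightarrow> linear_map R N P (\<lambda>y. f (x, y))\<rbrakk>
      \<Longrightarrow> compatible R P (carrier M \<times> carrier N) (tensor_rels R M N) f"
    and compatible_tensor_left: "\<lbrakk>compatible R P (carrier M \<times> carrier N) (tensor_rels R M N) f;
      y \<in> carrier N\<rbrakk> \<Longrightarrow> linear_map R M P (\<lambda>x. f (x, y))"
    and compatible_tensor_right: "\<lbrakk>compatible R P (carrier M \<times> carrier N) (tensor_rels R M N) f;
      x \<in> carrier M\<rbrakk> \<Longrightarrow> linear_map R N P (\<lambda>y. f (x, y))"
proof -
  interpret M: module R M by fact
  interpret N: module R N by fact
  interpret P: module R P by fact
  let ?X = "carrier M \<times> carrier N"
  show "compatible R P ?X (tensor_rels R M N) f"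
    if l: "\<And>y. y \<in> carrier N \<Longrightarrow> linear_map R M P (\<lambda>x. f (x, y))"
      and r: "\<And>x. x \<in> carrier M \<Longrightarrow> linear_map R N P (\<lambda>y. f (x, y))"
  proof -
    have f: "f \<in> ?X \<rightarrow> carrier P" using linear_map_closed[OF l] by auto
    have "lin_sum R P f b = \<zero>\<^bsub>P\<^esub>" if "b \<in> tensor_rels R M N" for b
      using that unfolding tensor_rels_def Let_def
      by (elim UnE CollectE exE conjE)
        (simp_all add: P.lin_sum_add_rel_iff[OF f] P.lin_sum_smult_rel_iff[OF f] linear_mapD[OF l]
          linear_mapD[OF r])
    then show ?thesis using f by (simp add: compatible_def)
  qed
  assume c: "compatible R P ?X (tensor_rels R M N) f"
  then have f: "f \<in> ?X \<rightarrow> carrier P" and rel: "\<And>b. b \<in> tensor_rels R M N \<Longrightarrow> lin_sum R P f b = \<zero>\<^bsub>P\<^esub>"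
    by (auto simp: compatible_def)
  note rel = rel[unfolded tensor_rels_def Let_def]
  show "linear_map R M P (\<lambda>x. f (x, y))" if y: "y \<in> carrier N"
  proof (rule linear_mapI)
    show "f (x, y) \<in> carrier P" if "x \<in> carrier M" for x
      using f that y by auto
    show "f (x \<oplus>\<^bsub>M\<^esub> x', y) = f (x, y) \<oplus>\<^bsub>P\<^esub> f (x', y)" if "x \<in> carrier M" "x' \<in> carrier M" for x x'
      by (subst P.lin_sum_add_rel_iff[OF f, symmetric], use that y in simp_all)
        (rule rel, use that y in blast)
    show "f (d \<odot>\<^bsub>M\<^esub> x, y) = d \<odot>\<^bsub>P\<^esub> f (x, y)" if "d \<in> carrier R" "x \<in> carrier M" for d x
      by (subst P.lin_sum_smult_rel_iff[OF f, symmetric], use that y in simp_all)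
        (rule rel, use that y in blast)
  qed
  show "linear_map R N P (\<lambda>y. f (x, y))" if x: "x \<in> carrier M"
  proof (rule linear_mapI)
    show "f (x, y) \<in> carrier P" if "y \<in> carrier N" for y
      using f that x by auto
    show "f (x, y \<oplus>\<^bsub>N\<^esub> y') = f (x, y) \<oplus>\<^bsub>P\<^esub> f (x, y')" if "y \<in> carrier N" "y' \<in> carrier N" for y y'
      by (subst P.lin_sum_add_rel_iff[OF f, symmetric], use that x in simp_all)
        (rule rel, use that x in blast)
    show "f (x, d \<odot>\<^bsub>N\<^esub> y) = d \<odot>\<^bsub>P\<^esub> f (x, y)" if "d \<in> carrier R" "y \<in> carrier N" for d y
      by (subst P.lin_sum_smult_rel_iff[OF f, symmetric], use that x in simp_all)
        (rule rel, use that x in blast)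
  qed
qed

text \<open>A slot is written \<open>xs @ x # ys\<close> and not as a list update, the form used in
  \<open>power_rels\<close>, because this suits recursion on lists. The membership clause covers
  \<open>n = 0\<close>, where there is no slot.\<close>

definition multilinear ::
  "('k, 'r) ring_scheme \<Rightarrow> ('k, 'a, 'm) module_scheme \<Rightarrow> ('k, 'p, 'n) module_scheme \<Rightarrow> nat \<Rightarrow>
    ('a list \<Rightarrow> 'p) \<Rightarrow> bool"
  where "multilinear R M P n f \<longleftrightarrow> f \<in> power_gens M n \<rightarrow> carrier P \<and>
    (\<forall>xs ys. set xs \<subseteq> carrier M \<longrightarrow> set ys \<subseteq> carrier M \<longrightarrow> Suc (length xs + length ys) = n \<longrightarrow>
      linear_map R M P (\<lambda>x. f (xs @ x # ys)))"

lemma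
  fixes R M P f n
  assumes "module R M" "module R P"
  shows compatible_powerI: "multilinear R M P n f \<Longrightarrow> compatible R P (power_gens M n) (power_rels R M n) f"
    and compatible_powerD: "compatible R P (power_gens M n) (power_rels R M n) f \<Longrightarrow> multilinear R M P n f"
proof -
  interpret M: module R M by fact
  interpret P: module R P by fact
  let ?X = "power_gens M n"
  show "compatible R P ?X (power_rels R M n) f" if m: "multilinear R M P n f"
  proof -
    have f: "f \<in> ?X \<rightarrow> carrier P" using m by (simp add: multilinear_def)
    have lin: "linear_map R M P (\<lambda>x. f (xs[i := x]))" if "xs \<in> ?X" "i < n" for xs i
      using that m set_take_subset[of i xs] set_drop_subset[of "Suc i" xs]
      by (auto simp: upd_conv_take_nth_drop multilinear_def power_gens_def)
    have "lin_sum R P f b = \<zero>\<^bsub>P\<^esub>" if "b \<in> power_rels R M n" for b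
      using that unfolding power_rels_def Let_def
      by (elim UnE CollectE exE conjE)
        (simp_all add: P.lin_sum_add_rel_iff[OF f] P.lin_sum_smult_rel_iff[OF f] power_gens_update
          linear_mapD[OF lin])
    then show ?thesis using f by (simp add: compatible_def)
  qed
  assume "compatible R P ?X (power_rels R M n) f"
  then have f: "f \<in> ?X \<rightarrow> carrier P" and rel: "\<And>b. b \<in> power_rels R M n \<Longrightarrow> lin_sum R P f b = \<zero>\<^bsub>P\<^esub>"
    by (auto simp: compatible_def)
  note rel = rel[unfolded power_rels_def Let_def]
  show "multilinear R M P n f"
    unfolding multilinear_def
  proof (intro conjI allI impI f)
    fix xs ys assume len: "set xs \<subseteq> carrier M" "set ys \<subseteq> carrier M" "Suc (length xs + length ys) = n"
    \<comment> \<open>The zero is a placeholder: every update below overwrites position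
      \<open>i\<close>.\<close>
    define zs where "zs = xs @ \<zero>\<^bsub>M\<^esub> # ys"
    define i where "i = length xs"
    have upd: "xs @ x # ys = zs[i := x]" for x by (simp add: zs_def i_def)
    have z: "zs \<in> ?X" "i < n" using len by (auto simp: power_gens_def zs_def i_def)
    show "linear_map R M P (\<lambda>x. f (xs @ x # ys))"
      unfolding upd
    proof (rule linear_mapI)
      show "f (zs[i := x]) \<in> carrier P" if "x \<in> carrier M" for x
        using f power_gens_update[OF z(1) that] by auto
      show "f (zs[i := x \<oplus>\<^bsub>M\<^esub> y]) = f (zs[i := x]) \<oplus>\<^bsub>P\<^esub> f (zs[i := y])"
        if "x \<in> carrier M" "y \<in> carrier M" for x y
        by (rule P.lin_sum_add_rel_iff[OF f, THEN iffD1];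
            (rule power_gens_update | rule rel); use that z in blast)
      show "f (zs[i := d \<odot>\<^bsub>M\<^esub> x]) = d \<odot>\<^bsub>P\<^esub> f (zs[i := x])" if "d \<in> carrier R" "x \<in> carrier M" for d x
        by (rule P.lin_sum_smult_rel_iff[OF f, THEN iffD1];
            (rule power_gens_update | rule rel)?; use that z in blast)
    qed
  qed
qed

lemma power_gens_Cons: "x # xs \<in> power_gens M (Suc n) \<longleftrightarrow> x \<in> carrier M \<and> xs \<in> power_gens M n"
  by (auto simp: power_gens_def)

lemma multilinear_closed: "multilinear R M P n f \<Longrightarrow> xs \<in> power_gens M n \<Longrightarrow> f xs \<in> carrier P"
  by (auto simp: multilinear_def)

lemma multilinear_slot:
  "multilinear R M P (Suc (length xs + length ys)) f \<Longrightarrow> set xs \<subseteq> carrier M \<Longrightarrow> set ys \<subseteq> carrier M \<Longrightarrow>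
    linear_map R M P (\<lambda>x. f (xs @ x # ys))"
  by (simp add: multilinear_def)

lemma multilinear_Cons:
  assumes "multilinear R M P (Suc n) f" "x \<in> carrier M"
  shows "multilinear R M P n (\<lambda>xs. f (x # xs))"
  unfolding multilinear_def
proof (intro conjI allI impI)
  show "(\<lambda>xs. f (x # xs)) \<in> power_gens M n \<rightarrow> carrier P"
    using assms by (auto simp: multilinear_def power_gens_Cons Pi_iff)
  fix xs ys assume "set xs \<subseteq> carrier M" "set ys \<subseteq> carrier M" "Suc (length xs + length ys) = n"
  then show "linear_map R M P (\<lambda>y. f (x # xs @ y # ys))"
    using multilinear_slot[of R M P "x # xs" ys f] assms by simp
qed

lemma multilinear_head:
  assumes "multilinear R M P (Suc n) f" "xs \<in> power_gens M n"
  shows "linear_map R M P (\<lambda>x. f (x # xs))"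
  using multilinear_slot[of R M P "[]" xs f] assms by (simp add: power_gens_def)

lemma multilinear_comp:
  assumes "multilinear R M P n f" "linear_map R P Q \<phi>"
  shows "multilinear R M Q n (\<lambda>xs. \<phi> (f xs))"
  using assms linear_map_closed[OF assms(2)] linear_map_comp[OF _ assms(2)]
  unfolding multilinear_def by (fastforce simp: Pi_iff)

section \<open>Multibilinear functions and Sweedler sums\<close>

definition pair_lists ::
  "('k, 'a, 'm) module_scheme \<Rightarrow> ('k, 'b, 'n) module_scheme \<Rightarrow> nat \<Rightarrow> ('a \<times> 'b) list set"
  where "pair_lists M N n = {ps. length ps = n \<and> set ps \<subseteq> carrier M \<times> carrier N}"

lemma pair_lists_map:
  assumes "ps \<in> pair_lists M N n"
  shows "map fst ps \<in> power_gens M n" "map snd ps \<in> power_gens N n"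
  using assms by (force simp: pair_lists_def power_gens_def)+

lemma pair_lists_Cons:
  "p # ps \<in> pair_lists M N (Suc n) \<longleftrightarrow> p \<in> carrier M \<times> carrier N \<and> ps \<in> pair_lists M N n"
  by (auto simp: pair_lists_def)

text \<open>What a Sweedler sum over several entries needs of its summand. Each slot is required to
  be \<open>compatible\<close> because this is the hypothesis under which \<open>tensor_lift\<close>
  can be evaluated.\<close>

definition multibilinear ::
  "('k, 'r) ring_scheme \<Rightarrow> ('k, 'a, 'm) module_scheme \<Rightarrow> ('k, 'b, 'n) module_scheme \<Rightarrow>
    ('k, 'p, 'q) module_scheme \<Rightarrow> nat \<Rightarrow> (('a \<times> 'b) list \<Rightarrow> 'p) \<Rightarrow> bool"
  where "multibilinear R M N P n f \<longleftrightarrow> f \<in> pair_lists M N n \<rightarrow> carrier P \<and>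
    (\<forall>ps qs. set ps \<subseteq> carrier M \<times> carrier N \<longrightarrow> set qs \<subseteq> carrier M \<times> carrier N \<longrightarrow>
      Suc (length ps + length qs) = n \<longrightarrow>
      compatible R P (carrier M \<times> carrier N) (tensor_rels R M N) (\<lambda>p. f (ps @ p # qs)))"

lemma multibilinear_closed: "multibilinear R M N P n f \<Longrightarrow> ps \<in> pair_lists M N n \<Longrightarrow> f ps \<in> carrier P"
  by (auto simp: multibilinear_def)

lemma multibilinear_slot:
  "multibilinear R M N P (Suc (length ps + length qs)) f \<Longrightarrow> set ps \<subseteq> carrier M \<times> carrier N \<Longrightarrow>
    set qs \<subseteq> carrier M \<times> carrier N \<Longrightarrow>
    compatible R P (carrier M \<times> carrier N) (tensor_rels R M N) (\<lambda>p. f (ps @ p # qs))"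
  by (simp add: multibilinear_def)

lemma multibilinear_Cons:
  assumes "multibilinear R M N P (Suc n) f" "p \<in> carrier M \<times> carrier N"
  shows "multibilinear R M N P n (\<lambda>ps. f (p # ps))"
  unfolding multibilinear_def
proof (intro conjI allI impI)
  show "(\<lambda>ps. f (p # ps)) \<in> pair_lists M N n \<rightarrow> carrier P"
    using assms by (auto simp: multibilinear_def pair_lists_Cons)
  fix ps qs assume "set ps \<subseteq> carrier M \<times> carrier N" "set qs \<subseteq> carrier M \<times> carrier N"
    "Suc (length ps + length qs) = n"
  then show "compatible R P (carrier M \<times> carrier N) (tensor_rels R M N) (\<lambda>q. f (p # ps @ q # qs))"
    using multibilinear_slot[of R M N P "p # ps" qs f] assms by simp
qed

lemma multibilinear_head:
  assumes "multibilinear R M N P (Suc n) f" "ps \<in> pair_lists M N n"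
  shows "compatible R P (carrier M \<times> carrier N) (tensor_rels R M N) (\<lambda>p. f (p # ps))"
  using multibilinear_slot[of R M N P "[]" ps f] assms by (simp add: pair_lists_def)

text \<open>For summands that see the pairs only through the list of first and the list of second
  components; multilinearity in each list separately is then enough.\<close>

lemma multibilinearI:
  assumes "module R M" "module R N" "module R P"
    and "\<And>ys. ys \<in> power_gens N n \<Longrightarrow> multilinear R M P n (\<lambda>xs. G xs ys)"
    and "\<And>xs. xs \<in> power_gens M n \<Longrightarrow> multilinear R N P n (\<lambda>ys. G xs ys)"
  shows "multibilinear R M N P n (\<lambda>ps. G (map fst ps) (map snd ps))"
  unfolding multibilinear_def
proof (intro conjI allI impI)
  show "(\<lambda>ps. G (map fst ps) (map snd ps)) \<in> pair_lists M N n \<rightarrow> carrier P"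
    using multilinear_closed[OF assms(4)] pair_lists_map by blast
  fix ps qs assume ps: "set ps \<subseteq> carrier M \<times> carrier N" "set qs \<subseteq> carrier M \<times> carrier N"
    "Suc (length ps + length qs) = n"
  have sets: "set (map fst ps) \<subseteq> carrier M" "set (map fst qs) \<subseteq> carrier M"
    "set (map snd ps) \<subseteq> carrier N" "set (map snd qs) \<subseteq> carrier N"
    using ps by force+
  show "compatible R P (carrier M \<times> carrier N) (tensor_rels R M N)
      (\<lambda>p. G (map fst (ps @ p # qs)) (map snd (ps @ p # qs)))"
  proof (rule compatible_tensorI[OF assms(1-3)])
    fix y assume "y \<in> carrier N"
    then have "map snd ps @ y # map snd qs \<in> power_gens N n"
      using sets ps(3) by (simp add: power_gens_def)
    from multilinear_slot[of R M P "map fst ps" "map fst qs", OF _ sets(1,2)] assms(4)[OF this] ps(3)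
    show "linear_map R M P (\<lambda>x. G (map fst (ps @ (x, y) # qs)) (map snd (ps @ (x, y) # qs)))"
      by simp
  next
    fix x assume "x \<in> carrier M"
    then have "map fst ps @ x # map fst qs \<in> power_gens M n"
      using sets ps(3) by (simp add: power_gens_def)
    from multilinear_slot[of R N P "map snd ps" "map snd qs", OF _ sets(3,4)] assms(5)[OF this] ps(3)
    show "linear_map R N P (\<lambda>y. G (map fst (ps @ (x, y) # qs)) (map snd (ps @ (x, y) # qs)))"
      by simp
  qed
qed

lemma sweedler_sum_append:
  "sweedler_sum R P \<beta> f (as @ bs) =
    sweedler_sum R P \<beta> (\<lambda>ps. sweedler_sum R P \<beta> (\<lambda>qs. f (ps @ qs)) bs) as"
  by (induction as arbitrary: f) simp_all

text \<open>Serves for the coproduct, with all three modules equal to \<open>H\<close>, and for the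
  coaction, with \<open>C\<close> and \<open>M\<close> equal to \<open>A\<close>. Only linearity
  enters here; multiplicativity and coassociativity come later.\<close>

locale linear_coaction = C?: module R C + M?: module R M + N?: module R N
  for R (structure) and C :: "('a, 'c, 'x) module_scheme" and M :: "('a, 'm, 'y) module_scheme"
    and N :: "('a, 'n, 'z) module_scheme" +
  fixes \<beta> :: "'c \<Rightarrow> ('m \<times> 'n \<Rightarrow> 'a) set"
  assumes coaction_linear: "linear_map R C (tensor_mod R M N) \<beta>"
begin

abbreviation "bilin P \<equiv> compatible R P (carrier M \<times> carrier N) (tensor_rels R M N)"
abbreviation "multibil P \<equiv> multibilinear R M N P"
abbreviation "pairs \<equiv> pair_lists M N"
abbreviation "sweedler P \<equiv> sweedler_sum R P \<beta>"

lemma presentation_T: "presentation R (carrier M \<times> carrier N) (tensor_rels R M N)"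
  by (rule presentation_tensor[OF M.module_axioms N.module_axioms])

interpretation T: presentation R "carrier M \<times> carrier N" "tensor_rels R M N"
  by (rule presentation_T)

lemma coaction_pres: "linear_map R C (pres_mod R (carrier M \<times> carrier N) (tensor_rels R M N)) \<beta>"
  using coaction_linear by (simp add: tensor_mod_eq)

lemma coaction_closed:
  "a \<in> carrier C \<Longrightarrow> \<beta> a \<in> carrier (pres_mod R (carrier M \<times> carrier N) (tensor_rels R M N))"
  using linear_map_closed[OF coaction_pres] .

lemma linear_map_lift:
  assumes "module R P" "bilin P f"
  shows "linear_map R C P (\<lambda>a. tensor_lift R P f (\<beta> a))"
  by (rule linear_map_comp[OF coaction_pres T.linear_map_tensor_lift[OF assms]])

lemma multibil_cong:
  assumes "module R P" "multibil P n g" "\<And>ps. ps \<in> pairs n \<Longrightarrow> f ps = g ps"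
  shows "multibil P n f"
  unfolding multibilinear_def
proof (intro conjI allI impI)
  show "f \<in> pairs n \<rightarrow> carrier P"
    using assms by (auto simp: multibilinear_def)
  fix ps qs assume "set ps \<subseteq> carrier M \<times> carrier N" "set qs \<subseteq> carrier M \<times> carrier N"
    "Suc (length ps + length qs) = n"
  then show "bilin P (\<lambda>p. f (ps @ p # qs))"
    using assms(2,3)
    by (intro T.compatible_cong[OF assms(1), of "\<lambda>p. g (ps @ p # qs)" "\<lambda>p. f (ps @ p # qs)"])
      (auto simp: multibilinear_def pair_lists_def)
qed

lemma multibil_comp:
  assumes "module R P" "module R P'" "multibil P n f" "linear_map R P P' \<phi>"
  shows "multibil P' n (\<lambda>ps. \<phi> (f ps))"
  using assms(3) linear_map_closed[OF assms(4)] T.compatible_comp[OF assms(1,2) _ assms(4)]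
  by (auto simp: multibilinear_def Pi_iff)

text \<open>
  A Sweedler sum of a multibilinear function is a finite sum whose coefficients do not depend on the
  function.  This makes exchanging summations and checking linearity in parameters automatic.
\<close>

lemma sweedler_weights:
  assumes P: "module R P" and "as \<in> power_gens C n"
  shows "\<exists>w\<in>carrier (free_mod R (pairs n)). \<forall>f. multibil P n f \<longrightarrow> sweedler P f as = lin_sum R P f w"
  using assms(2)
proof (induction as arbitrary: n)
  case Nil
  interpret P: module R P by fact
  have n: "n = 0" using Nil by (simp add: power_gens_def)
  have "[] \<in> pairs 0" by (simp add: pair_lists_def)
  then show ?case
    using n P.lin_sum_free_gen[of "[]" "pairs 0"]
    by (intro bexI[of _ "free_gen R []"]) (auto simp: multibilinear_def intro: R.free_gen_closed)
next
  case (Cons a as)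
  interpret P: module R P by fact
  obtain m where n: "n = Suc m" "as \<in> power_gens C m" "a \<in> carrier C"
    using Cons.prems by (cases n) (auto simp: power_gens_def)
  obtain w where w: "w \<in> carrier (free_mod R (pairs m))"
    and wf: "\<And>f. multibil P m f \<Longrightarrow> sweedler P f as = lin_sum R P f w"
    using Cons.IH[OF n(2)] by blast
  obtain t where t: "t \<in> \<beta> a" "t \<in> carrier (free_mod R (carrier M \<times> carrier N))"
    using T.pres_mod_rep[OF coaction_closed[OF n(3)]] by blast
  let ?F = "free_mod R (pairs n)"
  interpret F: module R ?F by (rule R.module_free_mod)
  \<comment> \<open>\<open>?v p\<close> is the weight \<open>w\<close> of the tail pushed forward
    along prepending \<open>p\<close>. Summing it against a representative \<open>t\<close> of
    \<open>\<beta> a\<close> gives the weight of \<open>a # as\<close>.\<close>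
  let ?v = "\<lambda>p. lin_sum R ?F (\<lambda>ps. free_gen R (p # ps)) w"
  have g: "(\<lambda>ps. free_gen R (p # ps)) \<in> pairs m \<rightarrow> carrier ?F" if "p \<in> carrier M \<times> carrier N" for p
    using that by (auto simp: n pair_lists_Cons intro!: R.free_gen_closed)
  have v: "?v \<in> carrier M \<times> carrier N \<rightarrow> carrier ?F"
    using F.lin_sum_closed[OF w g] by blast
  have "sweedler P f (a # as) = lin_sum R P f (lin_sum R ?F ?v t)" if f: "multibil P n f" for f
  proof -
    have c: "bilin P (\<lambda>p. lin_sum R P (\<lambda>ps. f (p # ps)) w)"
      using f by (intro T.compatible_lin_sum[OF P w] multibilinear_head[of R M N P m]) (simp_all add: n)
    have cl: "(\<lambda>ps. f (p # ps)) \<in> pairs m \<rightarrow> carrier P" if "p \<in> carrier M \<times> carrier N" for p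
      using multibilinear_closed[OF multibilinear_Cons[OF f[unfolded n] that]] by auto
    have ff: "f \<in> pairs n \<rightarrow> carrier P" using multibilinear_closed[OF f] by auto
    note lin = P.linear_map_lin_sum[OF ff]
    have "sweedler P f (a # as) = tensor_lift R P (\<lambda>p. lin_sum R P (\<lambda>ps. f (p # ps)) w) (\<beta> a)"
      using wf[OF multibilinear_Cons[OF f[unfolded n]]]
      by (simp, intro T.tensor_lift_cong[OF P c _ coaction_closed[OF n(3)]])
    also have "\<dots> = lin_sum R P (\<lambda>p. lin_sum R P (\<lambda>ps. f (p # ps)) w) t"
      by (rule T.tensor_lift_eq(1)[OF P c coaction_closed[OF n(3)] t(1)])
    also have "\<dots> = lin_sum R P (\<lambda>p. lin_sum R P f (?v p)) t"
    proof (rule P.lin_sum_cong[OF t(2), symmetric])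
      show "(\<lambda>p. lin_sum R P (\<lambda>ps. f (p # ps)) w) \<in> carrier M \<times> carrier N \<rightarrow> carrier P"
        using compatible_funcset[OF c] .
      fix p assume p: "p \<in> carrier M \<times> carrier N"
      show "lin_sum R P f (?v p) = lin_sum R P (\<lambda>ps. f (p # ps)) w"
        unfolding F.linear_map_lin_sum_comm[OF P lin w g[OF p]]
        using p by (intro P.lin_sum_cong[OF w cl[OF p]] P.lin_sum_free_gen[OF _ ff])
          (simp add: n pair_lists_Cons)
    qed
    also have "\<dots> = lin_sum R P f (lin_sum R ?F ?v t)"
      by (rule F.linear_map_lin_sum_comm[OF P lin t(2) v, symmetric])
    finally show ?thesis .
  qed
  then show ?case
    using F.lin_sum_closed[OF t(2) v] by blast
qed

lemma sweedler_closed: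
  assumes "module R P" "as \<in> power_gens C n" "multibil P n f"
  shows "sweedler P f as \<in> carrier P"
proof -
  interpret P: module R P by fact
  obtain w where "w \<in> carrier (free_mod R (pairs n))" "sweedler P f as = lin_sum R P f w"
    using sweedler_weights[OF assms(1,2)] assms(3) by blast
  then show ?thesis
    using P.lin_sum_closed multibilinear_closed[OF assms(3)] by auto
qed

lemma sweedler_cong:
  assumes "module R P" "as \<in> power_gens C n" "multibil P n g" "\<And>ps. ps \<in> pairs n \<Longrightarrow> f ps = g ps"
  shows "sweedler P f as = sweedler P g as"
proof -
  interpret P: module R P by fact
  obtain w where w: "w \<in> carrier (free_mod R (pairs n))"
    "\<And>f. multibil P n f \<Longrightarrow> sweedler P f as = lin_sum R P f w"
    using sweedler_weights[OF assms(1,2)] by blast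
  have f: "multibil P n f"
    by (rule multibil_cong[OF assms(1,3)]) (rule assms(4))
  show ?thesis
    unfolding w(2)[OF assms(3)] w(2)[OF f]
    using multibilinear_closed[OF assms(3)] assms(4) by (intro P.lin_sum_cong[OF w(1)]) auto
qed

text \<open>The same weights serve for all \<open>y\<close>, so the Sweedler sum is a
  \<open>lin_sum\<close> with fixed coefficients of functions compatible in \<open>y\<close>. The
  next two lemmas use the same idea for linear and multilinear parameters.\<close>

lemma compatible_sweedler_param:
  assumes "module R P" "presentation R Y D" "as \<in> power_gens C n"
    and "\<And>y. y \<in> Y \<Longrightarrow> multibil P n (f y)"
    and "\<And>ps. ps \<in> pairs n \<Longrightarrow> compatible R P Y D (\<lambda>y. f y ps)"
  shows "compatible R P Y D (\<lambda>y. sweedler P (f y) as)"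
proof -
  interpret Y: presentation R Y D by fact
  obtain w where w: "w \<in> carrier (free_mod R (pairs n))"
    "\<And>f. multibil P n f \<Longrightarrow> sweedler P f as = lin_sum R P f w"
    using sweedler_weights[OF assms(1,3)] by blast
  show ?thesis
    by (rule Y.compatible_cong[OF assms(1) Y.compatible_lin_sum[OF assms(1) w(1) assms(5)]])
      (simp_all add: w(2)[OF assms(4)])
qed

lemma linear_map_sweedler_param:
  assumes "module R P" "module R V" "as \<in> power_gens C n"
    and "\<And>v. v \<in> carrier V \<Longrightarrow> multibil P n (f v)"
    and "\<And>ps. ps \<in> pairs n \<Longrightarrow> linear_map R V P (\<lambda>v. f v ps)"
  shows "linear_map R V P (\<lambda>v. sweedler P (f v) as)"
proof -
  interpret P: module R P by fact
  obtain w where w: "w \<in> carrier (free_mod R (pairs n))"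
    "\<And>f. multibil P n f \<Longrightarrow> sweedler P f as = lin_sum R P f w"
    using sweedler_weights[OF assms(1,3)] by blast
  show ?thesis
    by (rule linear_map_cong[OF assms(2) P.linear_map_lin_sum_param[OF w(1) assms(5)]])
      (simp_all add: w(2)[OF assms(4)])
qed

lemma multilinear_sweedler_param:
  assumes "module R P" "module R V" "as \<in> power_gens C n"
    and "\<And>vs. vs \<in> power_gens V m \<Longrightarrow> multibil P n (f vs)"
    and "\<And>ps. ps \<in> pairs n \<Longrightarrow> multilinear R V P m (\<lambda>vs. f vs ps)"
  shows "multilinear R V P m (\<lambda>vs. sweedler P (f vs) as)"
  unfolding multilinear_def
proof (intro conjI allI impI)
  show "(\<lambda>vs. sweedler P (f vs) as) \<in> power_gens V m \<rightarrow> carrier P"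
    using sweedler_closed[OF assms(1,3,4)] by blast
  fix xs ys assume *: "set xs \<subseteq> carrier V" "set ys \<subseteq> carrier V" "Suc (length xs + length ys) = m"
  show "linear_map R V P (\<lambda>v. sweedler P (f (xs @ v # ys)) as)"
  proof (rule linear_map_sweedler_param[OF assms(1-3)])
    show "multibil P n (f (xs @ v # ys))" if "v \<in> carrier V" for v
      using * that by (intro assms(4)) (auto simp: power_gens_def)
    show "linear_map R V P (\<lambda>v. f (xs @ v # ys) ps)" if "ps \<in> pairs n" for ps
      using multilinear_slot[OF _ *(1,2)] assms(5)[OF that] *(3) by blast
  qed
qed

text \<open>The side condition that gives the outermost \<open>tensor_lift\<close> of a Sweedler sum
  a meaning.\<close>

lemma compatible_sweedler_head:
  assumes "module R P" "as \<in> power_gens C n" "multibil P (Suc n) f"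
  shows "bilin P (\<lambda>p. sweedler P (\<lambda>ps. f (p # ps)) as)"
  by (rule compatible_sweedler_param[OF assms(1) presentation_T assms(2)])
    (simp_all add: multibilinear_Cons[OF assms(3)] multibilinear_head[OF assms(3)])

text \<open>\<open>sweedler_weights\<close> provides weights for one target module at a time; the
  change of target from \<open>P\<close> to \<open>P'\<close> is therefore done by induction on the
  list.\<close>

lemma sweedler_linear:
  assumes "module R P" "module R P'" "linear_map R P P' \<phi>" "as \<in> power_gens C n" "multibil P n f"
  shows "\<phi> (sweedler P f as) = sweedler P' (\<lambda>ps. \<phi> (f ps)) as"
  using assms(4,5)
proof (induction as arbitrary: n f)
  case Nil
  then show ?case by simp
next
  case (Cons a as)
  obtain m where n: "n = Suc m" "as \<in> power_gens C m" "a \<in> carrier C"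
    using Cons.prems by (cases n) (auto simp: power_gens_def)
  note f = Cons.prems(2)[unfolded n]
  note head = compatible_sweedler_head[OF assms(1) n(2) f]
  have "\<phi> (sweedler P f (a # as)) =
      tensor_lift R P' (\<lambda>p. \<phi> (sweedler P (\<lambda>ps. f (p # ps)) as)) (\<beta> a)"
    using T.tensor_lift_linear[OF assms(1,2) head assms(3) coaction_closed[OF n(3)]] by simp
  also have "\<dots> = tensor_lift R P' (\<lambda>p. sweedler P' (\<lambda>ps. \<phi> (f (p # ps))) as) (\<beta> a)"
  proof (rule T.tensor_lift_cong[OF assms(2) _ _ coaction_closed[OF n(3)]])
    show "bilin P' (\<lambda>p. sweedler P' (\<lambda>ps. \<phi> (f (p # ps))) as)"
      using compatible_sweedler_head[OF assms(2) n(2) multibil_comp[OF assms(1,2) f assms(3)]] .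
    show "\<phi> (sweedler P (\<lambda>ps. f (p # ps)) as) = sweedler P' (\<lambda>ps. \<phi> (f (p # ps))) as"
      if "p \<in> carrier M \<times> carrier N" for p
      by (rule Cons.IH[OF n(2) multibilinear_Cons[OF f that]])
  qed
  finally show ?case by simp
qed

text \<open>Linearity in one entry of the list being summed over. Entries before the slot are peeled
  off one by one; each leaves an outer lift over a tensor that does not involve the slot, so the
  slot enters only as a parameter of the summand.\<close>

lemma multilinear_sweedler:
  assumes "module R P" "multibil P n f"
  shows "multilinear R C P n (sweedler P f)"
proof -
  have "linear_map R C P (\<lambda>a. sweedler P f (us @ a # vs))"
    if "set us \<subseteq> carrier C" "set vs \<subseteq> carrier C" "multibil P (Suc (length us + length vs)) f" for us vs f
    using that
  proof (induction us arbitrary: f)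
    case Nil
    then have "vs \<in> power_gens C (length vs)" by (simp add: power_gens_def)
    then show ?case
      using Nil linear_map_lift[OF assms(1) compatible_sweedler_head[OF assms(1)]] by simp
  next
    case (Cons u us)
    let ?n = "Suc (length us + length vs)"
    have f: "multibil P (Suc ?n) f" and u: "u \<in> carrier C" using Cons.prems by simp_all
    have "linear_map R C P (\<lambda>a. tensor_lift R P (\<lambda>p. sweedler P (\<lambda>ps. f (p # ps)) (us @ a # vs)) (\<beta> u))"
    proof (rule T.linear_map_tensor_lift_param[OF assms(1) C.module_axioms coaction_closed[OF u]])
      fix a assume "a \<in> carrier C"
      then have "us @ a # vs \<in> power_gens C ?n"
        using Cons.prems by (simp add: power_gens_def)
      then show "bilin P (\<lambda>p. sweedler P (\<lambda>ps. f (p # ps)) (us @ a # vs))"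
        by (rule compatible_sweedler_head[OF assms(1) _ f])
    next
      fix p assume "p \<in> carrier M \<times> carrier N"
      then show "linear_map R C P (\<lambda>a. sweedler P (\<lambda>ps. f (p # ps)) (us @ a # vs))"
        using Cons.prems multibilinear_Cons[OF f] by (intro Cons.IH) auto
    qed
    then show ?case by simp
  qed
  then show ?thesis
    using assms(2) sweedler_closed[OF assms(1) _ assms(2)] unfolding multilinear_def by auto
qed

text \<open>\<open>U\<close> may belong to any presentation, since it will be a coproduct of an
  H-leg, a coaction on an A-leg, or the coaction on a_0. With weights for \<open>as\<close> and a
  representative of \<open>U\<close> the claim is \<open>lin_sum_swap\<close>.\<close>

lemma sweedler_tensor_lift_swap:
  assumes P: "module R P" and Y: "presentation R Y D" and as: "as \<in> power_gens C n"
    and U: "U \<in> carrier (pres_mod R Y D)"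
    and f1: "\<And>y. y \<in> Y \<Longrightarrow> multibil P n (\<lambda>ps. f ps y)"
    and f2: "\<And>ps. ps \<in> pairs n \<Longrightarrow> compatible R P Y D (f ps)"
  shows "sweedler P (\<lambda>ps. tensor_lift R P (f ps) U) as = tensor_lift R P (\<lambda>y. sweedler P (\<lambda>ps. f ps y) as) U"
    and "multibil P n (\<lambda>ps. tensor_lift R P (f ps) U)"
proof -
  interpret P: module R P by fact
  interpret Y: presentation R Y D by fact
  obtain w where w: "w \<in> carrier (free_mod R (pairs n))"
    "\<And>f. multibil P n f \<Longrightarrow> sweedler P f as = lin_sum R P f w"
    using sweedler_weights[OF P as] by blast
  obtain u where u: "u \<in> U" "u \<in> carrier (free_mod R Y)" using Y.pres_mod_rep[OF U] .
  have cl: "f ps y \<in> carrier P" if "ps \<in> pairs n" "y \<in> Y" for ps y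
    using compatible_closed[OF f2] that by auto
  show mb: "multibil P n (\<lambda>ps. tensor_lift R P (f ps) U)"
    unfolding multibilinear_def
  proof (intro conjI allI impI)
    show "(\<lambda>ps. tensor_lift R P (f ps) U) \<in> pairs n \<rightarrow> carrier P"
      using Y.tensor_lift_closed[OF P f2 U] by blast
    fix ps qs assume *: "set ps \<subseteq> carrier M \<times> carrier N" "set qs \<subseteq> carrier M \<times> carrier N"
      "Suc (length ps + length qs) = n"
    show "bilin P (\<lambda>p. tensor_lift R P (f (ps @ p # qs)) U)"
    proof (rule compatible_tensor_lift_param[OF Y presentation_T P U])
      show "compatible R P Y D (f (ps @ p # qs))" if "p \<in> carrier M \<times> carrier N" for p
        using * that by (intro f2) (auto simp: pair_lists_def)
      show "bilin P (\<lambda>p. f (ps @ p # qs) y)" if "y \<in> Y" for y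
        using f1[OF that] * by (simp add: multibilinear_def)
    qed
  qed
  have cp: "compatible R P Y D (\<lambda>y. sweedler P (\<lambda>ps. f ps y) as)"
    by (rule compatible_sweedler_param[OF P Y as f1 f2])
  have "sweedler P (\<lambda>ps. tensor_lift R P (f ps) U) as = lin_sum R P (\<lambda>ps. lin_sum R P (f ps) u) w"
    unfolding w(2)[OF mb] using cl
    by (intro P.lin_sum_cong[OF w(1)]) (auto simp: Y.tensor_lift_eq(1)[OF P f2 U u(1)]
      intro!: P.lin_sum_closed[OF u(2)])
  also have "\<dots> = lin_sum R P (\<lambda>y. lin_sum R P (\<lambda>ps. f ps y) w) u"
    by (rule P.lin_sum_swap[OF w(1) u(2) cl])
  also have "\<dots> = lin_sum R P (\<lambda>y. sweedler P (\<lambda>ps. f ps y) as) u"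
    using compatible_funcset[OF cp] by (intro P.lin_sum_cong[OF u(2)]) (auto simp: w(2)[OF f1])
  also have "\<dots> = tensor_lift R P (\<lambda>y. sweedler P (\<lambda>ps. f ps y) as) U"
    by (rule Y.tensor_lift_eq(1)[symmetric, OF P cp U u(1)])
  finally show "sweedler P (\<lambda>ps. tensor_lift R P (f ps) U) as =
    tensor_lift R P (\<lambda>y. sweedler P (\<lambda>ps. f ps y) as) U" .
qed

end

section \<open>Tensors, products and linearity\<close>

lemma module_tensor_mod: "module R M \<Longrightarrow> module R N \<Longrightarrow> module R (tensor_mod R M N)"
  unfolding tensor_mod_eq by (rule presentation.module_pres_mod[OF presentation_tensor])

lemma
  assumes "module R M" "module R N"
  shows linear_map_tensor_left: "y \<in> carrier N \<Longrightarrow> linear_map R M (tensor_mod R M N) (\<lambda>x. tensor R M N x y)"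
    and linear_map_tensor_right: "x \<in> carrier M \<Longrightarrow> linear_map R N (tensor_mod R M N) (tensor R M N x)"
  using compatible_tensor_left[OF assms module_tensor_mod[OF assms]]
    compatible_tensor_right[OF assms module_tensor_mod[OF assms]]
    presentation.compatible_gen[OF presentation_tensor[OF assms]]
  by (auto simp: tensor_mod_eq tensor_eq[abs_def])

lemma tensor_closed:
  assumes "module R M" "module R N" "x \<in> carrier M" "y \<in> carrier N"
  shows "tensor R M N x y \<in> carrier (tensor_mod R M N)"
  using linear_map_closed[OF linear_map_tensor_left[OF assms(1,2,4)] assms(3)] .

lemma tensor_lift_tensor:
  assumes "module R M" "module R N" "module R P"
    and "compatible R P (carrier M \<times> carrier N) (tensor_rels R M N) f"
    and "x \<in> carrier M" "y \<in> carrier N"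
  shows "tensor_lift R P f (tensor R M N x y) = f (x, y)"
  unfolding tensor_eq
  using presentation.tensor_lift_gen[OF presentation_tensor[OF assms(1,2)] assms(3,4)] assms(5,6) by simp

lemma module_tensor_power: "module R M \<Longrightarrow> module R (tensor_power R M n)"
  unfolding tensor_power_eq by (rule presentation.module_pres_mod[OF presentation_power])

text \<open>\<open>tensor_list\<close> takes its relations from the length of its argument, so it
  agrees with the generators of the \<open>n\<close>-th power only on lists of length
  \<open>n\<close>; hence the detour through a congruence rule.\<close>

lemma multilinear_tensor_list:
  assumes "module R M"
  shows "multilinear R M (tensor_power R M n) n (tensor_list R M)"
proof -
  interpret T: presentation R "power_gens M n" "power_rels R M n"
    by (rule presentation_power[OF assms])
  show ?thesis
    unfolding tensor_power_eq
    by (intro compatible_powerD[OF assms T.module_pres_mod]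
        T.compatible_cong[OF T.module_pres_mod T.compatible_gen] tensor_list_eq)
      (simp add: power_gens_def)
qed

lemma tensor_lift_tensor_list:
  assumes "module R M" "module R P" "multilinear R M P n f" "xs \<in> power_gens M n"
  shows "tensor_lift R P f (tensor_list R M xs) = f xs"
  using presentation.tensor_lift_gen[OF presentation_power[OF assms(1)] assms(2)
      compatible_powerI[OF assms(1-3)] assms(4)] assms(4) tensor_list_eq[of xs n R M]
  by (simp add: power_gens_def)

lemma linear_map_power_lift:
  assumes "module R M" "module R P" "multilinear R M P n f"
  shows "linear_map R (tensor_power R M n) P (tensor_lift R P f)"
  unfolding tensor_power_eq
  by (rule presentation.linear_map_tensor_lift[OF presentation_power[OF assms(1)] assms(2)
        compatible_powerI[OF assms]])

lemma tensor_power_ext: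
  assumes "module R M" "module R P" "linear_map R (tensor_power R M n) P \<phi>"
    "linear_map R (tensor_power R M n) P \<psi>"
    and "\<And>xs. xs \<in> power_gens M n \<Longrightarrow> \<phi> (tensor_list R M xs) = \<psi> (tensor_list R M xs)"
    and "T \<in> carrier (tensor_power R M n)"
  shows "\<phi> T = \<psi> T"
proof (rule presentation.pres_mod_ext[OF presentation_power[OF assms(1)] assms(2)
      assms(3,4)[unfolded tensor_power_eq] _ assms(6)[unfolded tensor_power_eq]])
  fix xs assume xs: "xs \<in> power_gens M n"
  then show "\<phi> (pres_gen R (power_gens M n) (power_rels R M n) xs) =
      \<psi> (pres_gen R (power_gens M n) (power_rels R M n) xs)"
    using assms(5)[OF xs] tensor_list_eq[of xs n R M] by (simp add: power_gens_def)
qed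

context assoc_algebra
begin

lemma linear_map_mult_left: "a \<in> carrier A \<Longrightarrow> linear_map R A A (\<lambda>x. a \<otimes>\<^bsub>A\<^esub> x)"
  by (rule linear_mapI) (simp_all add: r_distr smult_mult_right)

lemma linear_map_mult_right: "a \<in> carrier A \<Longrightarrow> linear_map R A A (\<lambda>x. x \<otimes>\<^bsub>A\<^esub> a)"
  by (rule linear_mapI) (simp_all add: l_distr smult_mult_left)

lemma list_mult_closed: "set xs \<subseteq> carrier A \<Longrightarrow> list_mult A xs \<in> carrier A"
  by (induction xs) (simp_all add: list_mult_def)

lemma list_mult_append:
  "set xs \<subseteq> carrier A \<Longrightarrow> set ys \<subseteq> carrier A \<Longrightarrow>
    list_mult A (xs @ ys) = list_mult A xs \<otimes>\<^bsub>A\<^esub> list_mult A ys"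
proof (induction xs)
  case Nil
  then show ?case using list_mult_closed[of ys] by (simp add: list_mult_def)
next
  case (Cons x xs)
  then show ?case
    using list_mult_closed[of ys] list_mult_closed[of xs] by (simp add: list_mult_def m_assoc)
qed

lemma list_mult_Cons: "list_mult A (x # xs) = x \<otimes>\<^bsub>A\<^esub> list_mult A xs"
  by (simp add: list_mult_def)

lemma list_mult_Nil: "list_mult A [] = \<one>\<^bsub>A\<^esub>"
  by (simp add: list_mult_def)

lemma multilinear_list_mult: "multilinear R A A n (list_mult A)"
  unfolding multilinear_def
proof (intro conjI allI impI)
  show "list_mult A \<in> power_gens A n \<rightarrow> carrier A"
    using list_mult_closed by (auto simp: power_gens_def)
  fix xs ys assume *: "set xs \<subseteq> carrier A" "set ys \<subseteq> carrier A"
  show "linear_map R A A (\<lambda>x. list_mult A (xs @ x # ys))"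
  proof (rule linear_map_cong[OF module_axioms linear_map_comp[OF
          linear_map_mult_right[OF list_mult_closed[OF *(2)]]
          linear_map_mult_left[OF list_mult_closed[OF *(1)]]]])
    fix x assume "x \<in> carrier A"
    then show "list_mult A (xs @ x # ys) = list_mult A xs \<otimes>\<^bsub>A\<^esub> (x \<otimes>\<^bsub>A\<^esub> list_mult A ys)"
      using * by (simp add: list_mult_append list_mult_Cons)
  qed
qed

end

text \<open>The summand of iterated coassociativity, with one list for each of the three legs.
  Separate lists, not a list of triples, because one side of the law produces the last two legs
  together by a coproduct and the other side the first two by a coaction.\<close>

definition trimultilinear ::
  "('k, 'r) ring_scheme \<Rightarrow> ('k, 'a, 'm) module_scheme \<Rightarrow> ('k, 'b, 'n) module_scheme \<Rightarrow>
    ('k, 'p, 'q) module_scheme \<Rightarrow> nat \<Rightarrow> ('a list \<Rightarrow> 'b list \<Rightarrow> 'b list \<Rightarrow> 'p) \<Rightarrow> bool"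
  where "trimultilinear R M N P n F \<longleftrightarrow>
    (\<forall>ys\<in>power_gens N n. \<forall>zs\<in>power_gens N n. multilinear R M P n (\<lambda>xs. F xs ys zs)) \<and>
    (\<forall>xs\<in>power_gens M n. \<forall>zs\<in>power_gens N n. multilinear R N P n (\<lambda>ys. F xs ys zs)) \<and>
    (\<forall>xs\<in>power_gens M n. \<forall>ys\<in>power_gens N n. multilinear R N P n (\<lambda>zs. F xs ys zs))"

lemma trimultilinear_Cons:
  assumes "trimultilinear R M N P (Suc n) F" "x \<in> carrier M" "y \<in> carrier N" "z \<in> carrier N"
  shows "trimultilinear R M N P n (\<lambda>xs ys zs. F (x # xs) (y # ys) (z # zs))"
  using assms unfolding trimultilinear_def
  by (intro conjI ballI) (auto simp: power_gens_Cons intro!: multilinear_Cons)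

lemma trimultilinear_heads:
  assumes "trimultilinear R M N P (Suc n) F"
    and "xs \<in> power_gens M n" "ys \<in> power_gens N n" "zs \<in> power_gens N n"
  shows "y \<in> carrier N \<Longrightarrow> z \<in> carrier N \<Longrightarrow> linear_map R M P (\<lambda>x. F (x # xs) (y # ys) (z # zs))"
    "x \<in> carrier M \<Longrightarrow> z \<in> carrier N \<Longrightarrow> linear_map R N P (\<lambda>y. F (x # xs) (y # ys) (z # zs))"
    "x \<in> carrier M \<Longrightarrow> y \<in> carrier N \<Longrightarrow> linear_map R N P (\<lambda>z. F (x # xs) (y # ys) (z # zs))"
  using assms unfolding trimultilinear_def
  by (auto simp: power_gens_Cons intro!: multilinear_head)

text \<open>\<open>tensor_alg\<close> overrides only \<open>mult\<close> and \<open>one\<close>, at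
  which \<open>linear_map\<close> does not look.\<close>

lemma linear_map_tensor_alg:
  "linear_map R C (tensor_alg R M N) f \<longleftrightarrow> linear_map R C (tensor_mod R M N) f"
  by (simp add: linear_map_def tensor_alg_def)

section \<open>Comodule algebras\<close>

text \<open>Gives the two algebra structures separate name spaces.\<close>

locale coacting_algebra = H: assoc_algebra R H + A: assoc_algebra R A
  for R :: "('k, 'r) ring_scheme" (structure) and H :: "('k, 'h, 'u) module_scheme" (structure)
    and A :: "('k, 'a, 'v) module_scheme" (structure) +
  fixes \<Delta> :: "'h \<Rightarrow> ('h \<times> 'h \<Rightarrow> 'k) set" and \<epsilon> :: "'h \<Rightarrow> 'k" and S :: "'h \<Rightarrow> 'h"
    and \<beta> :: "'a \<Rightarrow> ('a \<times> 'h \<Rightarrow> 'k) set"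
  assumes comodule_algebra: "comodule_algebra R H \<Delta> \<epsilon> S A \<beta>"
begin

lemmas hopf_algebra = comodule_algebra.axioms(1)[OF comodule_algebra]
lemmas comult_algebra_map = hopf_algebra.comult_algebra_map[OF hopf_algebra]
lemmas counit_algebra_map = hopf_algebra.counit_algebra_map[OF hopf_algebra]
lemmas antipode_linear = hopf_algebra.antipode_linear[OF hopf_algebra]
lemmas coaction_algebra_map = comodule_algebra.coaction_algebra_map[OF comodule_algebra]
lemmas coaction_coassoc = comodule_algebra.coaction_coassoc[OF comodule_algebra]
lemmas coaction_counit = comodule_algebra.coaction_counit[OF comodule_algebra]

lemma linear_coaction_\<Delta>: "linear_coaction R H H H \<Delta>"
  using comult_algebra_map
  by (intro linear_coaction.intro linear_coaction_axioms.intro H.module_axioms)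
    (simp add: algebra_map_def linear_map_tensor_alg)

lemma linear_coaction_\<beta>: "linear_coaction R A A H \<beta>"
  using coaction_algebra_map
  by (intro linear_coaction.intro linear_coaction_axioms.intro H.module_axioms A.module_axioms)
    (simp add: algebra_map_def linear_map_tensor_alg)

interpretation \<Delta>: linear_coaction R H H H \<Delta> by (rule linear_coaction_\<Delta>)
interpretation \<beta>: linear_coaction R A A H \<beta> by (rule linear_coaction_\<beta>)

interpretation HH: presentation R "carrier H \<times> carrier H" "tensor_rels R H H"
  by (rule presentation_tensor[OF H.module_axioms H.module_axioms])
interpretation AH: presentation R "carrier A \<times> carrier H" "tensor_rels R A H"
  by (rule presentation_tensor[OF A.module_axioms H.module_axioms])

text \<open>Universal form of coassociativity: a trilinear \<open>K\<close> factors through a linear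
  map \<Phi> on A \<otimes> (H \<otimes> H), the module in which the axiom is stated, and \<Phi> is
  applied to both sides of it.\<close>

lemma coassoc_lift:
  assumes P: "module R P" and a: "a \<in> carrier A"
    and K1: "\<And>y z. y \<in> carrier H \<Longrightarrow> z \<in> carrier H \<Longrightarrow> linear_map R A P (\<lambda>x. K x y z)"
    and K2: "\<And>x z. x \<in> carrier A \<Longrightarrow> z \<in> carrier H \<Longrightarrow> linear_map R H P (\<lambda>y. K x y z)"
    and K3: "\<And>x y. x \<in> carrier A \<Longrightarrow> y \<in> carrier H \<Longrightarrow> linear_map R H P (\<lambda>z. K x y z)"
  shows "tensor_lift R P (\<lambda>p. tensor_lift R P (\<lambda>q. K (fst p) (fst q) (snd q)) (\<Delta> (snd p))) (\<beta> a) =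
    tensor_lift R P (\<lambda>p. tensor_lift R P (\<lambda>r. K (fst r) (snd r) (snd p)) (\<beta> (fst p))) (\<beta> a)"
    (is "?l = ?r")
proof -
  let ?HH = "tensor_mod R H H"
  let ?Q = "tensor_mod R A ?HH"
  have mHH: "module R ?HH" by (rule module_tensor_mod[OF H.module_axioms H.module_axioms])
  have Q: "module R ?Q" by (rule module_tensor_mod[OF A.module_axioms mHH])
  define G where "G x q = K x (fst q) (snd q)" for x q
  have G: "\<Delta>.bilin P (G x)" if "x \<in> carrier A" for x
    unfolding G_def using that
    by (intro compatible_tensorI[OF H.module_axioms H.module_axioms P]) (simp_all add: K2 K3)
  \<comment> \<open>The lift over H \<otimes> H is taken first, with the A-argument fixed. The
    result is bilinear in that argument and the tensor, and lifting it once more gives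
    \<Phi>.\<close>
  define f where "f p = tensor_lift R P (G (fst p)) (snd p)" for p
  have f: "compatible R P (carrier A \<times> carrier ?HH) (tensor_rels R A ?HH) f"
  proof (rule compatible_tensorI[OF A.module_axioms mHH P])
    fix T assume T: "T \<in> carrier ?HH"
    show "linear_map R A P (\<lambda>x. f (x, T))"
      unfolding f_def fst_conv snd_conv using T G K1
      by (intro HH.linear_map_tensor_lift_param[OF P A.module_axioms])
        (auto simp: tensor_mod_eq[symmetric] G_def)
  next
    fix x assume "x \<in> carrier A"
    then show "linear_map R ?HH P (\<lambda>T. f (x, T))"
      unfolding f_def using HH.linear_map_tensor_lift[OF P G] by (simp add: tensor_mod_eq)
  qed
  define \<Phi> where "\<Phi> = tensor_lift R P f"
  have \<Phi>: "linear_map R ?Q P \<Phi>"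
    unfolding \<Phi>_def tensor_mod_eq[of R A]
    by (rule presentation.linear_map_tensor_lift[OF presentation_tensor[OF A.module_axioms mHH] P f])
  have \<Phi>_tensor: "\<Phi> (tensor R A ?HH x T) = tensor_lift R P (G x) T"
    if "x \<in> carrier A" "T \<in> carrier ?HH" for x T
    unfolding \<Phi>_def using tensor_lift_tensor[OF A.module_axioms mHH P f that] by (simp add: f_def)
  have \<Delta>_closed: "\<Delta> h \<in> carrier ?HH" if "h \<in> carrier H" for h
    using \<Delta>.coaction_closed[OF that] by (simp add: tensor_mod_eq)
  have r: "\<beta>.bilin ?Q (\<lambda>(x, y). tensor R A ?HH x (\<Delta> y))"
    using linear_map_comp[OF \<Delta>.coaction_linear linear_map_tensor_right[OF A.module_axioms mHH]]
      linear_map_tensor_left[OF A.module_axioms mHH] \<Delta>_closed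
    by (intro compatible_tensorI[OF A.module_axioms H.module_axioms Q]) auto
  have l1: "\<beta>.bilin ?Q (\<lambda>(x', x''). tensor R A ?HH x' (tensor R H H x'' y))" if "y \<in> carrier H" for y
    using that linear_map_tensor_left[OF A.module_axioms mHH]
      linear_map_comp[OF linear_map_tensor_left[OF H.module_axioms H.module_axioms]
        linear_map_tensor_right[OF A.module_axioms mHH]]
    by (intro compatible_tensorI[OF A.module_axioms H.module_axioms Q])
      (auto simp: tensor_closed[OF H.module_axioms H.module_axioms])
  \<comment> \<open>One side of the axiom is a lift whose summand is again a lift; \<Phi> can be
    moved inside only after that summand is known to be bilinear.\<close>
  have l: "\<beta>.bilin ?Q (\<lambda>(x, y). tensor_lift R ?Q
      (\<lambda>(x', x''). tensor R A ?HH x' (tensor R H H x'' y)) (\<beta> x))"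
  proof (rule compatible_tensorI[OF A.module_axioms H.module_axioms Q]; unfold case_prod_conv)
    fix y assume "y \<in> carrier H"
    then show "linear_map R A ?Q (\<lambda>x. tensor_lift R ?Q
        (\<lambda>(x', x''). tensor R A ?HH x' (tensor R H H x'' y)) (\<beta> x))"
      by (intro \<beta>.linear_map_lift[OF Q] l1)
  next
    fix x assume "x \<in> carrier A"
    then show "linear_map R H ?Q (\<lambda>y. tensor_lift R ?Q
        (\<lambda>(x', x''). tensor R A ?HH x' (tensor R H H x'' y)) (\<beta> x))"
      using l1 linear_map_comp[OF linear_map_tensor_right[OF H.module_axioms H.module_axioms]
        linear_map_tensor_right[OF A.module_axioms mHH]]
      by (intro AH.linear_map_tensor_lift_param[OF Q H.module_axioms \<beta>.coaction_closed]) auto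
  qed
  have "?l = \<Phi> (tensor_lift R ?Q (\<lambda>(x, y). tensor R A ?HH x (\<Delta> y)) (\<beta> a))"
    unfolding AH.tensor_lift_linear[OF Q P r \<Phi> \<beta>.coaction_closed[OF a]]
  proof (rule AH.tensor_lift_cong[OF P AH.compatible_comp[OF Q P r \<Phi>] _ \<beta>.coaction_closed[OF a]])
    fix p assume "p \<in> carrier A \<times> carrier H"
    then show "tensor_lift R P (\<lambda>q. K (fst p) (fst q) (snd q)) (\<Delta> (snd p)) =
        \<Phi> (case p of (x, y) \<Rightarrow> tensor R A ?HH x (\<Delta> y))"
      using \<Phi>_tensor \<Delta>_closed by (auto simp: G_def[abs_def])
  qed
  also have "\<dots> = \<Phi> (tensor_lift R ?Q (\<lambda>(x, y). tensor_lift R ?Q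
      (\<lambda>(x', x''). tensor R A ?HH x' (tensor R H H x'' y)) (\<beta> x)) (\<beta> a))"
    by (simp only: coaction_coassoc[OF a])
  also have "\<dots> = ?r"
    unfolding AH.tensor_lift_linear[OF Q P l \<Phi> \<beta>.coaction_closed[OF a]]
  proof (rule AH.tensor_lift_cong[OF P AH.compatible_comp[OF Q P l \<Phi>] _ \<beta>.coaction_closed[OF a], symmetric])
    fix p assume "p \<in> carrier A \<times> carrier H"
    then obtain x y where p: "p = (x, y)" "x \<in> carrier A" "y \<in> carrier H" by auto
    have "\<Phi> (tensor_lift R ?Q (\<lambda>(x', x''). tensor R A ?HH x' (tensor R H H x'' y)) (\<beta> x)) =
        tensor_lift R P (\<lambda>r. \<Phi> (case r of (x', x'') \<Rightarrow> tensor R A ?HH x' (tensor R H H x'' y))) (\<beta> x)"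
      by (rule AH.tensor_lift_linear[OF Q P l1[OF p(3)] \<Phi> \<beta>.coaction_closed[OF p(2)]])
    also have "\<dots> = tensor_lift R P (\<lambda>r. K (fst r) (snd r) y) (\<beta> x)"
    proof (rule AH.tensor_lift_cong[OF P _ _ \<beta>.coaction_closed[OF p(2)]])
      show "\<beta>.bilin P (\<lambda>r. K (fst r) (snd r) y)"
        using p by (intro compatible_tensorI[OF A.module_axioms H.module_axioms P]) (simp_all add: K1 K2)
      fix r assume "r \<in> carrier A \<times> carrier H"
      then show "\<Phi> (case r of (x', x'') \<Rightarrow> tensor R A ?HH x' (tensor R H H x'' y)) = K (fst r) (snd r) y"
        using p \<Phi>_tensor tensor_closed[OF H.module_axioms H.module_axioms]
          tensor_lift_tensor[OF H.module_axioms H.module_axioms P G]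
        by (auto simp: G_def)
    qed
    finally show "tensor_lift R P (\<lambda>r. K (fst r) (snd r) (snd p)) (\<beta> (fst p)) =
        \<Phi> (case p of (x, y) \<Rightarrow> tensor_lift R ?Q
          (\<lambda>(x', x''). tensor R A ?HH x' (tensor R H H x'' y)) (\<beta> x))"
      by (simp add: p)
  qed
  finally show ?thesis .
qed

lemma
  assumes P: "module R P" and K: "\<beta>.bilin P K"
  shows bilin_mult_left: "p \<in> carrier A \<times> carrier H \<Longrightarrow>
      \<beta>.bilin P (\<lambda>q. K (fst p \<otimes>\<^bsub>A\<^esub> fst q, snd p \<otimes>\<^bsub>H\<^esub> snd q))"
    and bilin_mult_right: "q \<in> carrier A \<times> carrier H \<Longrightarrow>
      \<beta>.bilin P (\<lambda>p. K (fst p \<otimes>\<^bsub>A\<^esub> fst q, snd p \<otimes>\<^bsub>H\<^esub> snd q))"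
proof -
  note Kl = compatible_tensor_left[OF A.module_axioms H.module_axioms P K]
    and Kr = compatible_tensor_right[OF A.module_axioms H.module_axioms P K]
  show "\<beta>.bilin P (\<lambda>q. K (fst p \<otimes>\<^bsub>A\<^esub> fst q, snd p \<otimes>\<^bsub>H\<^esub> snd q))" if "p \<in> carrier A \<times> carrier H"
    using that linear_map_comp[OF A.linear_map_mult_left Kl] linear_map_comp[OF H.linear_map_mult_left Kr]
    by (intro compatible_tensorI[OF A.module_axioms H.module_axioms P]) auto
  show "\<beta>.bilin P (\<lambda>p. K (fst p \<otimes>\<^bsub>A\<^esub> fst q, snd p \<otimes>\<^bsub>H\<^esub> snd q))" if "q \<in> carrier A \<times> carrier H"
    using that linear_map_comp[OF A.linear_map_mult_right Kl] linear_map_comp[OF H.linear_map_mult_right Kr]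
    by (intro compatible_tensorI[OF A.module_axioms H.module_axioms P]) auto
qed

lemma bilin_mult_lift:
  assumes P: "module R P" and K: "\<beta>.bilin P K" and b: "b \<in> carrier A"
  shows "\<beta>.bilin P (\<lambda>p. tensor_lift R P (\<lambda>q. K (fst p \<otimes>\<^bsub>A\<^esub> fst q, snd p \<otimes>\<^bsub>H\<^esub> snd q)) (\<beta> b))"
  by (rule compatible_tensor_lift_param[OF \<beta>.presentation_T \<beta>.presentation_T P \<beta>.coaction_closed[OF b]
        bilin_mult_left[OF P K] bilin_mult_right[OF P K]])

text \<open>The product of A \<otimes> H is a double lift with values in A \<otimes> H. The lift of
  \<open>K\<close> is linear on that module, so it moves inside both sums and there meets a pure
  tensor.\<close>

lemma coaction_mult_lift:
  assumes P: "module R P" and K: "\<beta>.bilin P K" and a: "a \<in> carrier A" and b: "b \<in> carrier A"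
  shows "tensor_lift R P K (\<beta> (a \<otimes>\<^bsub>A\<^esub> b)) =
    tensor_lift R P (\<lambda>p. tensor_lift R P (\<lambda>q. K (fst p \<otimes>\<^bsub>A\<^esub> fst q, snd p \<otimes>\<^bsub>H\<^esub> snd q)) (\<beta> b)) (\<beta> a)"
proof -
  let ?T = "tensor_mod R A H"
  let ?t = "\<lambda>p. tensor R A H (fst p) (snd p)"
  have T: "module R ?T" by (rule module_tensor_mod[OF A.module_axioms H.module_axioms])
  have t: "\<beta>.bilin ?T ?t"
    using linear_map_tensor_left[OF A.module_axioms H.module_axioms]
      linear_map_tensor_right[OF A.module_axioms H.module_axioms]
    by (intro compatible_tensorI[OF A.module_axioms H.module_axioms T]) auto
  have lin: "linear_map R ?T P (tensor_lift R P K)"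
    unfolding tensor_mod_eq by (rule AH.linear_map_tensor_lift[OF P K])
  note ml = bilin_mult_left[OF T t, simplified] and mlift = bilin_mult_lift[OF T t b, simplified]
  have "\<beta> (a \<otimes>\<^bsub>A\<^esub> b) = tensor_mult R A H (\<beta> a) (\<beta> b)"
    using coaction_algebra_map a b by (simp add: algebra_map_def ring_hom_def tensor_alg_def)
  also have "\<dots> = tensor_lift R ?T (\<lambda>p. tensor_lift R ?T
      (\<lambda>q. tensor R A H (fst p \<otimes>\<^bsub>A\<^esub> fst q) (snd p \<otimes>\<^bsub>H\<^esub> snd q)) (\<beta> b)) (\<beta> a)"
    by (simp add: tensor_mult_def case_prod_beta')
  finally have "tensor_lift R P K (\<beta> (a \<otimes>\<^bsub>A\<^esub> b)) = tensor_lift R P (\<lambda>p. tensor_lift R P K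
      (tensor_lift R ?T (\<lambda>q. tensor R A H (fst p \<otimes>\<^bsub>A\<^esub> fst q) (snd p \<otimes>\<^bsub>H\<^esub> snd q)) (\<beta> b))) (\<beta> a)"
    using AH.tensor_lift_linear[OF T P mlift lin \<beta>.coaction_closed[OF a]] by simp
  also have "\<dots> = tensor_lift R P (\<lambda>p. tensor_lift R P
      (\<lambda>q. K (fst p \<otimes>\<^bsub>A\<^esub> fst q, snd p \<otimes>\<^bsub>H\<^esub> snd q)) (\<beta> b)) (\<beta> a)"
  proof (rule AH.tensor_lift_cong[OF P bilin_mult_lift[OF P K b] _ \<beta>.coaction_closed[OF a]])
    fix p assume p: "p \<in> carrier A \<times> carrier H"
    have "tensor_lift R P K (tensor_lift R ?T
          (\<lambda>q. tensor R A H (fst p \<otimes>\<^bsub>A\<^esub> fst q) (snd p \<otimes>\<^bsub>H\<^esub> snd q)) (\<beta> b)) =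
        tensor_lift R P (\<lambda>q. tensor_lift R P K
          (tensor R A H (fst p \<otimes>\<^bsub>A\<^esub> fst q) (snd p \<otimes>\<^bsub>H\<^esub> snd q))) (\<beta> b)"
      using p by (intro AH.tensor_lift_linear[OF T P _ lin \<beta>.coaction_closed[OF b]] ml) auto
    also have "\<dots> = tensor_lift R P (\<lambda>q. K (fst p \<otimes>\<^bsub>A\<^esub> fst q, snd p \<otimes>\<^bsub>H\<^esub> snd q)) (\<beta> b)"
      using p by (intro AH.tensor_lift_cong[OF P bilin_mult_left[OF P K p] _ \<beta>.coaction_closed[OF b]]
          tensor_lift_tensor[OF A.module_axioms H.module_axioms P K]) auto
    finally show "tensor_lift R P K (tensor_lift R ?T
          (\<lambda>q. tensor R A H (fst p \<otimes>\<^bsub>A\<^esub> fst q) (snd p \<otimes>\<^bsub>H\<^esub> snd q)) (\<beta> b)) =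
        tensor_lift R P (\<lambda>q. K (fst p \<otimes>\<^bsub>A\<^esub> fst q, snd p \<otimes>\<^bsub>H\<^esub> snd q)) (\<beta> b)" .
  qed
  finally show ?thesis .
qed

lemma coaction_one_lift:
  assumes P: "module R P" and K: "\<beta>.bilin P K"
  shows "tensor_lift R P K (\<beta> \<one>\<^bsub>A\<^esub>) = K (\<one>\<^bsub>A\<^esub>, \<one>\<^bsub>H\<^esub>)"
proof -
  have "\<beta> \<one>\<^bsub>A\<^esub> = tensor R A H \<one>\<^bsub>A\<^esub> \<one>\<^bsub>H\<^esub>"
    using coaction_algebra_map by (simp add: algebra_map_def ring_hom_def tensor_alg_def)
  then show ?thesis
    using tensor_lift_tensor[OF A.module_axioms H.module_axioms P K A.one_closed H.one_closed] by simp
qed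

text \<open>Iterates \<open>coaction_mult_lift\<close>, with \<open>coaction_one_lift\<close> for
  the empty product. \<open>K\<close> has to vary in the induction, because peeling off an entry
  multiplies its two legs into the arguments of \<open>K\<close>.\<close>

lemma sweedler_list_mult:
  assumes P: "module R P" and "\<beta>.bilin P K" and "as \<in> power_gens A n"
  shows "\<beta>.sweedler P (\<lambda>ps. K (list_mult A (map fst ps), list_mult H (map snd ps))) as =
    tensor_lift R P K (\<beta> (list_mult A as))"
  using assms(2,3)
proof (induction as arbitrary: n K)
  case Nil
  then show ?case using coaction_one_lift[OF P] by (simp add: list_mult_def)
next
  case (Cons a as)
  obtain m where n: "n = Suc m" "as \<in> power_gens A m" "a \<in> carrier A"
    using Cons.prems by (cases n) (auto simp: power_gens_def)
  have m: "list_mult A as \<in> carrier A" using n(2) A.list_mult_closed by (simp add: power_gens_def)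
  have "tensor_lift R P (\<lambda>p. \<beta>.sweedler P (\<lambda>ps. K (fst p \<otimes>\<^bsub>A\<^esub> list_mult A (map fst ps),
        snd p \<otimes>\<^bsub>H\<^esub> list_mult H (map snd ps))) as) (\<beta> a) =
      tensor_lift R P (\<lambda>p. tensor_lift R P (\<lambda>q. K (fst p \<otimes>\<^bsub>A\<^esub> fst q, snd p \<otimes>\<^bsub>H\<^esub> snd q))
        (\<beta> (list_mult A as))) (\<beta> a)"
    using Cons.IH[OF bilin_mult_left[OF P Cons.prems(1)] n(2)]
    by (intro AH.tensor_lift_cong[OF P bilin_mult_lift[OF P Cons.prems(1) m] _
          \<beta>.coaction_closed[OF n(3)]]) simp
  then show ?case
    using coaction_mult_lift[OF P Cons.prems(1) n(3) m] by (simp add: A.list_mult_Cons H.list_mult_Cons)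
qed

lemma
  assumes P: "module R P" and F: "trimultilinear R A H P n F"
  shows multibil_comult_inner: "xs \<in> power_gens A n \<Longrightarrow>
      \<Delta>.multibil P n (\<lambda>qs. F xs (map fst qs) (map snd qs))"
    and multibil_coaction_inner: "zs \<in> power_gens H n \<Longrightarrow>
      \<beta>.multibil P n (\<lambda>rs. F (map fst rs) (map snd rs) zs)"
  using F unfolding trimultilinear_def
  by (auto intro!: multibilinearI[OF H.module_axioms H.module_axioms P, of n "F xs"]
      multibilinearI[OF A.module_axioms H.module_axioms P, of n "\<lambda>xs ys. F xs ys zs"])

text \<open>The summands on both sides of \<open>sweedler_coassoc\<close> are Sweedler sums
  themselves. In each, one component of the outer pairs is the list being summed over and the other
  is a parameter, which gives linearity in both.\<close>

lemma
  assumes P: "module R P" and F: "trimultilinear R A H P n F"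
  shows multibil_comult_comp: "\<beta>.multibil P n (\<lambda>ps.
      \<Delta>.sweedler P (\<lambda>qs. F (map fst ps) (map fst qs) (map snd qs)) (map snd ps))"
    and multibil_coaction_comp: "\<beta>.multibil P n (\<lambda>ps.
      \<beta>.sweedler P (\<lambda>rs. F (map fst rs) (map snd rs) (map snd ps)) (map fst ps))"
proof -
  have F1: "multilinear R A P n (\<lambda>xs. F xs ys zs)" if "ys \<in> power_gens H n" "zs \<in> power_gens H n" for ys zs
    using F that by (simp add: trimultilinear_def)
  have F3: "multilinear R H P n (\<lambda>zs. F xs ys zs)" if "xs \<in> power_gens A n" "ys \<in> power_gens H n" for xs ys
    using F that by (simp add: trimultilinear_def)
  note in1 = multibil_comult_inner[OF P F] and in2 = multibil_coaction_inner[OF P F]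
  show "\<beta>.multibil P n (\<lambda>ps.
      \<Delta>.sweedler P (\<lambda>qs. F (map fst ps) (map fst qs) (map snd qs)) (map snd ps))"
  proof (rule multibilinearI[OF A.module_axioms H.module_axioms P,
        of n "\<lambda>xs ys. \<Delta>.sweedler P (\<lambda>qs. F xs (map fst qs) (map snd qs)) ys"])
    show "multilinear R A P n (\<lambda>xs. \<Delta>.sweedler P (\<lambda>qs. F xs (map fst qs) (map snd qs)) ys)"
      if "ys \<in> power_gens H n" for ys
      by (rule \<Delta>.multilinear_sweedler_param[OF P A.module_axioms that])
        (simp_all add: F1 in1 pair_lists_map)
  qed (rule \<Delta>.multilinear_sweedler[OF P in1])
  show "\<beta>.multibil P n (\<lambda>ps.
      \<beta>.sweedler P (\<lambda>rs. F (map fst rs) (map snd rs) (map snd ps)) (map fst ps))"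
  proof (rule multibilinearI[OF A.module_axioms H.module_axioms P,
        of n "\<lambda>xs ys. \<beta>.sweedler P (\<lambda>rs. F (map fst rs) (map snd rs) ys) xs"])
    show "multilinear R H P n (\<lambda>ys. \<beta>.sweedler P (\<lambda>rs. F (map fst rs) (map snd rs) ys) xs)"
      if "xs \<in> power_gens A n" for xs
      by (rule \<beta>.multilinear_sweedler_param[OF P H.module_axioms that])
        (simp_all add: F3 in2 pair_lists_map)
  qed (rule \<beta>.multilinear_sweedler[OF P in2])
qed

text \<open>Induction on the list: \<open>coassoc_lift\<close> treats the first entry, with the sum
  over the tail as its trilinear function. The inner sum belonging to the first entry stands inside
  the outer sum over the tail, so the two are exchanged beforehand.\<close>

lemma sweedler_coassoc:
  assumes P: "module R P" and "trimultilinear R A H P n F" and "as \<in> power_gens A n"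
  shows "\<beta>.sweedler P (\<lambda>ps.
      \<Delta>.sweedler P (\<lambda>qs. F (map fst ps) (map fst qs) (map snd qs)) (map snd ps)) as =
    \<beta>.sweedler P (\<lambda>ps.
      \<beta>.sweedler P (\<lambda>rs. F (map fst rs) (map snd rs) (map snd ps)) (map fst ps)) as"
  using assms(2,3)
proof (induction as arbitrary: n F)
  case Nil
  then show ?case by simp
next
  case (Cons a as)
  obtain m where n: "n = Suc m" "as \<in> power_gens A m" "a \<in> carrier A"
    using Cons.prems by (cases n) (auto simp: power_gens_def)
  note F = Cons.prems(1)[unfolded n]
  define F' where "F' x y z = (\<lambda>xs ys zs. F (x # xs) (y # ys) (z # zs))" for x y z
  have F': "trimultilinear R A H P m (F' x y z)"
    if "x \<in> carrier A" "y \<in> carrier H" "z \<in> carrier H" for x y z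
    unfolding F'_def by (rule trimultilinear_Cons[OF F that])
  \<comment> \<open>The tail is taken in the form with iterated coactions, so only the side with
    \<Delta> appeals to the induction hypothesis.\<close>
  define K where "K x y z = \<beta>.sweedler P (\<lambda>ps.
      \<beta>.sweedler P (\<lambda>rs. F' x y z (map fst rs) (map snd rs) (map snd ps)) (map fst ps)) as" for x y z
  have inner: "\<beta>.multibil P m (\<lambda>rs. F' x y z (map fst rs) (map snd rs) (map snd ps))"
    if "x \<in> carrier A" "y \<in> carrier H" "z \<in> carrier H" "ps \<in> \<beta>.pairs m" for x y z ps
    using that F' by (intro multibil_coaction_inner[OF P]) (auto simp: pair_lists_map)
  have outer: "\<beta>.multibil P m (\<lambda>ps.
      \<beta>.sweedler P (\<lambda>rs. F' x y z (map fst rs) (map snd rs) (map snd ps)) (map fst ps))"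
    if "x \<in> carrier A" "y \<in> carrier H" "z \<in> carrier H" for x y z
    by (rule multibil_coaction_comp[OF P F'[OF that]])
  have K1: "linear_map R A P (\<lambda>x. K x y z)" if "y \<in> carrier H" "z \<in> carrier H" for y z
    unfolding K_def
  proof (rule \<beta>.linear_map_sweedler_param[OF P A.module_axioms n(2)])
    show "\<beta>.multibil P m (\<lambda>ps. \<beta>.sweedler P (\<lambda>rs. F' x y z (map fst rs) (map snd rs) (map snd ps)) (map fst ps))"
      if "x \<in> carrier A" for x
      using that \<open>y \<in> carrier H\<close> \<open>z \<in> carrier H\<close> by (intro outer)
    show "linear_map R A P (\<lambda>x. \<beta>.sweedler P (\<lambda>rs. F' x y z (map fst rs) (map snd rs) (map snd ps)) (map fst ps))"
      if ps: "ps \<in> \<beta>.pairs m" for ps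
    proof (rule \<beta>.linear_map_sweedler_param[OF P A.module_axioms pair_lists_map(1)[OF ps]])
      show "\<beta>.multibil P m (\<lambda>rs. F' x y z (map fst rs) (map snd rs) (map snd ps))"
        if "x \<in> carrier A" for x
        using that \<open>y \<in> carrier H\<close> \<open>z \<in> carrier H\<close> ps by (intro inner)
      show "linear_map R A P (\<lambda>x. F' x y z (map fst rs) (map snd rs) (map snd ps))"
        if "rs \<in> \<beta>.pairs m" for rs
        unfolding F'_def using that ps \<open>y \<in> carrier H\<close> \<open>z \<in> carrier H\<close>
        by (intro trimultilinear_heads(1)[OF F]) (simp_all add: pair_lists_map)
    qed
  qed
  have K2: "linear_map R H P (\<lambda>y. K x y z)" if "x \<in> carrier A" "z \<in> carrier H" for x z
    unfolding K_def
  proof (rule \<beta>.linear_map_sweedler_param[OF P H.module_axioms n(2)])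
    show "\<beta>.multibil P m (\<lambda>ps. \<beta>.sweedler P (\<lambda>rs. F' x y z (map fst rs) (map snd rs) (map snd ps)) (map fst ps))"
      if "y \<in> carrier H" for y
      using that \<open>x \<in> carrier A\<close> \<open>z \<in> carrier H\<close> by (intro outer)
    show "linear_map R H P (\<lambda>y. \<beta>.sweedler P (\<lambda>rs. F' x y z (map fst rs) (map snd rs) (map snd ps)) (map fst ps))"
      if ps: "ps \<in> \<beta>.pairs m" for ps
    proof (rule \<beta>.linear_map_sweedler_param[OF P H.module_axioms pair_lists_map(1)[OF ps]])
      show "\<beta>.multibil P m (\<lambda>rs. F' x y z (map fst rs) (map snd rs) (map snd ps))"
        if "y \<in> carrier H" for y
        using that \<open>x \<in> carrier A\<close> \<open>z \<in> carrier H\<close> ps by (intro inner)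
      show "linear_map R H P (\<lambda>y. F' x y z (map fst rs) (map snd rs) (map snd ps))"
        if "rs \<in> \<beta>.pairs m" for rs
        unfolding F'_def using that ps \<open>x \<in> carrier A\<close> \<open>z \<in> carrier H\<close>
        by (intro trimultilinear_heads(2)[OF F]) (simp_all add: pair_lists_map)
    qed
  qed
  have K3: "linear_map R H P (\<lambda>z. K x y z)" if "x \<in> carrier A" "y \<in> carrier H" for x y
    unfolding K_def
  proof (rule \<beta>.linear_map_sweedler_param[OF P H.module_axioms n(2)])
    show "\<beta>.multibil P m (\<lambda>ps. \<beta>.sweedler P (\<lambda>rs. F' x y z (map fst rs) (map snd rs) (map snd ps)) (map fst ps))"
      if "z \<in> carrier H" for z
      using that \<open>x \<in> carrier A\<close> \<open>y \<in> carrier H\<close> by (intro outer)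
    show "linear_map R H P (\<lambda>z. \<beta>.sweedler P (\<lambda>rs. F' x y z (map fst rs) (map snd rs) (map snd ps)) (map fst ps))"
      if ps: "ps \<in> \<beta>.pairs m" for ps
    proof (rule \<beta>.linear_map_sweedler_param[OF P H.module_axioms pair_lists_map(1)[OF ps]])
      show "\<beta>.multibil P m (\<lambda>rs. F' x y z (map fst rs) (map snd rs) (map snd ps))"
        if "z \<in> carrier H" for z
        using that \<open>x \<in> carrier A\<close> \<open>y \<in> carrier H\<close> ps by (intro inner)
      show "linear_map R H P (\<lambda>z. F' x y z (map fst rs) (map snd rs) (map snd ps))"
        if "rs \<in> \<beta>.pairs m" for rs
        unfolding F'_def using that ps \<open>x \<in> carrier A\<close> \<open>y \<in> carrier H\<close>
        by (intro trimultilinear_heads(3)[OF F]) (simp_all add: pair_lists_map)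
    qed
  qed
  let ?L = "\<lambda>p. \<beta>.sweedler P (\<lambda>ps. \<Delta>.sweedler P
      (\<lambda>qs. F (map fst (p # ps)) (map fst qs) (map snd qs)) (map snd (p # ps))) as"
  let ?R = "\<lambda>p. \<beta>.sweedler P (\<lambda>ps. \<beta>.sweedler P
      (\<lambda>rs. F (map fst rs) (map snd rs) (map snd (p # ps))) (map fst (p # ps))) as"
  have Lc: "\<beta>.bilin P ?L"
    by (rule \<beta>.compatible_sweedler_head[OF P n(2) multibil_comult_comp[OF P F]])
  have Rc: "\<beta>.bilin P ?R"
    by (rule \<beta>.compatible_sweedler_head[OF P n(2) multibil_coaction_comp[OF P F]])
  have L: "?L p = tensor_lift R P (\<lambda>q. K (fst p) (fst q) (snd q)) (\<Delta> (snd p))"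
    if p: "p \<in> carrier A \<times> carrier H" for p
  proof -
    have p': "fst p \<in> carrier A" "snd p \<in> carrier H" using p by auto
    let ?g = "\<lambda>ps q. \<Delta>.sweedler P (\<lambda>qs. F' (fst p) (fst q) (snd q) (map fst ps) (map fst qs) (map snd qs))
      (map snd ps)"
    have "?L p = \<beta>.sweedler P (\<lambda>ps. tensor_lift R P (?g ps) (\<Delta> (snd p))) as"
      by (simp add: F'_def)
    also have "\<dots> = tensor_lift R P (\<lambda>q. \<beta>.sweedler P (\<lambda>ps. ?g ps q) as) (\<Delta> (snd p))"
    proof (rule \<beta>.sweedler_tensor_lift_swap(1)[OF P \<Delta>.presentation_T n(2) \<Delta>.coaction_closed[OF p'(2)]])
      show "\<beta>.multibil P m (\<lambda>ps. ?g ps q)" if "q \<in> carrier H \<times> carrier H" for q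
        using that p' by (intro multibil_comult_comp[OF P F']) auto
      show "\<Delta>.bilin P (?g ps)" if ps: "ps \<in> \<beta>.pairs m" for ps
      proof -
        have "\<Delta>.multibil P (Suc m) (\<lambda>qs. F (fst p # map fst ps) (map fst qs) (map snd qs))"
          using ps p' by (intro multibil_comult_inner[OF P F]) (simp add: power_gens_Cons pair_lists_map)
        from \<Delta>.compatible_sweedler_head[OF P pair_lists_map(2)[OF ps] this] show ?thesis
          by (simp add: F'_def)
      qed
    qed
    also have "\<dots> = tensor_lift R P (\<lambda>q. K (fst p) (fst q) (snd q)) (\<Delta> (snd p))"
    proof (rule HH.tensor_lift_cong[OF P _ _ \<Delta>.coaction_closed[OF p'(2)]])
      show "\<Delta>.bilin P (\<lambda>q. K (fst p) (fst q) (snd q))"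
        using K2 K3 p' by (intro compatible_tensorI[OF H.module_axioms H.module_axioms P]) simp_all
      show "\<beta>.sweedler P (\<lambda>ps. ?g ps q) as = K (fst p) (fst q) (snd q)"
        if "q \<in> carrier H \<times> carrier H" for q
        unfolding K_def using that p' by (intro Cons.IH[OF F' n(2)]) auto
    qed
    finally show ?thesis .
  qed
  have R: "?R p = tensor_lift R P (\<lambda>r. K (fst r) (snd r) (snd p)) (\<beta> (fst p))"
    if p: "p \<in> carrier A \<times> carrier H" for p
  proof -
    have p': "fst p \<in> carrier A" "snd p \<in> carrier H" using p by auto
    let ?g = "\<lambda>ps r. \<beta>.sweedler P (\<lambda>rs. F' (fst r) (snd r) (snd p) (map fst rs) (map snd rs) (map snd ps))
      (map fst ps)"
    have "?R p = \<beta>.sweedler P (\<lambda>ps. tensor_lift R P (?g ps) (\<beta> (fst p))) as"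
      by (simp add: F'_def)
    also have "\<dots> = tensor_lift R P (\<lambda>r. \<beta>.sweedler P (\<lambda>ps. ?g ps r) as) (\<beta> (fst p))"
    proof (rule \<beta>.sweedler_tensor_lift_swap(1)[OF P \<beta>.presentation_T n(2) \<beta>.coaction_closed[OF p'(1)]])
      show "\<beta>.multibil P m (\<lambda>ps. ?g ps r)" if "r \<in> carrier A \<times> carrier H" for r
        using that p' by (intro multibil_coaction_comp[OF P F']) auto
      show "\<beta>.bilin P (?g ps)" if ps: "ps \<in> \<beta>.pairs m" for ps
      proof -
        have "\<beta>.multibil P (Suc m) (\<lambda>rs. F (map fst rs) (map snd rs) (snd p # map snd ps))"
          using ps p' by (intro multibil_coaction_inner[OF P F]) (simp add: power_gens_Cons pair_lists_map)
        from \<beta>.compatible_sweedler_head[OF P pair_lists_map(1)[OF ps] this] show ?thesis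
          by (simp add: F'_def)
      qed
    qed
    also have "\<dots> = tensor_lift R P (\<lambda>r. K (fst r) (snd r) (snd p)) (\<beta> (fst p))"
      by (simp add: K_def)
    finally show ?thesis .
  qed
  have "tensor_lift R P ?L (\<beta> a) =
      tensor_lift R P (\<lambda>p. tensor_lift R P (\<lambda>q. K (fst p) (fst q) (snd q)) (\<Delta> (snd p))) (\<beta> a)"
    using L by (intro AH.tensor_lift_cong[OF P Lc _ \<beta>.coaction_closed[OF n(3)], symmetric]) simp
  also have "\<dots> = tensor_lift R P (\<lambda>p. tensor_lift R P (\<lambda>r. K (fst r) (snd r) (snd p)) (\<beta> (fst p))) (\<beta> a)"
    by (rule coassoc_lift[OF P n(3) K1 K2 K3])
  also have "\<dots> = tensor_lift R P ?R (\<beta> a)"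
    using R by (intro AH.tensor_lift_cong[OF P Rc _ \<beta>.coaction_closed[OF n(3)]]) simp
  finally show ?case by simp
qed

end

section \<open>Multilinearity of faces, degeneracies and rotations\<close>

lemma power_gens_Suc_cases:
  assumes "xs \<in> power_gens M (Suc n)"
  obtains x ys where "xs = x # ys" "x \<in> carrier M" "ys \<in> power_gens M n"
  using assms by (cases xs) (auto simp: power_gens_def)

lemma power_gens_snoc_cases:
  assumes "xs \<in> power_gens M (Suc n)"
  obtains x ys where "xs = ys @ [x]" "x \<in> carrier M" "ys \<in> power_gens M n"
  using assms by (cases xs rule: rev_cases) (auto simp: power_gens_def)

lemma multilinear_cong:
  assumes "module R M" "multilinear R M P n g" "\<And>xs. xs \<in> power_gens M n \<Longrightarrow> f xs = g xs"
  shows "multilinear R M P n f"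
  unfolding multilinear_def
proof (intro conjI allI impI)
  show "f \<in> power_gens M n \<rightarrow> carrier P"
    using multilinear_closed[OF assms(2)] assms(3) by auto
  fix xs ys assume *: "set xs \<subseteq> carrier M" "set ys \<subseteq> carrier M" "Suc (length xs + length ys) = n"
  show "linear_map R M P (\<lambda>x. f (xs @ x # ys))"
  proof (rule linear_map_cong[OF assms(1)])
    show "linear_map R M P (\<lambda>x. g (xs @ x # ys))"
      using * assms(2) by (simp add: multilinear_def)
    show "f (xs @ x # ys) = g (xs @ x # ys)" if "x \<in> carrier M" for x
      using * that by (intro assms(3)) (auto simp: power_gens_def)
  qed
qed

text \<open>Converse to \<open>multilinear_head\<close> and \<open>multilinear_Cons\<close> taken
  together; it allows multilinearity to be proved by recursion on the list.\<close>

lemma multilinear_ConsI: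
  assumes "\<And>xs. xs \<in> power_gens M n \<Longrightarrow> linear_map R M P (\<lambda>x. f (x # xs))"
    and "\<And>x. x \<in> carrier M \<Longrightarrow> multilinear R M P n (\<lambda>xs. f (x # xs))"
  shows "multilinear R M P (Suc n) f"
  unfolding multilinear_def
proof (intro conjI allI impI)
  show "f \<in> power_gens M (Suc n) \<rightarrow> carrier P"
    using linear_map_closed[OF assms(1)] by (auto elim!: power_gens_Suc_cases)
  fix xs ys assume *: "set xs \<subseteq> carrier M" "set ys \<subseteq> carrier M" "Suc (length xs + length ys) = Suc n"
  show "linear_map R M P (\<lambda>x. f (xs @ x # ys))"
  proof (cases xs)
    case Nil
    then show ?thesis using * assms(1)[of ys] by (simp add: power_gens_def)
  next
    case (Cons u us)
    then show ?thesis
      using * multilinear_slot[of R M P us ys "\<lambda>xs. f (u # xs)"] assms(2)[of u] by simp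
  qed
qed

text \<open>The slot is either the last entry, which becomes the head of the rotated list, or it
  stays inside and moves by one place.\<close>

lemma multilinear_rotate:
  assumes "multilinear R M P n G" "n > 0"
  shows "multilinear R M P n (\<lambda>xs. G (last xs # butlast xs))"
  unfolding multilinear_def
proof (intro conjI allI impI)
  show "(\<lambda>xs. G (last xs # butlast xs)) \<in> power_gens M n \<rightarrow> carrier P"
  proof
    fix xs assume xs: "xs \<in> power_gens M n"
    then obtain ys x where "xs = ys @ [x]" using assms(2) by (cases xs rule: rev_cases) (auto simp: power_gens_def)
    then show "G (last xs # butlast xs) \<in> carrier P"
      using xs by (intro multilinear_closed[OF assms(1)]) (auto simp: power_gens_def)
  qed
  fix xs ys assume *: "set xs \<subseteq> carrier M" "set ys \<subseteq> carrier M" "Suc (length xs + length ys) = n"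
  show "linear_map R M P (\<lambda>x. G (last (xs @ x # ys) # butlast (xs @ x # ys)))"
  proof (cases ys rule: rev_cases)
    case Nil
    then show ?thesis
      using * multilinear_slot[of R M P "[]" xs G] assms(1) by (auto simp: butlast_append)
  next
    case (snoc zs z)
    then show ?thesis
      using * multilinear_slot[of R M P "z # xs" zs G] assms(1) by (auto simp: butlast_append)
  qed
qed

lemma multilinear_insert:
  assumes "multilinear R M P (Suc n) G" "u \<in> carrier M" "i \<le> n"
  shows "multilinear R M P n (\<lambda>xs. G (take i xs @ u # drop i xs))"
  using assms(1,3)
proof (induction i arbitrary: n G)
  case 0
  then show ?case using multilinear_Cons[OF _ assms(2)] by simp
next
  case (Suc i)
  then obtain m where n: "n = Suc m" by (cases n) auto
  show ?case
    unfolding n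
  proof (rule multilinear_ConsI)
    fix xs assume "xs \<in> power_gens M m"
    then have "take i xs @ u # drop i xs \<in> power_gens M (Suc m)"
      using assms(2) Suc.prems(2) n by (auto simp: power_gens_def dest: in_set_takeD in_set_dropD)
    then show "linear_map R M P (\<lambda>x. G (take (Suc i) (x # xs) @ u # drop (Suc i) (x # xs)))"
      using multilinear_head[OF Suc.prems(1)[unfolded n]] by simp
  next
    fix x assume "x \<in> carrier M"
    then show "multilinear R M P m (\<lambda>xs. G (take (Suc i) (x # xs) @ u # drop (Suc i) (x # xs)))"
      using Suc.IH[OF multilinear_Cons[OF Suc.prems(1)[unfolded n]]] Suc.prems(2) n by simp
  qed
qed

lemma multilinear_smult_tl:
  assumes "module R M" "module R P" "multilinear R M P n G" "linear_map R M (base_module R) \<phi>"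
  shows "multilinear R M P (Suc n) (\<lambda>xs. \<phi> (hd xs) \<odot>\<^bsub>P\<^esub> G (tl xs))"
proof (rule multilinear_ConsI; simp)
  show "linear_map R M P (\<lambda>x. \<phi> x \<odot>\<^bsub>P\<^esub> G xs)" if "xs \<in> power_gens M n" for xs
    by (rule linear_map_smult_const[OF assms(2,4) multilinear_closed[OF assms(3) that]])
  fix x assume "x \<in> carrier M"
  then have "\<phi> x \<in> carrier R" using linear_map_closed[OF assms(4)] by (simp add: base_module_def)
  then show "multilinear R M P n (\<lambda>xs. \<phi> x \<odot>\<^bsub>P\<^esub> G xs)"
    by (rule multilinear_comp[OF assms(3) linear_map_const_smult[OF assms(2) linear_map_id]])
qed

text \<open>A rotation brings the last entry to the head and so reduces this to
  \<open>multilinear_smult_tl\<close>.\<close>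

lemma multilinear_smult_butlast:
  assumes "module R M" "module R P" "multilinear R M P n G" "linear_map R M (base_module R) \<phi>"
  shows "multilinear R M P (Suc n) (\<lambda>xs. \<phi> (last xs) \<odot>\<^bsub>P\<^esub> G (butlast xs))"
  using multilinear_rotate[OF multilinear_smult_tl[OF assms]] by simp

section \<open>Products of adjacent entries, the common form of the inner faces\<close>

lemma split_at:
  assumes "Suc i < length xs"
  obtains us a b vs where "xs = us @ a # b # vs" "length us = i"
proof
  show "xs = take i xs @ xs ! i # xs ! Suc i # drop (Suc (Suc i)) xs"
    using assms by (simp add: Cons_nth_drop_Suc)
qed (use assms in simp)

context assoc_algebra
begin

text \<open>Positions count from 0. Hence the inner face with index \<open>i\<close> is
  \<open>merge i\<close> on the list a_0, ..., a_n, but \<open>merge (i - 1)\<close> on the list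
  h_1, ..., h_n.\<close>

definition merge :: "nat \<Rightarrow> 'c list \<Rightarrow> 'c list" where
  "merge i xs = take i xs @ (xs ! i \<otimes>\<^bsub>A\<^esub> xs ! Suc i) # drop (Suc (Suc i)) xs"

lemma merge_0 [simp]: "merge 0 (x # y # xs) = (x \<otimes>\<^bsub>A\<^esub> y) # xs"
  and merge_Suc [simp]: "merge (Suc i) (x # xs) = x # merge i xs"
  by (simp_all add: merge_def)

lemma merge_append: "merge (length us) (us @ a # b # vs) = us @ (a \<otimes>\<^bsub>A\<^esub> b) # vs"
  by (induction us) simp_all

lemma merge_closed:
  assumes "xs \<in> power_gens A (Suc n)" "i < n"
  shows "merge i xs \<in> power_gens A n"
proof -
  have "Suc i < length xs" using assms by (simp add: power_gens_def)
  then obtain us a b vs where *: "xs = us @ a # b # vs" "length us = i"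
    by (rule split_at)
  then show ?thesis
    using assms(1) by (auto simp: merge_append power_gens_def)
qed

lemma list_mult_merge:
  assumes "xs \<in> power_gens A (Suc n)" "i < n"
  shows "list_mult A (merge i xs) = list_mult A xs"
proof -
  have "Suc i < length xs" using assms by (simp add: power_gens_def)
  then obtain us a b vs where *: "xs = us @ a # b # vs" "length us = i"
    by (rule split_at)
  have "set us \<subseteq> carrier A" "a \<in> carrier A" "b \<in> carrier A" "set vs \<subseteq> carrier A"
    using assms(1) * by (auto simp: power_gens_def)
  then show ?thesis
    unfolding *(1) *(2)[symmetric] merge_append
    by (simp add: list_mult_append list_mult_Cons list_mult_closed m_assoc)
qed

lemma multilinear_merge:
  assumes "module R P" "multilinear R A P n G" "i < n"
  shows "multilinear R A P (Suc n) (\<lambda>xs. G (merge i xs))"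
  using assms(2,3)
proof (induction i arbitrary: n G)
  case 0
  then obtain m where n: "n = Suc m" by (cases n) auto
  note G = 0(1)[unfolded n]
  show ?case
    unfolding n
  proof (rule multilinear_ConsI)
    fix xs assume "xs \<in> power_gens A (Suc m)"
    then obtain b cs where xs: "xs = b # cs" "b \<in> carrier A" "cs \<in> power_gens A m"
      by (rule power_gens_Suc_cases)
    show "linear_map R A P (\<lambda>x. G (merge 0 (x # xs)))"
      using linear_map_comp[OF linear_map_mult_right[OF xs(2)] multilinear_head[OF G xs(3)]]
      by (simp add: xs)
  next
    fix a assume a: "a \<in> carrier A"
    \<comment> \<open>At position 0 the two factors of the product are separate slots, so a head is
      split off a second time.\<close>
    show "multilinear R A P (Suc m) (\<lambda>xs. G (merge 0 (a # xs)))"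
    proof (rule multilinear_ConsI; simp)
      show "linear_map R A P (\<lambda>b. G ((a \<otimes>\<^bsub>A\<^esub> b) # xs))" if "xs \<in> power_gens A m" for xs
        using linear_map_comp[OF linear_map_mult_left[OF a] multilinear_head[OF G that]] .
      show "multilinear R A P m (\<lambda>xs. G ((a \<otimes>\<^bsub>A\<^esub> b) # xs))" if "b \<in> carrier A" for b
        using a that by (intro multilinear_Cons[OF G]) auto
    qed
  qed
next
  case (Suc i)
  then obtain m where n: "n = Suc m" "i < m" by (cases n) auto
  note G = Suc.prems(1)[unfolded n]
  show ?case
    unfolding n
  proof (rule multilinear_ConsI)
    show "linear_map R A P (\<lambda>x. G (merge (Suc i) (x # xs)))" if "xs \<in> power_gens A (Suc m)" for xs
      using multilinear_head[OF G merge_closed[OF that n(2)]] by simp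
    show "multilinear R A P (Suc m) (\<lambda>xs. G (merge (Suc i) (x # xs)))" if "x \<in> carrier A" for x
      using Suc.IH[OF multilinear_Cons[OF G that] n(2)] by simp
  qed
qed

text \<open>With \<open>n > 0\<close> the list has at least two entries, so \<open>last xs\<close>
  and \<open>hd xs\<close> are distinct slots and the product is linear in each.\<close>

lemma multilinear_wrap:
  assumes "module R P" "multilinear R A P n G" "n > 0"
  shows "multilinear R A P (Suc n) (\<lambda>xs. G ((last xs \<otimes>\<^bsub>A\<^esub> hd xs) # butlast (tl xs)))"
proof -
  obtain m where n: "n = Suc m" using assms(3) by (cases n) auto
  note G = assms(2)[unfolded n]
  show ?thesis
    unfolding n
  proof (rule multilinear_ConsI)
    fix xs assume "xs \<in> power_gens A (Suc m)"
    then obtain b cs where xs: "xs = cs @ [b]" "b \<in> carrier A" "cs \<in> power_gens A m"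
      by (rule power_gens_snoc_cases)
    show "linear_map R A P (\<lambda>x. G ((last (x # xs) \<otimes>\<^bsub>A\<^esub> hd (x # xs)) # butlast (tl (x # xs))))"
      using linear_map_comp[OF linear_map_mult_left[OF xs(2)] multilinear_head[OF G xs(3)]]
      by (simp add: xs)
  next
    fix a assume a: "a \<in> carrier A"
    \<comment> \<open>For a fixed first entry \<open>a\<close> the product is formed with the head
      of the rest; a rotation then puts the last entry in the place of that head.\<close>
    have "multilinear R A P (Suc m) (\<lambda>xs. G ((hd xs \<otimes>\<^bsub>A\<^esub> a) # tl xs))"
    proof (rule multilinear_ConsI; simp)
      show "linear_map R A P (\<lambda>b. G ((b \<otimes>\<^bsub>A\<^esub> a) # xs))" if "xs \<in> power_gens A m" for xs
        using linear_map_comp[OF linear_map_mult_right[OF a] multilinear_head[OF G that]] .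
      show "multilinear R A P m (\<lambda>xs. G ((b \<otimes>\<^bsub>A\<^esub> a) # xs))" if "b \<in> carrier A" for b
        using a that by (intro multilinear_Cons[OF G]) auto
    qed
    from multilinear_rotate[OF this]
    have "multilinear R A P (Suc m) (\<lambda>xs. G ((last xs \<otimes>\<^bsub>A\<^esub> a) # butlast xs))"
      by simp
    then show "multilinear R A P (Suc m)
        (\<lambda>xs. G ((last (a # xs) \<otimes>\<^bsub>A\<^esub> hd (a # xs)) # butlast (tl (a # xs))))"
      by (rule multilinear_cong[OF module_axioms]) (auto simp: power_gens_def)
  qed
qed

end

section \<open>Sweedler sums with a product or the unit in one slot\<close>

context linear_coaction
begin

lemma sweedler_Cons_cong:
  assumes "module R P" "a \<in> carrier C" "as \<in> power_gens C n" "multibil P (Suc n) f"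
    and "\<And>p. p \<in> carrier M \<times> carrier N \<Longrightarrow> g p = sweedler P (\<lambda>ps. f (p # ps)) as"
  shows "tensor_lift R P g (\<beta> a) = sweedler P f (a # as)"
  unfolding sweedler_sum.simps
  by (rule presentation.tensor_lift_cong[OF presentation_T assms(1)
        compatible_sweedler_head[OF assms(1,3,4)] assms(5) coaction_closed[OF assms(2)]])

end

context coacting_algebra
begin

interpretation \<Delta>: linear_coaction R H H H \<Delta> by (rule linear_coaction_\<Delta>)
interpretation \<beta>: linear_coaction R A A H \<beta> by (rule linear_coaction_\<beta>)
interpretation HH: presentation R "carrier H \<times> carrier H" "tensor_rels R H H"
  by (rule \<Delta>.presentation_T)
interpretation AH: presentation R "carrier A \<times> carrier H" "tensor_rels R A H"
  by (rule \<beta>.presentation_T)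

text \<open>The product of A \<otimes> H applied to two neighbouring pure tensors. Zipping the two
  merged lists makes both projections merges of the original projections.\<close>

definition pair_merge :: "nat \<Rightarrow> ('a \<times> 'h) list \<Rightarrow> ('a \<times> 'h) list" where
  "pair_merge i ps = zip (A.merge i (map fst ps)) (H.merge i (map snd ps))"

lemma pair_merge_0: "pair_merge 0 (p # q # ps) = (fst p \<otimes>\<^bsub>A\<^esub> fst q, snd p \<otimes>\<^bsub>H\<^esub> snd q) # ps"
  and pair_merge_Suc: "pair_merge (Suc i) (p # ps) = p # pair_merge i ps"
  by (simp_all add: pair_merge_def zip_map_fst_snd)

text \<open>Multiplicativity of the coaction inside a longer sum. Entries before the slot are peeled
  off; with none left, the sum over \<open>vs\<close> is the bilinear function in
  \<open>coaction_mult_lift\<close>.\<close>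

lemma sweedler_mult_slot:
  assumes P: "module R P" and "set us \<subseteq> carrier A" and a: "a \<in> carrier A" and b: "b \<in> carrier A"
    and vs: "set vs \<subseteq> carrier A" and "\<beta>.multibil P (Suc (length us + length vs)) f"
  shows "\<beta>.sweedler P (\<lambda>ps. f (pair_merge (length us) ps)) (us @ a # b # vs) =
    \<beta>.sweedler P f (us @ (a \<otimes>\<^bsub>A\<^esub> b) # vs)"
  using assms(2,6)
proof (induction us arbitrary: f)
  case Nil
  then have "\<beta>.bilin P (\<lambda>p. \<beta>.sweedler P (\<lambda>ps. f (p # ps)) vs)"
    using vs by (intro \<beta>.compatible_sweedler_head[OF P, of _ "length vs"]) (simp_all add: power_gens_def)
  from coaction_mult_lift[OF P this a b] show ?case
    by (simp add: pair_merge_0)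
next
  case (Cons u us)
  let ?n = "Suc (length us + length vs)"
  have f: "\<beta>.multibil P (Suc ?n) f" and u: "u \<in> carrier A" using Cons.prems by simp_all
  have as: "us @ (a \<otimes>\<^bsub>A\<^esub> b) # vs \<in> power_gens A ?n"
    using Cons.prems(1) a b vs by (simp add: power_gens_def)
  show ?case
    using \<beta>.sweedler_Cons_cong[OF P u as f Cons.IH[OF _ multibilinear_Cons[OF f]]] Cons.prems(1)
    by (simp add: pair_merge_Suc)
qed

lemma sweedler_one_slot:
  assumes P: "module R P" and "set us \<subseteq> carrier A"
    and vs: "set vs \<subseteq> carrier A" and "\<beta>.multibil P (Suc (length us + length vs)) f"
  shows "\<beta>.sweedler P f (us @ \<one>\<^bsub>A\<^esub> # vs) =
    \<beta>.sweedler P (\<lambda>ps. f (take (length us) ps @ (\<one>\<^bsub>A\<^esub>, \<one>\<^bsub>H\<^esub>) # drop (length us) ps)) (us @ vs)"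
  using assms(2,4)
proof (induction us arbitrary: f)
  case Nil
  then have "\<beta>.bilin P (\<lambda>p. \<beta>.sweedler P (\<lambda>ps. f (p # ps)) vs)"
    using vs by (intro \<beta>.compatible_sweedler_head[OF P, of _ "length vs"]) (simp_all add: power_gens_def)
  from coaction_one_lift[OF P this] show ?case by simp
next
  case (Cons u us)
  let ?n = "Suc (length us + length vs)"
  have f: "\<beta>.multibil P (Suc ?n) f" and u: "u \<in> carrier A" using Cons.prems by simp_all
  have as: "us @ \<one>\<^bsub>A\<^esub> # vs \<in> power_gens A ?n"
    using Cons.prems(1) vs by (simp add: power_gens_def)
  show ?case
    using \<beta>.sweedler_Cons_cong[OF P u as f Cons.IH[symmetric, OF _ multibilinear_Cons[OF f]]] Cons.prems(1)
    by simp
qed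

lemma multibil_smult:
  assumes P: "module R P" and \<phi>: "linear_map R A (base_module R) \<phi>" and G: "multilinear R H P n G"
  shows "\<beta>.multibil P n (\<lambda>ps. \<phi> (list_mult A (map fst ps)) \<odot>\<^bsub>P\<^esub> G (map snd ps))"
proof (rule multibilinearI[OF A.module_axioms H.module_axioms P])
  show "multilinear R A P n (\<lambda>xs. \<phi> (list_mult A xs) \<odot>\<^bsub>P\<^esub> G ys)" if "ys \<in> power_gens H n" for ys
    using multilinear_comp[OF A.multilinear_list_mult
        linear_map_smult_const[OF P \<phi> multilinear_closed[OF G that]]] .
  show "multilinear R H P n (\<lambda>ys. \<phi> (list_mult A xs) \<odot>\<^bsub>P\<^esub> G ys)" if "xs \<in> power_gens A n" for xs
  proof -
    have c: "\<phi> (list_mult A xs) \<in> carrier R"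
      using linear_map_closed[OF \<phi> A.list_mult_closed] that
      by (simp add: power_gens_def base_module_def)
    show ?thesis
      using multilinear_comp[OF G linear_map_const_smult[OF P linear_map_id c]] .
  qed
qed

end

section \<open>The characteristic map of an invariant trace\<close>

locale invariant_trace = coacting_algebra R H A \<Delta> \<epsilon> S \<beta>
  for R :: "('k, 'r) ring_scheme" (structure) and H :: "('k, 'h, 'u) module_scheme" (structure)
    and A :: "('k, 'a, 'v) module_scheme" (structure) and \<Delta> \<epsilon> S \<beta> +
  fixes \<delta> :: "'h \<Rightarrow> 'k" and \<sigma> :: 'h and Tr :: "'a \<Rightarrow> 'k"
  assumes character: "algebra_map R H (base_module R) \<delta>"
    and \<sigma>_closed: "\<sigma> \<in> carrier H"
    and trace: "delta_trace R A \<beta> \<delta> Tr"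
    and invariant: "sigma_invariant R H S \<sigma> A \<beta> Tr"
begin

interpretation \<Delta>: linear_coaction R H H H \<Delta> by (rule linear_coaction_\<Delta>)
interpretation \<beta>: linear_coaction R A A H \<beta> by (rule linear_coaction_\<beta>)
interpretation AH: presentation R "carrier A \<times> carrier H" "tensor_rels R A H"
  by (rule \<beta>.presentation_T)

lemma base_simps: "carrier (base_module R) = carrier R" "smult (base_module R) = mult R"
  by (simp_all add: base_module_def)

lemma module_base: "module R (base_module R)"
  by (rule module_base_module[OF H.R.is_cring])

lemma \<delta>_linear: "linear_map R H (base_module R) \<delta>"
  using character by (simp add: algebra_map_def)

lemma \<epsilon>_linear: "linear_map R H (base_module R) \<epsilon>"
  using counit_algebra_map by (simp add: algebra_map_def)

lemma Tr_linear: "linear_map R A (base_module R) Tr"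
  using trace by (simp add: delta_trace_def)

lemma Tr_closed: "a \<in> carrier A \<Longrightarrow> Tr a \<in> carrier R"
  and \<delta>_closed: "h \<in> carrier H \<Longrightarrow> \<delta> h \<in> carrier R"
  and \<epsilon>_closed: "h \<in> carrier H \<Longrightarrow> \<epsilon> h \<in> carrier R"
  using linear_map_closed[OF Tr_linear] linear_map_closed[OF \<delta>_linear] linear_map_closed[OF \<epsilon>_linear]
  by (simp_all add: base_simps)

lemma twisted_antipode_linear: "linear_map R H H (twisted_antipode H S \<sigma>)"
  unfolding twisted_antipode_def[abs_def]
  by (rule linear_map_comp[OF antipode_linear H.linear_map_mult_left[OF \<sigma>_closed]])

text \<open>The summand of \<gamma> with the pure tensor of the H-legs replaced by \<open>G\<close>.
  The map \<gamma> itself is the case where \<open>G\<close> is \<open>tensor_list\<close>, and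
  composing it with an operator on the Hopf side changes nothing but \<open>G\<close>.\<close>

definition trace_fun where
  "trace_fun P G a ps = Tr (a \<otimes>\<^bsub>A\<^esub> list_mult A (map fst ps)) \<odot>\<^bsub>P\<^esub> G (map snd ps)"

lemma multibil_trace_fun:
  assumes "module R P" "multilinear R H P n G" "a \<in> carrier A"
  shows "\<beta>.multibil P n (trace_fun P G a)"
  unfolding trace_fun_def[abs_def]
  by (rule multibil_smult[OF assms(1) linear_map_comp[OF A.linear_map_mult_left[OF assms(3)] Tr_linear]
        assms(2)])

lemma list_mult_fst_closed: "ps \<in> \<beta>.pairs n \<Longrightarrow> list_mult A (map fst ps) \<in> carrier A"
  by (rule A.list_mult_closed) (auto simp: pair_lists_def)

lemma linear_map_trace_fun:
  assumes "module R P" "multilinear R H P n G" "ps \<in> \<beta>.pairs n"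
  shows "linear_map R A P (\<lambda>a. trace_fun P G a ps)"
  unfolding trace_fun_def
  by (rule linear_map_smult_const[OF assms(1) linear_map_comp[OF
          A.linear_map_mult_right[OF list_mult_fst_closed[OF assms(3)]] Tr_linear]
        multilinear_closed[OF assms(2) pair_lists_map(2)[OF assms(3)]]])

section \<open>Faces and degeneracies at the level of Sweedler sums\<close>

lemma sweedler_counit_face:
  assumes P: "module R P" and G: "multilinear R H P n G"
    and a: "a \<in> carrier A" "b \<in> carrier A" and as: "as \<in> power_gens A n"
  shows "\<beta>.sweedler P (trace_fun P (\<lambda>hs. \<epsilon> (hd hs) \<odot>\<^bsub>P\<^esub> G (tl hs)) a) (b # as) =
    \<beta>.sweedler P (trace_fun P G (a \<otimes>\<^bsub>A\<^esub> b)) as"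
proof -
  interpret P: module R P by fact
  let ?G = "\<lambda>hs. \<epsilon> (hd hs) \<odot>\<^bsub>P\<^esub> G (tl hs)"
  \<comment> \<open>The right side with the factor \<open>b\<close> as a free argument. It is linear
    in that argument, so it can be applied to the counit identity for \<open>b\<close>.\<close>
  let ?W = "\<lambda>x. \<beta>.sweedler P (trace_fun P G (a \<otimes>\<^bsub>A\<^esub> x)) as"
  have W: "linear_map R A P ?W"
    by (rule linear_map_comp[OF A.linear_map_mult_left[OF a(1)] \<beta>.linear_map_sweedler_param[OF P
            A.module_axioms as multibil_trace_fun[OF P G] linear_map_trace_fun[OF P G]]])
  let ?f = "\<lambda>(x, y). \<epsilon> y \<odot>\<^bsub>A\<^esub> x"
  have f: "\<beta>.bilin A ?f"
    by (rule compatible_tensorI[OF A.module_axioms H.module_axioms A.module_axioms]; simp)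
      (auto intro: linear_map_const_smult[OF A.module_axioms linear_map_id] \<epsilon>_closed
        linear_map_smult_const[OF A.module_axioms \<epsilon>_linear])
  have "?W b = ?W (tensor_lift R A ?f (\<beta> b))"
    by (simp only: coaction_counit[OF a(2)])
  also have "\<dots> = tensor_lift R P (\<lambda>p. ?W (?f p)) (\<beta> b)"
    by (rule AH.tensor_lift_linear[OF A.module_axioms P f W \<beta>.coaction_closed[OF a(2)]])
  also have "\<dots> = \<beta>.sweedler P (trace_fun P ?G a) (b # as)"
  proof (rule \<beta>.sweedler_Cons_cong[OF P a(2) as])
    have mG: "multilinear R H P (Suc n) ?G"
      by (rule multilinear_smult_tl[OF H.module_axioms P G \<epsilon>_linear])
    show T: "\<beta>.multibil P (Suc n) (trace_fun P ?G a)"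
      by (rule multibil_trace_fun[OF P mG a(1)])
    fix p assume p: "p \<in> carrier A \<times> carrier H"
    show "?W (?f p) = \<beta>.sweedler P (\<lambda>ps. trace_fun P ?G a (p # ps)) as"
    proof (rule \<beta>.sweedler_cong[OF P as multibilinear_Cons[OF T p]])
      fix ps assume ps: "ps \<in> \<beta>.pairs n"
      obtain x y where xy: "p = (x, y)" "x \<in> carrier A" "y \<in> carrier H" using p by auto
      have cl: "list_mult A (map fst ps) \<in> carrier A" "G (map snd ps) \<in> carrier P" "\<epsilon> y \<in> carrier R"
        using list_mult_fst_closed[OF ps] multilinear_closed[OF G pair_lists_map(2)[OF ps]]
          \<epsilon>_closed[OF xy(3)] by auto
      then show "trace_fun P G (a \<otimes>\<^bsub>A\<^esub> ?f p) ps = trace_fun P ?G a (p # ps)"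
        using a xy by (simp add: trace_fun_def A.list_mult_Cons A.smult_mult_right A.smult_mult_left
            A.m_assoc linear_map_smult[OF Tr_linear] base_simps Tr_closed P.smult_assoc1[symmetric]
            H.R.m_comm)
    qed
  qed
  finally show ?thesis by simp
qed

text \<open>Merging two neighbouring pairs leaves the product of the A-legs unchanged and merges the
  H-legs, so only the argument of \<open>G\<close> is affected.\<close>

lemma sweedler_merge:
  assumes P: "module R P" and G: "multilinear R H P n G" and a: "a \<in> carrier A"
    and as: "as \<in> power_gens A (Suc n)" and i: "i < n"
  shows "\<beta>.sweedler P (trace_fun P (\<lambda>hs. G (H.merge i hs)) a) as =
    \<beta>.sweedler P (trace_fun P G a) (A.merge i as)"
proof -
  have "Suc i < length as" using as i by (simp add: power_gens_def)
  then obtain us b c vs where *: "as = us @ b # c # vs" "length us = i" by (rule split_at)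
  have n: "n = Suc (length us + length vs)" and cl: "set us \<subseteq> carrier A" "b \<in> carrier A"
    "c \<in> carrier A" "set vs \<subseteq> carrier A"
    using as * by (auto simp: power_gens_def)
  have mG: "multilinear R H P (Suc n) (\<lambda>hs. G (H.merge i hs))"
    by (rule H.multilinear_merge[OF P G i])
  have "\<beta>.sweedler P (trace_fun P G a) (A.merge i as) =
      \<beta>.sweedler P (\<lambda>ps. trace_fun P G a (pair_merge i ps)) as"
    using sweedler_mult_slot[OF P cl multibil_trace_fun[OF P G[unfolded n] a]]
    by (simp add: *(1) *(2)[symmetric] A.merge_append)
  also have "\<dots> = \<beta>.sweedler P (trace_fun P (\<lambda>hs. G (H.merge i hs)) a) as"
  proof (rule \<beta>.sweedler_cong[OF P as multibil_trace_fun[OF P mG a]])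
    fix ps assume ps: "ps \<in> \<beta>.pairs (Suc n)"
    have len: "length (A.merge i (map fst ps)) = length (H.merge i (map snd ps))"
      using A.merge_closed[OF pair_lists_map(1)[OF ps] i] H.merge_closed[OF pair_lists_map(2)[OF ps] i]
      by (simp add: power_gens_def)
    show "trace_fun P G a (pair_merge i ps) = trace_fun P (\<lambda>hs. G (H.merge i hs)) a ps"
      using A.list_mult_merge[OF pair_lists_map(1)[OF ps] i] len
      by (simp add: trace_fun_def pair_merge_def)
  qed
  finally show ?thesis by simp
qed

text \<open>Here \<open>a\<close> is a_0 and \<open>z\<close> is the last entry. \<open>G\<close> is
  arbitrary because the computation serves the last face and, with a further H-leg put in front of
  the tensor, the cyclic operator.\<close>

lemma sweedler_trace_face:
  assumes P: "module R P" and G: "multilinear R H P n G"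
    and a: "a \<in> carrier A" "z \<in> carrier A" and as: "as \<in> power_gens A n"
  shows "\<beta>.sweedler P (trace_fun P (\<lambda>hs. \<delta> (last hs) \<odot>\<^bsub>P\<^esub> G (butlast hs)) a) (as @ [z]) =
    \<beta>.sweedler P (trace_fun P G (z \<otimes>\<^bsub>A\<^esub> a)) as"
proof -
  interpret P: module R P by fact
  let ?G = "\<lambda>hs. \<delta> (last hs) \<odot>\<^bsub>P\<^esub> G (butlast hs)"
  have mG: "multilinear R H P (Suc n) ?G"
    by (rule multilinear_smult_butlast[OF H.module_axioms P G \<delta>_linear])
  have za: "z \<otimes>\<^bsub>A\<^esub> a \<in> carrier A" using a by simp
  have "\<beta>.sweedler P (trace_fun P ?G a) (as @ [z]) =
      \<beta>.sweedler P (\<lambda>ps. tensor_lift R P (\<lambda>p. trace_fun P ?G a (ps @ [p])) (\<beta> z)) as"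
    by (simp add: sweedler_sum_append)
  also have "\<dots> = \<beta>.sweedler P (trace_fun P G (z \<otimes>\<^bsub>A\<^esub> a)) as"
  proof (rule \<beta>.sweedler_cong[OF P as multibil_trace_fun[OF P G za]])
    fix ps assume ps: "ps \<in> \<beta>.pairs n"
    \<comment> \<open>With the legs of \<open>as\<close> fixed, the trace property is used for the
      product of \<open>z\<close> and \<open>b\<close>: it puts the A-leg of \<open>z\<close> behind
      \<open>b\<close> and creates the factor \<delta> at its H-leg.\<close>
    define b where "b = a \<otimes>\<^bsub>A\<^esub> list_mult A (map fst ps)"
    define w where "w = G (map snd ps)"
    have b: "b \<in> carrier A" unfolding b_def using a list_mult_fst_closed[OF ps] by simp
    have w: "w \<in> carrier P" unfolding w_def using multilinear_closed[OF G pair_lists_map(2)[OF ps]] .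
    let ?f = "\<lambda>(x, y). Tr (b \<otimes>\<^bsub>A\<^esub> x) \<otimes>\<^bsub>R\<^esub> \<delta> y"
    have f: "\<beta>.bilin (base_module R) ?f"
    proof (rule compatible_tensorI[OF A.module_axioms H.module_axioms module_base]; unfold case_prod_conv)
      show "linear_map R A (base_module R) (\<lambda>x. Tr (b \<otimes>\<^bsub>A\<^esub> x) \<otimes>\<^bsub>R\<^esub> \<delta> y)" if "y \<in> carrier H" for y
        using linear_map_smult_const[OF module_base
            linear_map_comp[OF A.linear_map_mult_left[OF b] Tr_linear], of "\<delta> y"] \<delta>_closed[OF that]
        by (simp add: base_simps)
      show "linear_map R H (base_module R) (\<lambda>y. Tr (b \<otimes>\<^bsub>A\<^esub> x) \<otimes>\<^bsub>R\<^esub> \<delta> y)" if "x \<in> carrier A" for x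
        using linear_map_const_smult[OF module_base \<delta>_linear, of "Tr (b \<otimes>\<^bsub>A\<^esub> x)"] b that
        by (simp add: base_simps Tr_closed)
    qed
    have \<phi>: "linear_map R (base_module R) P (\<lambda>c. c \<odot>\<^bsub>P\<^esub> w)"
      by (rule linear_map_smult_const[OF P linear_map_id w])
    have "trace_fun P G (z \<otimes>\<^bsub>A\<^esub> a) ps = Tr (z \<otimes>\<^bsub>A\<^esub> b) \<odot>\<^bsub>P\<^esub> w"
      using a list_mult_fst_closed[OF ps] by (simp add: trace_fun_def b_def w_def A.m_assoc)
    also have "\<dots> = tensor_lift R (base_module R) ?f (\<beta> z) \<odot>\<^bsub>P\<^esub> w"
      using trace a(2) b by (simp add: delta_trace_def)
    also have "\<dots> = tensor_lift R P (\<lambda>p. ?f p \<odot>\<^bsub>P\<^esub> w) (\<beta> z)"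
      by (rule AH.tensor_lift_linear[OF module_base P f \<phi> \<beta>.coaction_closed[OF a(2)]])
    also have "\<dots> = tensor_lift R P (\<lambda>p. trace_fun P ?G a (ps @ [p])) (\<beta> z)"
    proof (rule AH.tensor_lift_cong[OF P _ _ \<beta>.coaction_closed[OF a(2)]])
      show "\<beta>.bilin P (\<lambda>p. trace_fun P ?G a (ps @ [p]))"
        using multibilinear_slot[of R A H P ps "[]" "trace_fun P ?G a"] multibil_trace_fun[OF P mG a(1)] ps
        by (simp add: pair_lists_def)
      fix p assume "p \<in> carrier A \<times> carrier H"
      then obtain x y where p: "p = (x, y)" "x \<in> carrier A" "y \<in> carrier H" by auto
      have "set (map fst ps) \<subseteq> carrier A" using ps by (auto simp: pair_lists_def)
      then have "list_mult A (map fst (ps @ [p])) = list_mult A (map fst ps) \<otimes>\<^bsub>A\<^esub> x"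
        using p by (simp add: A.list_mult_append A.list_mult_Cons A.list_mult_Nil)
      then have "trace_fun P ?G a (ps @ [p]) = Tr (b \<otimes>\<^bsub>A\<^esub> x) \<odot>\<^bsub>P\<^esub> (\<delta> y \<odot>\<^bsub>P\<^esub> w)"
        using p a list_mult_fst_closed[OF ps] by (simp add: trace_fun_def b_def w_def A.m_assoc)
      then show "?f p \<odot>\<^bsub>P\<^esub> w = trace_fun P ?G a (ps @ [p])"
        using p b w by (simp add: P.smult_assoc1 Tr_closed \<delta>_closed)
    qed
    finally show "tensor_lift R P (\<lambda>p. trace_fun P ?G a (ps @ [p])) (\<beta> z) =
      trace_fun P G (z \<otimes>\<^bsub>A\<^esub> a) ps" by simp
  qed
  finally show ?thesis .
qed

text \<open>\<beta> sends 1 to 1 \<otimes> 1; the first unit drops out of the trace and the second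
  remains in the H-tensor. The list \<open>as\<close> omits a_0, so its position \<open>i\<close> is
  the place after a_i, and the index is the same on both sides.\<close>

lemma sweedler_degen:
  assumes P: "module R P" and G: "multilinear R H P (Suc n) G" and a: "a \<in> carrier A"
    and as: "as \<in> power_gens A n" and i: "i \<le> n"
  shows "\<beta>.sweedler P (trace_fun P (\<lambda>hs. G (take i hs @ \<one>\<^bsub>H\<^esub> # drop i hs)) a) as =
    \<beta>.sweedler P (trace_fun P G a) (take i as @ \<one>\<^bsub>A\<^esub> # drop i as)"
proof -
  have len: "length (take i as) = i" "n = length (take i as) + length (drop i as)"
    using as i by (auto simp: power_gens_def)
  have sets: "set (take i as) \<subseteq> carrier A" "set (drop i as) \<subseteq> carrier A"
    using as by (auto simp: power_gens_def dest: in_set_takeD in_set_dropD)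
  have mG: "multilinear R H P n (\<lambda>hs. G (take i hs @ \<one>\<^bsub>H\<^esub> # drop i hs))"
    by (rule multilinear_insert[OF G H.one_closed i])
  have "\<beta>.sweedler P (trace_fun P G a) (take i as @ \<one>\<^bsub>A\<^esub> # drop i as) =
      \<beta>.sweedler P (\<lambda>ps. trace_fun P G a (take i ps @ (\<one>\<^bsub>A\<^esub>, \<one>\<^bsub>H\<^esub>) # drop i ps)) as"
    using sweedler_one_slot[OF P sets multibil_trace_fun[OF P G[unfolded len(2)] a]]
    unfolding len(1) append_take_drop_id .
  also have "\<dots> = \<beta>.sweedler P (trace_fun P (\<lambda>hs. G (take i hs @ \<one>\<^bsub>H\<^esub> # drop i hs)) a) as"
  proof (rule \<beta>.sweedler_cong[OF P as multibil_trace_fun[OF P mG a]])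
    fix ps assume ps: "ps \<in> \<beta>.pairs n"
    have "set (take i (map fst ps)) \<subseteq> carrier A" "set (drop i (map fst ps)) \<subseteq> carrier A"
      using pair_lists_map(1)[OF ps] by (auto simp: power_gens_def dest!: in_set_takeD in_set_dropD)
    then have "list_mult A (take i (map fst ps) @ \<one>\<^bsub>A\<^esub> # drop i (map fst ps)) =
        list_mult A (take i (map fst ps) @ drop i (map fst ps))"
      by (simp only: A.list_mult_append A.list_mult_Cons list.set insert_subset A.one_closed)
        (simp add: A.list_mult_closed)
    then show "trace_fun P G a (take i ps @ (\<one>\<^bsub>A\<^esub>, \<one>\<^bsub>H\<^esub>) # drop i ps) =
        trace_fun P (\<lambda>hs. G (take i hs @ \<one>\<^bsub>H\<^esub> # drop i hs)) a ps"
      by (simp add: trace_fun_def take_map[symmetric] drop_map[symmetric])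
  qed
  finally show ?thesis by simp
qed

section \<open>From pure tensors to the maps \<gamma> on tensor powers; faces and
  degeneracies\<close>

lemma module_power: "module R (tensor_power R H n)"
  by (rule module_tensor_power[OF H.module_axioms])

lemma gamma_pure_Cons:
  "gamma_pure R H A \<beta> Tr n (a # as) =
    \<beta>.sweedler (tensor_power R H n) (trace_fun (tensor_power R H n) (tensor_list R H) a) as"
  by (simp add: gamma_pure_def trace_fun_def[abs_def])

lemma multilinear_gamma_pure:
  "multilinear R A (tensor_power R H n) (Suc n) (gamma_pure R H A \<beta> Tr n)"
proof (rule multilinear_ConsI; unfold gamma_pure_Cons)
  note tl = multilinear_tensor_list[OF H.module_axioms, of n]
  note mb = multibil_trace_fun[OF module_power tl]
  show "linear_map R A (tensor_power R H n) (\<lambda>a.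
      \<beta>.sweedler (tensor_power R H n) (trace_fun (tensor_power R H n) (tensor_list R H) a) as)"
    if "as \<in> power_gens A n" for as
    by (rule \<beta>.linear_map_sweedler_param[OF module_power A.module_axioms that mb
          linear_map_trace_fun[OF module_power tl]])
  show "multilinear R A (tensor_power R H n) n
      (\<beta>.sweedler (tensor_power R H n) (trace_fun (tensor_power R H n) (tensor_list R H) a))"
    if "a \<in> carrier A" for a
    by (rule \<beta>.multilinear_sweedler[OF module_power mb[OF that]])
qed

lemma linear_map_gamma:
  "linear_map R (tensor_power R A (Suc n)) (tensor_power R H n) (gamma_map R H A \<beta> Tr n)"
  unfolding gamma_map_def
  by (rule linear_map_power_lift[OF A.module_axioms module_power multilinear_gamma_pure])

lemma gamma_tensor_list:
  "as \<in> power_gens A (Suc n) \<Longrightarrow>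
    gamma_map R H A \<beta> Tr n (tensor_list R A as) = gamma_pure R H A \<beta> Tr n as"
  unfolding gamma_map_def
  by (rule tensor_lift_tensor_list[OF A.module_axioms module_power multilinear_gamma_pure])

text \<open>The lift of \<open>F\<close> is linear and passes inside the sum that defines \<gamma>;
  on the pure tensor found there it takes the value of \<open>F\<close>.\<close>

lemma lift_gamma_pure:
  assumes P: "module R P" and F: "multilinear R H P n F" and a: "a \<in> carrier A"
    and as: "as \<in> power_gens A n"
  shows "tensor_lift R P F (gamma_pure R H A \<beta> Tr n (a # as)) = \<beta>.sweedler P (trace_fun P F a) as"
proof -
  let ?H = "tensor_power R H n"
  note lin = linear_map_power_lift[OF H.module_axioms P F]
  note tl = multilinear_tensor_list[OF H.module_axioms, of n]
  have "tensor_lift R P F (gamma_pure R H A \<beta> Tr n (a # as)) =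
      \<beta>.sweedler P (\<lambda>ps. tensor_lift R P F (trace_fun ?H (tensor_list R H) a ps)) as"
    unfolding gamma_pure_Cons
    by (rule \<beta>.sweedler_linear[OF module_power P lin as multibil_trace_fun[OF module_power tl a]])
  also have "\<dots> = \<beta>.sweedler P (trace_fun P F a) as"
  proof (rule \<beta>.sweedler_cong[OF P as multibil_trace_fun[OF P F a]])
    fix ps assume ps: "ps \<in> \<beta>.pairs n"
    note hs = pair_lists_map(2)[OF ps]
    show "tensor_lift R P F (trace_fun ?H (tensor_list R H) a ps) = trace_fun P F a ps"
      using a list_mult_fst_closed[OF ps]
      by (simp add: trace_fun_def linear_map_smult[OF lin] Tr_closed multilinear_closed[OF tl hs]
          tensor_lift_tensor_list[OF H.module_axioms P F hs])
  qed
  finally show ?thesis .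
qed

text \<open>Reduces a commuting square to pure tensors. On the algebra side each operator sends pure
  tensors to pure tensors, hence the map \<open>g\<close> of lists. On the Hopf side scalars and
  Sweedler sums occur, hence a general multilinear \<open>F\<close>.\<close>

lemma gamma_commute:
  assumes g: "multilinear R A (tensor_power R A (Suc m)) (Suc n) (\<lambda>as. tensor_list R A (g as))"
    and g_closed: "\<And>as. as \<in> power_gens A (Suc n) \<Longrightarrow> g as \<in> power_gens A (Suc m)"
    and F: "multilinear R H (tensor_power R H m) n F"
    and eq: "\<And>a as. a \<in> carrier A \<Longrightarrow> as \<in> power_gens A n \<Longrightarrow> gamma_pure R H A \<beta> Tr m (g (a # as)) =
      \<beta>.sweedler (tensor_power R H m) (trace_fun (tensor_power R H m) F a) as"
    and x: "x \<in> carrier (tensor_power R A (Suc n))"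
  shows "gamma_map R H A \<beta> Tr m (tensor_lift R (tensor_power R A (Suc m)) (\<lambda>as. tensor_list R A (g as)) x) =
    tensor_lift R (tensor_power R H m) F (gamma_map R H A \<beta> Tr n x)"
proof (rule tensor_power_ext[OF A.module_axioms module_power _ _ _ x])
  have A: "module R (tensor_power R A (Suc m))" by (rule module_tensor_power[OF A.module_axioms])
  show "linear_map R (tensor_power R A (Suc n)) (tensor_power R H m)
      (\<lambda>x. gamma_map R H A \<beta> Tr m (tensor_lift R (tensor_power R A (Suc m)) (\<lambda>as. tensor_list R A (g as)) x))"
    by (rule linear_map_comp[OF linear_map_power_lift[OF A.module_axioms A g] linear_map_gamma])
  show "linear_map R (tensor_power R A (Suc n)) (tensor_power R H m)
      (\<lambda>x. tensor_lift R (tensor_power R H m) F (gamma_map R H A \<beta> Tr n x))"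
    by (rule linear_map_comp[OF linear_map_gamma linear_map_power_lift[OF H.module_axioms module_power F]])
  fix as assume as: "as \<in> power_gens A (Suc n)"
  then obtain a bs where *: "as = a # bs" "a \<in> carrier A" "bs \<in> power_gens A n"
    by (rule power_gens_Suc_cases)
  show "gamma_map R H A \<beta> Tr m (tensor_lift R (tensor_power R A (Suc m))
        (\<lambda>as. tensor_list R A (g as)) (tensor_list R A as)) =
      tensor_lift R (tensor_power R H m) F (gamma_map R H A \<beta> Tr n (tensor_list R A as))"
    using eq[OF *(2,3)] lift_gamma_pure[OF module_power F *(2,3)] g_closed[OF as]
    by (simp add: tensor_lift_tensor_list[OF A.module_axioms A g as] gamma_tensor_list[OF as]
        gamma_tensor_list[OF g_closed[OF as]], simp add: *(1))
qed

lemma gamma_face: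
  assumes i: "i \<le> Suc n" and x: "x \<in> carrier (tensor_power R A (Suc (Suc n)))"
  shows "gamma_map R H A \<beta> Tr n (tensor_lift R (tensor_power R A (Suc n))
      (\<lambda>as. tensor_list R A (alg_face_list A (Suc n) i as)) x) =
    tensor_lift R (tensor_power R H n) (hopf_face_pure R H \<epsilon> \<delta> (Suc n) i) (gamma_map R H A \<beta> Tr (Suc n) x)"
proof -
  let ?P = "tensor_power R H n"
  note tlA = multilinear_tensor_list[OF A.module_axioms, of "Suc n"]
  note tlH = multilinear_tensor_list[OF H.module_axioms, of n]
  have mA: "module R (tensor_power R A (Suc n))" by (rule module_tensor_power[OF A.module_axioms])
  \<comment> \<open>The entry a_0 has no counterpart on the Hopf side, so for an inner face
    multiplication at position \<open>i\<close> corresponds to position \<open>j\<close>, one less.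
    The extreme faces involve a_0 and use the counit and the trace property.\<close>
  consider "i = 0" | j where "i = Suc j" "j < n" | "i = Suc n"
    using i by (cases i) fastforce+
  then show ?thesis
  proof cases
    case 1
    have g: "alg_face_list A (Suc n) i = A.merge 0"
      by (auto simp: alg_face_list_def A.merge_def 1)
    have F: "hopf_face_pure R H \<epsilon> \<delta> (Suc n) i = (\<lambda>hs. \<epsilon> (hd hs) \<odot>\<^bsub>?P\<^esub> tensor_list R H (tl hs))"
      by (simp add: hopf_face_pure_def 1 fun_eq_iff)
    show ?thesis
      unfolding g F
    proof (rule gamma_commute[OF _ _ _ _ x])
      show "multilinear R A (tensor_power R A (Suc n)) (Suc (Suc n)) (\<lambda>as. tensor_list R A (A.merge 0 as))"
        by (rule A.multilinear_merge[OF mA tlA]) simp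
      show "multilinear R H ?P (Suc n) (\<lambda>hs. \<epsilon> (hd hs) \<odot>\<^bsub>?P\<^esub> tensor_list R H (tl hs))"
        by (rule multilinear_smult_tl[OF H.module_axioms module_power tlH \<epsilon>_linear])
      fix a as assume a: "a \<in> carrier A" and "as \<in> power_gens A (Suc n)"
      then obtain b bs where "as = b # bs" "b \<in> carrier A" "bs \<in> power_gens A n"
        by (elim power_gens_Suc_cases)
      then show "gamma_pure R H A \<beta> Tr n (A.merge 0 (a # as)) =
          \<beta>.sweedler ?P (trace_fun ?P (\<lambda>hs. \<epsilon> (hd hs) \<odot>\<^bsub>?P\<^esub> tensor_list R H (tl hs)) a) as"
        using sweedler_counit_face[OF module_power tlH a, of b bs] by (simp add: gamma_pure_Cons)
    qed (rule A.merge_closed, simp_all)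
  next
    case (2 j)
    have g: "alg_face_list A (Suc n) i = A.merge i"
      using 2 by (auto simp: alg_face_list_def A.merge_def)
    have F: "hopf_face_pure R H \<epsilon> \<delta> (Suc n) i = (\<lambda>hs. tensor_list R H (H.merge j hs))"
      using 2 by (auto simp: hopf_face_pure_def H.merge_def)
    show ?thesis
      unfolding g F
    proof (rule gamma_commute[OF _ _ _ _ x])
      show "multilinear R A (tensor_power R A (Suc n)) (Suc (Suc n)) (\<lambda>as. tensor_list R A (A.merge i as))"
        using 2 by (intro A.multilinear_merge[OF mA tlA]) simp
      show "multilinear R H ?P (Suc n) (\<lambda>hs. tensor_list R H (H.merge j hs))"
        by (rule H.multilinear_merge[OF module_power tlH 2(2)])
      show "gamma_pure R H A \<beta> Tr n (A.merge i (a # as)) =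
          \<beta>.sweedler ?P (trace_fun ?P (\<lambda>hs. tensor_list R H (H.merge j hs)) a) as"
        if "a \<in> carrier A" "as \<in> power_gens A (Suc n)" for a as
        using sweedler_merge[OF module_power tlH that 2(2)] 2 by (simp add: gamma_pure_Cons)
    qed (rule A.merge_closed, use 2 in simp_all)
  next
    case 3
    have g: "alg_face_list A (Suc n) i = (\<lambda>as. (last as \<otimes>\<^bsub>A\<^esub> hd as) # butlast (tl as))"
      by (auto simp: alg_face_list_def 3)
    have F: "hopf_face_pure R H \<epsilon> \<delta> (Suc n) i = (\<lambda>hs. \<delta> (last hs) \<odot>\<^bsub>?P\<^esub> tensor_list R H (butlast hs))"
      by (simp add: hopf_face_pure_def 3 fun_eq_iff)
    show ?thesis
      unfolding g F
    proof (rule gamma_commute[OF _ _ _ _ x])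
      show "multilinear R A (tensor_power R A (Suc n)) (Suc (Suc n))
          (\<lambda>as. tensor_list R A ((last as \<otimes>\<^bsub>A\<^esub> hd as) # butlast (tl as)))"
        by (rule A.multilinear_wrap[OF mA tlA]) simp
      show "multilinear R H ?P (Suc n) (\<lambda>hs. \<delta> (last hs) \<odot>\<^bsub>?P\<^esub> tensor_list R H (butlast hs))"
        by (rule multilinear_smult_butlast[OF H.module_axioms module_power tlH \<delta>_linear])
      fix as assume "as \<in> power_gens A (Suc (Suc n))"
      then obtain a bs where a: "as = a # bs" "a \<in> carrier A" "bs \<in> power_gens A (Suc n)"
        by (rule power_gens_Suc_cases)
      from a(3) obtain z cs where "bs = cs @ [z]" "z \<in> carrier A" "cs \<in> power_gens A n"
        by (rule power_gens_snoc_cases)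
      then show "(last as \<otimes>\<^bsub>A\<^esub> hd as) # butlast (tl as) \<in> power_gens A (Suc n)"
        using a by (simp add: power_gens_Cons)
    next
      fix a as assume a: "a \<in> carrier A" and "as \<in> power_gens A (Suc n)"
      from this(2) obtain z cs where "as = cs @ [z]" "z \<in> carrier A" "cs \<in> power_gens A n"
        by (rule power_gens_snoc_cases)
      then show "gamma_pure R H A \<beta> Tr n ((last (a # as) \<otimes>\<^bsub>A\<^esub> hd (a # as)) # butlast (tl (a # as))) =
          \<beta>.sweedler ?P (trace_fun ?P (\<lambda>hs. \<delta> (last hs) \<odot>\<^bsub>?P\<^esub> tensor_list R H (butlast hs)) a) as"
        using sweedler_trace_face[OF module_power tlH a, of z cs] by (simp add: gamma_pure_Cons)
    qed
  qed
qed

lemma gamma_degen: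
  assumes i: "i \<le> n" and x: "x \<in> carrier (tensor_power R A (Suc n))"
  shows "gamma_map R H A \<beta> Tr (Suc n) (tensor_lift R (tensor_power R A (Suc (Suc n)))
      (\<lambda>as. tensor_list R A (take (Suc i) as @ [\<one>\<^bsub>A\<^esub>] @ drop (Suc i) as)) x) =
    tensor_lift R (tensor_power R H (Suc n)) (\<lambda>hs. tensor_list R H (take i hs @ [\<one>\<^bsub>H\<^esub>] @ drop i hs))
      (gamma_map R H A \<beta> Tr n x)"
proof (rule gamma_commute[OF _ _ _ _ x])
  note tlA = multilinear_tensor_list[OF A.module_axioms, of "Suc (Suc n)"]
  note tlH = multilinear_tensor_list[OF H.module_axioms, of "Suc n"]
  show "multilinear R A (tensor_power R A (Suc (Suc n))) (Suc n)
      (\<lambda>as. tensor_list R A (take (Suc i) as @ [\<one>\<^bsub>A\<^esub>] @ drop (Suc i) as))"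
    using multilinear_insert[OF tlA A.one_closed, of "Suc i"] i by simp
  show "multilinear R H (tensor_power R H (Suc n)) n
      (\<lambda>hs. tensor_list R H (take i hs @ [\<one>\<^bsub>H\<^esub>] @ drop i hs))"
    using multilinear_insert[OF tlH H.one_closed i] by simp
  show "take (Suc i) as @ [\<one>\<^bsub>A\<^esub>] @ drop (Suc i) as \<in> power_gens A (Suc (Suc n))"
    if "as \<in> power_gens A (Suc n)" for as
    using that i by (auto simp: power_gens_def dest: in_set_takeD in_set_dropD)
  show "gamma_pure R H A \<beta> Tr (Suc n) (take (Suc i) (a # as) @ [\<one>\<^bsub>A\<^esub>] @ drop (Suc i) (a # as)) =
      \<beta>.sweedler (tensor_power R H (Suc n)) (trace_fun (tensor_power R H (Suc n))
        (\<lambda>hs. tensor_list R H (take i hs @ [\<one>\<^bsub>H\<^esub>] @ drop i hs)) a) as"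
    if "a \<in> carrier A" "as \<in> power_gens A n" for a as
    using sweedler_degen[OF module_power tlH that i] by (simp add: gamma_pure_Cons)
qed

section \<open>Compatibility with the cyclic operators\<close>

lemma bilin_smult:
  assumes Q: "module R Q" and \<phi>: "linear_map R A (base_module R) \<phi>" and f: "linear_map R H Q f"
  shows "\<beta>.bilin Q (\<lambda>p. \<phi> (fst p) \<odot>\<^bsub>Q\<^esub> f (snd p))"
  using linear_map_smult_const[OF Q \<phi>] linear_map_closed[OF f] linear_map_closed[OF \<phi>]
    linear_map_const_smult[OF Q f]
  by (intro compatible_tensorI[OF A.module_axioms H.module_axioms Q]) (simp_all add: base_simps)

text \<open>Invariance is an identity in \<open>H\<close>; a linear \<open>L\<close> is applied to
  it and moved inside both sums. The bilinearity of the two summands is recorded as well, since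
  these sums are nested into larger ones later.\<close>

lemma invariant_lift:
  assumes P: "module R P" and a: "a \<in> carrier A" and b: "b \<in> carrier A" and L: "linear_map R H P L"
  shows "tensor_lift R P (\<lambda>p. Tr (a \<otimes>\<^bsub>A\<^esub> fst p) \<odot>\<^bsub>P\<^esub> L (twisted_antipode H S \<sigma> (snd p))) (\<beta> b) =
    tensor_lift R P (\<lambda>p. Tr (fst p \<otimes>\<^bsub>A\<^esub> b) \<odot>\<^bsub>P\<^esub> L (snd p)) (\<beta> a)"
    and "\<beta>.bilin P (\<lambda>p. Tr (a \<otimes>\<^bsub>A\<^esub> fst p) \<odot>\<^bsub>P\<^esub> L (twisted_antipode H S \<sigma> (snd p)))"
    and "\<beta>.bilin P (\<lambda>p. Tr (fst p \<otimes>\<^bsub>A\<^esub> b) \<odot>\<^bsub>P\<^esub> L (snd p))"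
proof -
  note l = linear_map_comp[OF A.linear_map_mult_left[OF a] Tr_linear]
    and r = linear_map_comp[OF A.linear_map_mult_right[OF b] Tr_linear]
  show bl: "\<beta>.bilin P (\<lambda>p. Tr (a \<otimes>\<^bsub>A\<^esub> fst p) \<odot>\<^bsub>P\<^esub> L (twisted_antipode H S \<sigma> (snd p)))"
    by (rule bilin_smult[OF P l linear_map_comp[OF twisted_antipode_linear L]])
  show br: "\<beta>.bilin P (\<lambda>p. Tr (fst p \<otimes>\<^bsub>A\<^esub> b) \<odot>\<^bsub>P\<^esub> L (snd p))"
    by (rule bilin_smult[OF P r L])
  have "tensor_lift R P (\<lambda>p. Tr (a \<otimes>\<^bsub>A\<^esub> fst p) \<odot>\<^bsub>P\<^esub> L (twisted_antipode H S \<sigma> (snd p))) (\<beta> b) =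
      L (tensor_lift R H (\<lambda>p. Tr (a \<otimes>\<^bsub>A\<^esub> fst p) \<odot>\<^bsub>H\<^esub> twisted_antipode H S \<sigma> (snd p)) (\<beta> b))"
  proof -
    note t = bilin_smult[OF H.module_axioms l twisted_antipode_linear]
    have "L (tensor_lift R H (\<lambda>p. Tr (a \<otimes>\<^bsub>A\<^esub> fst p) \<odot>\<^bsub>H\<^esub> twisted_antipode H S \<sigma> (snd p)) (\<beta> b)) =
        tensor_lift R P (\<lambda>p. L (Tr (a \<otimes>\<^bsub>A\<^esub> fst p) \<odot>\<^bsub>H\<^esub> twisted_antipode H S \<sigma> (snd p))) (\<beta> b)"
      by (rule AH.tensor_lift_linear[OF H.module_axioms P t L \<beta>.coaction_closed[OF b]])
    also have "\<dots> = tensor_lift R P (\<lambda>p. Tr (a \<otimes>\<^bsub>A\<^esub> fst p) \<odot>\<^bsub>P\<^esub> L (twisted_antipode H S \<sigma> (snd p))) (\<beta> b)"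
      by (rule AH.tensor_lift_cong[OF P bl _ \<beta>.coaction_closed[OF b]])
        (auto simp: linear_map_smult[OF L] Tr_closed a linear_map_closed[OF twisted_antipode_linear])
    finally show ?thesis by simp
  qed
  also have "\<dots> = L (tensor_lift R H (\<lambda>p. Tr (fst p \<otimes>\<^bsub>A\<^esub> b) \<odot>\<^bsub>H\<^esub> snd p) (\<beta> a))"
    using invariant a b by (simp add: sigma_invariant_def case_prod_beta')
  also have "\<dots> = tensor_lift R P (\<lambda>p. Tr (fst p \<otimes>\<^bsub>A\<^esub> b) \<odot>\<^bsub>P\<^esub> L (snd p)) (\<beta> a)"
  proof -
    note t = bilin_smult[OF H.module_axioms r linear_map_id]
    have "L (tensor_lift R H (\<lambda>p. Tr (fst p \<otimes>\<^bsub>A\<^esub> b) \<odot>\<^bsub>H\<^esub> snd p) (\<beta> a)) =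
        tensor_lift R P (\<lambda>p. L (Tr (fst p \<otimes>\<^bsub>A\<^esub> b) \<odot>\<^bsub>H\<^esub> snd p)) (\<beta> a)"
      by (rule AH.tensor_lift_linear[OF H.module_axioms P t L \<beta>.coaction_closed[OF a]])
    also have "\<dots> = tensor_lift R P (\<lambda>p. Tr (fst p \<otimes>\<^bsub>A\<^esub> b) \<odot>\<^bsub>P\<^esub> L (snd p)) (\<beta> a)"
      by (rule AH.tensor_lift_cong[OF P br _ \<beta>.coaction_closed[OF a]])
        (auto simp: linear_map_smult[OF L] Tr_closed b)
    finally show ?thesis .
  qed
  finally show "tensor_lift R P (\<lambda>p. Tr (a \<otimes>\<^bsub>A\<^esub> fst p) \<odot>\<^bsub>P\<^esub> L (twisted_antipode H S \<sigma> (snd p))) (\<beta> b) =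
    tensor_lift R P (\<lambda>p. Tr (fst p \<otimes>\<^bsub>A\<^esub> b) \<odot>\<^bsub>P\<^esub> L (snd p)) (\<beta> a)" .
qed

context
  fixes m :: nat
begin

abbreviation "cyc_mod \<equiv> tensor_power R H (Suc m)"

text \<open>The summand of the cyclic operator with a free first entry \<open>y\<close> in place of
  the antipode term. As a linear function of \<open>y\<close> it is the \<open>L\<close> for
  \<open>invariant_lift\<close>; as a function of \<open>zs\<close> it has the shape required by
  \<open>sweedler_trace_face\<close>.\<close>

abbreviation "cyc_pair y zs \<equiv> \<delta> (last zs) \<odot>\<^bsub>cyc_mod\<^esub> tensor_list R H (y # butlast zs)"

abbreviation "cyc_term ys zs \<equiv> cyc_pair (twisted_antipode H S \<sigma> (list_mult H ys)) zs"

lemma multilinear_tensor_list_Cons: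
  "y \<in> carrier H \<Longrightarrow> multilinear R H cyc_mod m (\<lambda>hs. tensor_list R H (y # hs))"
  by (rule multilinear_Cons[OF multilinear_tensor_list[OF H.module_axioms]])

lemma multilinear_cyc_pair: "y \<in> carrier H \<Longrightarrow> multilinear R H cyc_mod (Suc m) (cyc_pair y)"
  by (rule multilinear_smult_butlast[OF H.module_axioms module_power multilinear_tensor_list_Cons \<delta>_linear])

lemma linear_map_cyc_pair:
  assumes "zs \<in> power_gens H (Suc m)"
  shows "linear_map R H cyc_mod (\<lambda>y. cyc_pair y zs)"
proof -
  obtain z ys where zs: "zs = ys @ [z]" "z \<in> carrier H" "ys \<in> power_gens H m"
    using assms by (rule power_gens_snoc_cases)
  show ?thesis
    using linear_map_const_smult[OF module_power
        multilinear_head[OF multilinear_tensor_list[OF H.module_axioms] zs(3)] \<delta>_closed[OF zs(2)]]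
    by (simp add: zs(1))
qed

lemma multilinear_cyc_term:
  shows "zs \<in> power_gens H (Suc m) \<Longrightarrow> multilinear R H cyc_mod (Suc m) (\<lambda>ys. cyc_term ys zs)"
    and "ys \<in> power_gens H (Suc m) \<Longrightarrow> multilinear R H cyc_mod (Suc m) (cyc_term ys)"
proof -
  show "multilinear R H cyc_mod (Suc m) (\<lambda>ys. cyc_term ys zs)" if "zs \<in> power_gens H (Suc m)"
    using multilinear_comp[OF H.multilinear_list_mult
        linear_map_comp[OF twisted_antipode_linear linear_map_cyc_pair[OF that]]] .
  show "multilinear R H cyc_mod (Suc m) (cyc_term ys)" if "ys \<in> power_gens H (Suc m)"
    using that linear_map_closed[OF twisted_antipode_linear] H.list_mult_closed[of ys]
    by (intro multilinear_cyc_pair) (simp add: power_gens_def)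
qed

lemma multibil_cyc_term:
  "\<Delta>.multibil cyc_mod (Suc m) (\<lambda>qs. cyc_term (map fst qs) (map snd qs))"
  by (rule multibilinearI[OF H.module_axioms H.module_axioms module_power multilinear_cyc_term])

lemma hopf_cyc_pure_eq:
  assumes "hs \<in> power_gens H (Suc m)"
  shows "hopf_cyc_pure R H \<Delta> S \<delta> \<sigma> (Suc m) hs =
    \<Delta>.sweedler cyc_mod (\<lambda>qs. cyc_term (map fst qs) (map snd qs)) hs"
  unfolding hopf_cyc_pure_def
proof (rule \<Delta>.sweedler_cong[OF module_power assms multibil_cyc_term])
  fix qs assume "qs \<in> \<Delta>.pairs (Suc m)"
  \<comment> \<open>For a nonempty list \<open>last\<close> commutes with \<open>map snd\<close>;
    this is where the degree must be positive.\<close>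
  then have "qs \<noteq> []" by (auto simp: pair_lists_def)
  then show "\<delta> (snd (last qs)) \<odot>\<^bsub>cyc_mod\<^esub>
      tensor_list R H (twisted_antipode H S \<sigma> (list_mult H (map fst qs)) # map snd (butlast qs)) =
    cyc_term (map fst qs) (map snd qs)"
    by (simp add: last_map map_butlast)
qed

lemma multilinear_hopf_cyc_pure:
  "multilinear R H cyc_mod (Suc m) (hopf_cyc_pure R H \<Delta> S \<delta> \<sigma> (Suc m))"
  by (rule multilinear_cong[OF H.module_axioms
        \<Delta>.multilinear_sweedler[OF module_power multibil_cyc_term] hopf_cyc_pure_eq])

lemma trimultilinear_cyc_term:
  assumes a: "a \<in> carrier A"
  shows "trimultilinear R A H cyc_mod (Suc m)
    (\<lambda>xs ys zs. Tr (a \<otimes>\<^bsub>A\<^esub> list_mult A xs) \<odot>\<^bsub>cyc_mod\<^esub> cyc_term ys zs)"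
  unfolding trimultilinear_def
proof (intro conjI ballI)
  have c: "Tr (a \<otimes>\<^bsub>A\<^esub> list_mult A xs) \<in> carrier R" if "xs \<in> power_gens A (Suc m)" for xs
    using a that A.list_mult_closed[of xs] by (simp add: power_gens_def Tr_closed)
  show "multilinear R A cyc_mod (Suc m) (\<lambda>xs. Tr (a \<otimes>\<^bsub>A\<^esub> list_mult A xs) \<odot>\<^bsub>cyc_mod\<^esub> cyc_term ys zs)"
    if "ys \<in> power_gens H (Suc m)" "zs \<in> power_gens H (Suc m)" for ys zs
    using multilinear_comp[OF A.multilinear_list_mult linear_map_smult_const[OF module_power
          linear_map_comp[OF A.linear_map_mult_left[OF a] Tr_linear]
          multilinear_closed[OF multilinear_cyc_term(1)[OF that(2)] that(1)]]] .
  show "multilinear R H cyc_mod (Suc m) (\<lambda>ys. Tr (a \<otimes>\<^bsub>A\<^esub> list_mult A xs) \<odot>\<^bsub>cyc_mod\<^esub> cyc_term ys zs)"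
    if "xs \<in> power_gens A (Suc m)" "zs \<in> power_gens H (Suc m)" for xs zs
    using multilinear_comp[OF multilinear_cyc_term(1)[OF that(2)]
        linear_map_const_smult[OF module_power linear_map_id c[OF that(1)]]] .
  show "multilinear R H cyc_mod (Suc m) (\<lambda>zs. Tr (a \<otimes>\<^bsub>A\<^esub> list_mult A xs) \<odot>\<^bsub>cyc_mod\<^esub> cyc_term ys zs)"
    if "xs \<in> power_gens A (Suc m)" "ys \<in> power_gens H (Suc m)" for xs ys
    using multilinear_comp[OF multilinear_cyc_term(2)[OF that(2)]
        linear_map_const_smult[OF module_power linear_map_id c[OF that(1)]]] .
qed

text \<open>The cyclic operator on pure tensors in degree \<open>Suc m\<close>, with
  \<open>a\<close> for a_0 and \<open>z\<close> for the last entry; the right side is \<gamma> of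
  the rotated tensor.\<close>

lemma sweedler_cyc:
  assumes a: "a \<in> carrier A" and z: "z \<in> carrier A" and as: "as \<in> power_gens A m"
  shows "\<beta>.sweedler cyc_mod (trace_fun cyc_mod (hopf_cyc_pure R H \<Delta> S \<delta> \<sigma> (Suc m)) a) (as @ [z]) =
    gamma_pure R H A \<beta> Tr (Suc m) (z # a # as)"
proof -
  let ?P = cyc_mod
  let ?F = "\<lambda>xs ys zs. Tr (a \<otimes>\<^bsub>A\<^esub> list_mult A xs) \<odot>\<^bsub>?P\<^esub> cyc_term ys zs"
  note P = module_power[of "Suc m"]
  have bs: "as @ [z] \<in> power_gens A (Suc m)" using as z by (simp add: power_gens_def)
  note F = trimultilinear_cyc_term[OF a]
  have Tr_smult: "Tr (a \<otimes>\<^bsub>A\<^esub> list_mult A (map fst ps)) \<in> carrier R" if "ps \<in> \<beta>.pairs (Suc m)" for ps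
    using a list_mult_fst_closed[OF that] by (simp add: Tr_closed)
  have "\<beta>.sweedler ?P (trace_fun ?P (hopf_cyc_pure R H \<Delta> S \<delta> \<sigma> (Suc m)) a) (as @ [z]) =
      \<beta>.sweedler ?P (\<lambda>ps. \<Delta>.sweedler ?P (\<lambda>qs. ?F (map fst ps) (map fst qs) (map snd qs)) (map snd ps)) (as @ [z])"
  proof (rule \<beta>.sweedler_cong[OF P bs multibil_comult_comp[OF P F]])
    fix ps assume ps: "ps \<in> \<beta>.pairs (Suc m)"
    note hs = pair_lists_map(2)[OF ps]
    show "trace_fun ?P (hopf_cyc_pure R H \<Delta> S \<delta> \<sigma> (Suc m)) a ps =
        \<Delta>.sweedler ?P (\<lambda>qs. ?F (map fst ps) (map fst qs) (map snd qs)) (map snd ps)"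
      unfolding trace_fun_def hopf_cyc_pure_eq[OF hs]
      by (rule \<Delta>.sweedler_linear[OF P P linear_map_const_smult[OF P linear_map_id Tr_smult[OF ps]]
            hs multibil_cyc_term])
  qed
  \<comment> \<open>From here on \<open>map snd rs\<close> holds the middle legs, which stand under
    the antipode, and \<open>map snd ps\<close> the outer legs, which make up the rest of the tensor
    and the factor \<delta>.\<close>
  also have "\<dots> = \<beta>.sweedler ?P (\<lambda>ps. \<beta>.sweedler ?P
      (\<lambda>rs. ?F (map fst rs) (map snd rs) (map snd ps)) (map fst ps)) (as @ [z])"
    by (rule sweedler_coassoc[OF P F bs])
  \<comment> \<open>For fixed \<open>ps\<close> the inner summand depends on \<open>rs\<close> only
    through the products of its two kinds of legs, so \<open>sweedler_list_mult\<close> makes the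
    inner sum a coaction on a single element of \<open>A\<close>, the form needed by
    \<open>invariant_lift\<close>.\<close>
  also have "\<dots> = \<beta>.sweedler ?P (\<lambda>ps. tensor_lift R ?P
      (\<lambda>p. trace_fun ?P (cyc_pair (snd p)) (fst p) ps) (\<beta> a)) (as @ [z])"
  proof (rule \<beta>.sweedler_cong[OF P bs multibil_coaction_comp[OF P F], symmetric])
    fix ps assume ps: "ps \<in> \<beta>.pairs (Suc m)"
    note hs = pair_lists_map(2)[OF ps]
    have b: "list_mult A (map fst ps) \<in> carrier A" by (rule list_mult_fst_closed[OF ps])
    let ?K = "\<lambda>p. Tr (a \<otimes>\<^bsub>A\<^esub> fst p) \<odot>\<^bsub>?P\<^esub> cyc_pair (twisted_antipode H S \<sigma> (snd p)) (map snd ps)"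
    have "\<beta>.sweedler ?P (\<lambda>rs. ?F (map fst rs) (map snd rs) (map snd ps)) (map fst ps) =
        tensor_lift R ?P ?K (\<beta> (list_mult A (map fst ps)))"
      using sweedler_list_mult[OF P invariant_lift(2)[OF P a b linear_map_cyc_pair[OF hs]]
          pair_lists_map(1)[OF ps]] by simp
    also have "\<dots> = tensor_lift R ?P (\<lambda>p. trace_fun ?P (cyc_pair (snd p)) (fst p) ps) (\<beta> a)"
      unfolding trace_fun_def
      by (rule invariant_lift(1)[OF P a b linear_map_cyc_pair[OF hs]])
    finally show "tensor_lift R ?P (\<lambda>p. trace_fun ?P (cyc_pair (snd p)) (fst p) ps) (\<beta> a) =
      \<beta>.sweedler ?P (\<lambda>rs. ?F (map fst rs) (map snd rs) (map snd ps)) (map fst ps)" by simp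
  qed
  \<comment> \<open>The coaction on \<open>a\<close> moves outermost because \<open>a\<close> is the
    first entry summed over in the goal.\<close>
  also have "\<dots> = tensor_lift R ?P (\<lambda>p. \<beta>.sweedler ?P
      (trace_fun ?P (cyc_pair (snd p)) (fst p)) (as @ [z])) (\<beta> a)"
  proof (rule \<beta>.sweedler_tensor_lift_swap(1)[OF P \<beta>.presentation_T bs \<beta>.coaction_closed[OF a]])
    show "\<beta>.multibil ?P (Suc m) (trace_fun ?P (cyc_pair (snd p)) (fst p))"
      if "p \<in> carrier A \<times> carrier H" for p
      using that by (intro multibil_trace_fun[OF P multilinear_cyc_pair]) auto
    show "\<beta>.bilin ?P (\<lambda>p. trace_fun ?P (cyc_pair (snd p)) (fst p) ps)" if ps: "ps \<in> \<beta>.pairs (Suc m)" for ps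
      unfolding trace_fun_def
      by (rule invariant_lift(3)[OF P a list_mult_fst_closed[OF ps]
            linear_map_cyc_pair[OF pair_lists_map(2)[OF ps]]])
  qed
  \<comment> \<open>For a fixed pair \<open>p\<close> of legs of \<open>a\<close>, the remaining sum
    is the left side of \<open>sweedler_trace_face\<close> with \<open>snd p\<close> in front of the
    H-tensor. Afterwards \<open>fst p\<close> stands behind \<open>z\<close> in the product, so
    \<open>p\<close> becomes the first pair of the sum for \<open>a # as\<close>.\<close>
  also have "\<dots> = \<beta>.sweedler ?P (trace_fun ?P (tensor_list R H) z) (a # as)"
  proof (rule \<beta>.sweedler_Cons_cong[OF P a as])
    show T: "\<beta>.multibil ?P (Suc m) (trace_fun ?P (tensor_list R H) z)"
      by (rule multibil_trace_fun[OF P multilinear_tensor_list[OF H.module_axioms] z])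
    fix p assume p: "p \<in> carrier A \<times> carrier H"
    then have p': "fst p \<in> carrier A" "snd p \<in> carrier H" by auto
    have "\<beta>.sweedler ?P (trace_fun ?P (cyc_pair (snd p)) (fst p)) (as @ [z]) =
        \<beta>.sweedler ?P (trace_fun ?P (\<lambda>hs. tensor_list R H (snd p # hs)) (z \<otimes>\<^bsub>A\<^esub> fst p)) as"
      by (rule sweedler_trace_face[OF P multilinear_tensor_list_Cons[OF p'(2)] p'(1) z as])
    also have "\<dots> = \<beta>.sweedler ?P (\<lambda>ps. trace_fun ?P (tensor_list R H) z (p # ps)) as"
      using p' z list_mult_fst_closed
      by (intro \<beta>.sweedler_cong[OF P as multibilinear_Cons[OF T p]])
        (simp add: trace_fun_def A.list_mult_Cons A.m_assoc)
    finally show "\<beta>.sweedler ?P (trace_fun ?P (cyc_pair (snd p)) (fst p)) (as @ [z]) =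
      \<beta>.sweedler ?P (\<lambda>ps. trace_fun ?P (tensor_list R H) z (p # ps)) as" .
  qed
  finally show ?thesis by (simp add: gamma_pure_Cons)
qed

end

lemma gamma_cyc:
  assumes x: "x \<in> carrier (tensor_power R A (Suc n))"
  shows "gamma_map R H A \<beta> Tr n
      (tensor_lift R (tensor_power R A (Suc n)) (\<lambda>as. tensor_list R A (last as # butlast as)) x) =
    (if n = 0 then gamma_map R H A \<beta> Tr n x
     else tensor_lift R (tensor_power R H n) (hopf_cyc_pure R H \<Delta> S \<delta> \<sigma> n) (gamma_map R H A \<beta> Tr n x))"
proof -
  let ?A = "tensor_power R A (Suc n)"
  have mA: "module R ?A" by (rule module_tensor_power[OF A.module_axioms])
  have rot: "multilinear R A ?A (Suc n) (\<lambda>as. tensor_list R A (last as # butlast as))"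
    by (rule multilinear_rotate[OF multilinear_tensor_list[OF A.module_axioms]]) simp
  show ?thesis
  proof (cases n)
    case 0
    \<comment> \<open>Rotating a list with one entry changes nothing, which matches the convention
      that the cyclic operator on the Hopf side is the identity in degree 0.\<close>
    have "tensor_lift R ?A (\<lambda>as. tensor_list R A (last as # butlast as)) x = x"
    proof (rule tensor_power_ext[OF A.module_axioms mA linear_map_power_lift[OF A.module_axioms mA rot]
          linear_map_id _ x])
      fix as assume as: "as \<in> power_gens A (Suc n)"
      then obtain a where "as = [a]" using 0 by (auto simp: power_gens_def length_Suc_conv)
      then show "tensor_lift R ?A (\<lambda>as. tensor_list R A (last as # butlast as)) (tensor_list R A as) =
          tensor_list R A as"
        by (subst tensor_lift_tensor_list[OF A.module_axioms mA rot as]) simp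
    qed
    then show ?thesis using 0 by simp
  next
    case (Suc m)
    have "gamma_map R H A \<beta> Tr n
        (tensor_lift R ?A (\<lambda>as. tensor_list R A (last as # butlast as)) x) =
      tensor_lift R (tensor_power R H n) (hopf_cyc_pure R H \<Delta> S \<delta> \<sigma> n) (gamma_map R H A \<beta> Tr n x)"
    proof (rule gamma_commute[OF rot _ _ _ x])
      show "multilinear R H (tensor_power R H n) n (hopf_cyc_pure R H \<Delta> S \<delta> \<sigma> n)"
        unfolding Suc by (rule multilinear_hopf_cyc_pure)
      show "last as # butlast as \<in> power_gens A (Suc n)" if as: "as \<in> power_gens A (Suc n)" for as
        using as by (elim power_gens_snoc_cases) (simp add: power_gens_Cons)
      fix a as assume a: "a \<in> carrier A" "as \<in> power_gens A n"
      from a(2)[unfolded Suc] obtain z bs where "as = bs @ [z]" "z \<in> carrier A" "bs \<in> power_gens A m"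
        by (rule power_gens_snoc_cases)
      then show "gamma_pure R H A \<beta> Tr n (last (a # as) # butlast (a # as)) =
          \<beta>.sweedler (tensor_power R H n)
            (trace_fun (tensor_power R H n) (hopf_cyc_pure R H \<Delta> S \<delta> \<sigma> n) a) as"
        using sweedler_cyc[OF a(1), of z bs m] by (simp add: Suc butlast_append)
    qed
    then show ?thesis using Suc by simp
  qed
qed

end

theorem proposition3p1:
  fixes R :: "('k, 'r) ring_scheme"
    and H :: "('k, 'h, 'u) module_scheme"
    and \<Delta> :: "'h \<Rightarrow> ('h \<times> 'h \<Rightarrow> 'k) set"
    and \<epsilon> :: "'h \<Rightarrow> 'k"
    and S :: "'h \<Rightarrow> 'h"
    and \<delta> :: "'h \<Rightarrow> 'k"
    and \<sigma> :: 'h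
    and A :: "('k, 'a, 'v) module_scheme"
    and \<beta> :: "'a \<Rightarrow> ('a \<times> 'h \<Rightarrow> 'k) set"
    and Tr :: "'a \<Rightarrow> 'k"
  assumes "hopf_algebra R H \<Delta> \<epsilon> S"
    and "modular_pair_in_involution R H \<Delta> \<epsilon> S \<delta> \<sigma>"
    and "comodule_algebra R H \<Delta> \<epsilon> S A \<beta>"
    and "delta_trace R A \<beta> \<delta> Tr"
    and "sigma_invariant R H S \<sigma> A \<beta> Tr"
  shows "cyclic_map R (alg_cyclic R A) (hopf_cyclic R H \<Delta> \<epsilon> S \<delta> \<sigma>) (gamma_map R H A \<beta> Tr)"
proof -
  have "coacting_algebra R H A \<Delta> \<epsilon> S \<beta>"
    using assms(1,3)
    by (simp add: coacting_algebra_def coacting_algebra_axioms_def hopf_algebra_def comodule_algebra_def)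
  then interpret invariant_trace R H A \<Delta> \<epsilon> S \<beta> \<delta> \<sigma> Tr
    using assms(2,4,5)
    by (simp add: invariant_trace_def invariant_trace_axioms_def modular_pair_in_involution_def
        grouplike_def)
  show ?thesis
    unfolding cyclic_map_def alg_cyclic_def hopf_cyclic_def
    using linear_map_gamma gamma_face gamma_degen gamma_cyc by simp
qed

end
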